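(* Let $\mathcal{M}$ be a Type $\mathcal{A}$ model with torsion components $T=(T^1,T^2)$ such that $\dim\mathfrak{K}(\mathcal{M})>2$. Then $\mathcal{M}$ is linearly equivalent to one of the following models $\mathcal{M}_i^j(\star;T)$, with $T=(T^1,T^2)\in\mathbb{R}^2$ restricted to the values listed and with $\mathfrak{K}$ as listed; for the values of $T$ not listed, the given model has $\mathfrak{K}=\mathrm{span}\{\partial_1,\partial_2\}$. (1) $\mathcal{M}_0^6(T):=\mathcal{M}(0,0,T^1,T^2,-T^1,-T^2,0,0)$: (a) $\mathfrak{K}(\mathcal{M}_0^6(0))=\mathrm{span}\{\partial_1,\partial_2,x^1\partial_1,x^1\partial_2,x^2\partial_1,x^2\partial_2\}$; (b) $\mathfrak{K}(\mathcal{M}_0^6(T))=\mathrm{span}\{\partial_1,\partial_2,x^1(T^1\partial_1+T^2\partial_2),x^2(T^1\partial_1+T^2\partial_2)\}$ if $T\ne0$. (2) $\mathcal{M}_1^6(T):=\mathcal{M}(1,0,T^1,1+T^2,-T^1,1-T^2,0,0)$. Then $T^1=0$ and (a) $\mathfrak{K}(\mathcal{M}_1^6(0,0))=\mathrm{span}\{\partial_1,e^{-x^1}(\partial_1-x^2\partial_2),x^2\partial_2,x^2(\partial_1-x^2\partial_2),\partial_2,e^{-x^1}\partial_2\}$; (b) $\mathfrak{K}(\mathcal{M}_1^6(0,T^2))=\mathrm{span}\{\partial_1,\partial_2,x^2\partial_2,e^{-x^1}\partial_2\}$ if $T^2\ne0$. (3) $\mathcal{M}_2^6(T):=\mathcal{M}(-1,0,T^1,T^2,-T^1,-T^2,0,1)$.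 Then $T^1T^2=0$ and (a) $\mathfrak{K}(\mathcal{M}_2^6(0))=\mathrm{span}\{\partial_1,e^{x^1}\partial_1,e^{x^1+x^2}\partial_1,\partial_2,e^{-x^1-x^2}\partial_2,e^{-x^2}\partial_2\}$; (b) $\mathfrak{K}(\mathcal{M}_2^6(T))=\mathrm{span}\{\partial_1,\partial_2,e^{-x^1-x^2}\partial_2,e^{-x^2}\partial_2\}$ if $T^1=0$, $T^2\ne0$; (c) $\mathfrak{K}(\mathcal{M}_2^6(T))=\mathrm{span}\{\partial_1,e^{x^1}\partial_1,e^{x^1+x^2}\partial_1,\partial_2\}$ if $T^1\ne0$, $T^2=0$. (4) $\mathcal{M}_3^6(T):=\mathcal{M}(0,0,T^1,T^2,-T^1,-T^2,0,1)$. Then $T^1T^2=0$ and (a) $\mathfrak{K}(\mathcal{M}_3^6(0))=\mathrm{span}\{\partial_1,x^1\partial_1,e^{x^2}\partial_1,\partial_2,e^{-x^2}\partial_2,x^1e^{-x^2}\partial_2\}$; (b) $\mathfrak{K}(\mathcal{M}_3^6(T))=\mathrm{span}\{\partial_1,\partial_2,e^{-x^2}\partial_2,x^1e^{-x^2}\partial_2\}$ if $T^1=0$, $T^2\ne0$; (c) $\mathfrak{K}(\mathcal{M}_3^6(T))=\mathrm{span}\{\partial_1,\partial_2,x^1\partial_1,e^{x^2}\partial_1\}$ if $T^1\ne0$, $T^2=0$. (5) $\mathcal{M}_4^6(T):=\mathcal{M}(0,0,T^1,T^2,-T^1,-T^2,1,0)$. Then $T^2=0$ and (a) $\mathfrak{K}(\mathcal{M}_4^6(0))=\mathrm{span}\{\partial_1,\partial_2,(x^1+\frac12(x^2)^2)\partial_1,x^2\partial_1,(-x^1x^2-\frac12(x^2)^3)\partial_1+(x^1+\frac12(x^2)^2)\partial_2,-(x^2)^2\partial_1+x^2\partial_2\}$;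 (b) $\mathfrak{K}(\mathcal{M}_4^6(T^1,0))=\mathrm{span}\{\partial_1,\partial_2,(x^1+\frac12(x^2)^2)\partial_1,x^2\partial_1\}$ if $T^1\ne0$. (6) $\mathcal{M}_5^6(T):=\mathcal{M}(1,0,T^1,1+T^2,-T^1,1-T^2,-1,0)$. Then $T=0$ and $\mathfrak{K}(\mathcal{M}_5^6(0))=\mathrm{span}\{\partial_1,\partial_2,\cos(2x^2)\partial_1-\sin(2x^2)\partial_2,\sin(2x^2)\partial_1+\cos(2x^2)\partial_2,e^{-x^1}(\cos(x^2)\partial_1-\sin(x^2)\partial_2),e^{-x^1}(\sin(x^2)\partial_1+\cos(x^2)\partial_2)\}$. (7) $\mathcal{M}_1^4(T):=\mathcal{M}(-1,0,1+T^1,T^2,1-T^1,-T^2,0,2)$. Then $T^2=0$ and $\mathfrak{K}(\mathcal{M}_1^4(T^1,0))=\mathrm{span}\{\partial_1,\partial_2,e^{x^1}\partial_1,x^2e^{x^1}\partial_1\}$. (8) $\mathcal{M}_2^4(c;T):=\mathcal{M}(-1,0,c+T^1,T^2,c-T^1,-T^2,0,1+2c)$ for $c\in\mathbb{R}$, $c\ne0,-1$. Then $T^2=0$ and $\mathfrak{K}(\mathcal{M}_2^4(c;(T^1,0)))=\mathrm{span}\{\partial_1,\partial_2,e^{x^1}\partial_1,e^{x^1+x^2}\partial_1\}$. (9) $\mathcal{M}_3^4(c;T):=\mathcal{M}(0,0,c+T^1,T^2,c-T^1,-T^2,0,1+2c)$ for $c\in\mathbb{R}$, $c\ne0,-1$.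 Then $T^2=0$ and $\mathfrak{K}(\mathcal{M}_3^4(c;(T^1,0)))=\mathrm{span}\{\partial_1,\partial_2,e^{x^2}\partial_1,x^1\partial_1\}$. (10) $\mathcal{M}_4^4(c;T):=\mathcal{M}(0,0,1+T^1,T^2,1-T^1,-T^2,c,2)$, $c\in\mathbb{R}$. Then $T^2=0$ and $\mathfrak{K}(\mathcal{M}_4^4(c;(T^1,0)))=\mathrm{span}\{\partial_1,\partial_2,(x^1+\frac c2(x^2)^2)\partial_1,x^2\partial_1\}$. (11) $\mathcal{M}_5^4(c;T):=\mathcal{M}(1,0,T^1,T^2,-T^1,-T^2,1+c^2,2c)$, $c\in\mathbb{R}$. Then $T^2=0$ and $\mathfrak{K}(\mathcal{M}_5^4(c;(T^1,0)))=\mathrm{span}\{\partial_1,\partial_2,e^{-x^1+cx^2}\cos(x^2)\partial_1,e^{-x^1+cx^2}\sin(x^2)\partial_1\}$. (Here "Then $T^2=0$", etc., means that this condition on $T$ is necessary for the given model to satisfy $\dim\mathfrak{K}>2$.)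
   Context: For $\vec\xi=(\xi_1,\dots,\xi_8)\in\mathbb{R}^8$, $\mathcal{M}(\vec\xi)=(\mathbb{R}^2,\nabla)$ denotes the affine surface whose Christoffel symbols ($\nabla_{\partial_i}\partial_j=\Gamma_{ij}^k\partial_k$, $\partial_k=\partial/\partial x^k$, sums over repeated indices) are the constants $$\Gamma_{11}^1=\xi_1,\ \Gamma_{11}^2=\xi_2,\ \Gamma_{12}^1=\xi_3,\ \Gamma_{12}^2=\xi_4,\ \Gamma_{21}^1=\xi_5,\ \Gamma_{21}^2=\xi_6,\ \Gamma_{22}^1=\xi_7,\ \Gamma_{22}^2=\xi_8.$$ These are the Type $\mathcal{A}$ models (torsion is allowed and may vanish). The torsion components are $T^i=\frac12(\Gamma_{12}^i-\Gamma_{21}^i)$, $i=1,2$. $\mathrm{GL}(2,\mathbb{R})$ acts on the Type $\mathcal{A}$ models by linear change of coordinates on $\mathbb{R}^2$, hence linearly on $\mathbb{R}^8$; two Type $\mathcal{A}$ models are linearly equivalent if they lie in the same orbit. A smooth vector field $X=v^1\partial_1+v^2\partial_2$ is an affine Killing vector field if the Lie derivative of $\nabla$ with respect to $X$ vanishes; equivalently, for all $1\le i,j,k\le2$, $$0=\frac{\partial^2 v^k}{\partial x^i\partial x^j}+v^l\frac{\partial\Gamma_{ij}^k}{\partial x^l}-\Gamma_{ij}^l\frac{\partial v^k}{\partial x^l}+\Gamma_{il}^k\frac{\partial v^l}{\partial x^j}+\Gamma_{lj}^k\frac{\partial v^l}{\partial x^i}.$$ $\mathfrak{K}(\mathcal{M})$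 is the real Lie algebra of affine Killing vector fields on $\mathcal{M}$; spans are over $\mathbb{R}$. For a Type $\mathcal{A}$ model, $\partial_1,\partial_2\in\mathfrak{K}(\mathcal{M})$. *)

theory Defs
  imports "HOL-Analysis.Analysis" "HOL-Library.Function_Algebras"
begin

text \<open>Pointwise scalar multiplication turns a space of functions, in particular that of vector
  fields on the plane, into a real vector space, so that \<^term>\<open>span\<close> and \<^term>\<open>dim\<close> apply to it.\<close>

instantiation "fun" :: (type, real_vector) real_vector
begin

definition scaleR_fun_def: "scaleR c f = (\<lambda>x. c *\<^sub>R f x)"

instance
  by standard (simp_all add: scaleR_fun_def fun_eq_iff scaleR_add_right scaleR_add_left)

end

lemma scaleR_fun_apply [simp]: "(c *\<^sub>R f) x = c *\<^sub>R f x"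
  by (simp add: scaleR_fun_def)

lemma vector_8 [simp]:
  fixes a b c d e f g h :: "'a::zero"
  defines "v \<equiv> (vector [a, b, c, d, e, f, g, h] :: 'a^8)"
  shows "v $ 1 = a" "v $ 2 = b" "v $ 3 = c" "v $ 4 = d"
    "v $ 5 = e" "v $ 6 = f" "v $ 7 = g" "v $ 8 = h"
  unfolding v_def vector_def by simp_all


section \<open>Smooth functions on the plane\<close>

definition partial :: "2 \<Rightarrow> (real^2 \<Rightarrow> 'b::real_normed_vector) \<Rightarrow> real^2 \<Rightarrow> 'b" where
  "partial i f x = frechet_derivative f (at x) (axis i 1)"

primrec C_times :: "nat \<Rightarrow> (real^2 \<Rightarrow> 'b::real_normed_vector) \<Rightarrow> bool" where
  "C_times 0 f \<longleftrightarrow> continuous_on UNIV f"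
| "C_times (Suc n) f \<longleftrightarrow> (\<forall>x. f differentiable (at x)) \<and> (\<forall>i. C_times n (partial i f))"

definition smooth :: "(real^2 \<Rightarrow> 'b::real_normed_vector) \<Rightarrow> bool" where
  "smooth f \<longleftrightarrow> (\<forall>n. C_times n f)"


section \<open>Affine connections on the plane and their Killing fields\<close>

text \<open>A connection is given by its Christoffel symbols in the standard coordinates:
  \<open>\<Gamma> i j k x\<close> is the coefficient of the \<open>k\<close>-th coordinate field in the covariant derivative
  along the \<open>i\<close>-th of the \<open>j\<close>-th one. No symmetry in \<open>i\<close>, \<open>j\<close> is required.\<close>

type_synonym connection = "2 \<Rightarrow> 2 \<Rightarrow> 2 \<Rightarrow> real^2 \<Rightarrow> real"

text \<open>The components of the Lie derivative of the connection in the direction of \<open>v\<close>.\<close>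

definition lie_connection :: "connection \<Rightarrow> (real^2 \<Rightarrow> real^2) \<Rightarrow> connection" where
  "lie_connection \<Gamma> v i j k x =
     partial i (partial j (\<lambda>y. v y $ k)) x
     + (\<Sum>l\<in>UNIV. v x $ l * partial l (\<Gamma> i j k) x)
     - (\<Sum>l\<in>UNIV. \<Gamma> i j l x * partial l (\<lambda>y. v y $ k) x)
     + (\<Sum>l\<in>UNIV. \<Gamma> i l k x * partial j (\<lambda>y. v y $ l) x)
     + (\<Sum>l\<in>UNIV. \<Gamma> l j k x * partial i (\<lambda>y. v y $ l) x)"

definition killing :: "connection \<Rightarrow> (real^2 \<Rightarrow> real^2) set" where
  "killing \<Gamma> = {v. smooth v \<and> (\<forall>i j k x. lie_connection \<Gamma> v i j k x = 0)}"


section \<open>Type A models\<close>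

definition christoffel :: "real^8 \<Rightarrow> 2 \<Rightarrow> 2 \<Rightarrow> 2 \<Rightarrow> real" where
  "christoffel \<xi> i j k =
     (if i = 1 \<and> j = 1 then (if k = 1 then \<xi> $ 1 else \<xi> $ 2)
      else if i = 1 \<and> j = 2 then (if k = 1 then \<xi> $ 3 else \<xi> $ 4)
      else if i = 2 \<and> j = 1 then (if k = 1 then \<xi> $ 5 else \<xi> $ 6)
      else (if k = 1 then \<xi> $ 7 else \<xi> $ 8))"

definition type_A :: "real^8 \<Rightarrow> connection" where
  "type_A \<xi> i j k = (\<lambda>x. christoffel \<xi> i j k)"

definition torsion :: "real^8 \<Rightarrow> real^2" where
  "torsion \<xi> = (\<chi> i. (christoffel \<xi> 1 2 i - christoffel \<xi> 2 1 i) / 2)"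

text \<open>The Christoffel symbols of the model \<open>\<xi>\<close> in the new linear coordinates \<open>y = A x\<close>,
  in which the coordinate fields are the columns of the inverse of \<open>A\<close>. For invertible \<open>A\<close>
  this is the (left) action of the general linear group on the models.\<close>

definition transformed_symbol :: "real^2^2 \<Rightarrow> real^8 \<Rightarrow> 2 \<Rightarrow> 2 \<Rightarrow> 2 \<Rightarrow> real" where
  "transformed_symbol A \<xi> i j k =
     (\<Sum>p\<in>UNIV. \<Sum>q\<in>UNIV. \<Sum>r\<in>UNIV.
        matrix_inv A $ p $ i * matrix_inv A $ q $ j * A $ k $ r * christoffel \<xi> p q r)"

definition gl_act :: "real^2^2 \<Rightarrow> real^8 \<Rightarrow> real^8" where
  "gl_act A \<xi> = (let \<Gamma> = transformed_symbol A \<xi> in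
     vector [\<Gamma> 1 1 1, \<Gamma> 1 1 2, \<Gamma> 1 2 1, \<Gamma> 1 2 2, \<Gamma> 2 1 1, \<Gamma> 2 1 2, \<Gamma> 2 2 1, \<Gamma> 2 2 2])"

lemma christoffel_gl_act: "christoffel (gl_act A \<xi>) = transformed_symbol A \<xi>"
proof (intro ext)
  fix i j k :: 2
  show "christoffel (gl_act A \<xi>) i j k = transformed_symbol A \<xi> i j k"
    using exhaust_2[of i] exhaust_2[of j] exhaust_2[of k]
    by (auto simp: christoffel_def gl_act_def Let_def)
qed

definition linearly_equivalent :: "real^8 \<Rightarrow> real^8 \<Rightarrow> bool" where
  "linearly_equivalent \<xi> \<eta> \<longleftrightarrow> (\<exists>A. invertible A \<and> \<eta> = gl_act A \<xi>)"


section \<open>The model families\<close>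

text \<open>In \<open>M6_i\<close> and \<open>M4_i\<close> the digit after \<open>M\<close> is the upper index of the family, the dimension of
  the space of Killing fields of the torsion free representatives.\<close>

definition M6_0 :: "real^2 \<Rightarrow> real^8" where
  "M6_0 T = vector [0, 0, T$1, T$2, - T$1, - T$2, 0, 0]"

definition M6_1 :: "real^2 \<Rightarrow> real^8" where
  "M6_1 T = vector [1, 0, T$1, 1 + T$2, - T$1, 1 - T$2, 0, 0]"

definition M6_2 :: "real^2 \<Rightarrow> real^8" where
  "M6_2 T = vector [-1, 0, T$1, T$2, - T$1, - T$2, 0, 1]"

definition M6_3 :: "real^2 \<Rightarrow> real^8" where
  "M6_3 T = vector [0, 0, T$1, T$2, - T$1, - T$2, 0, 1]"

definition M6_4 :: "real^2 \<Rightarrow> real^8" where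
  "M6_4 T = vector [0, 0, T$1, T$2, - T$1, - T$2, 1, 0]"

definition M6_5 :: "real^2 \<Rightarrow> real^8" where
  "M6_5 T = vector [1, 0, T$1, 1 + T$2, - T$1, 1 - T$2, -1, 0]"

definition M4_1 :: "real^2 \<Rightarrow> real^8" where
  "M4_1 T = vector [-1, 0, 1 + T$1, T$2, 1 - T$1, - T$2, 0, 2]"

definition M4_2 :: "real \<Rightarrow> real^2 \<Rightarrow> real^8" where
  "M4_2 c T = vector [-1, 0, c + T$1, T$2, c - T$1, - T$2, 0, 1 + 2 * c]"

definition M4_3 :: "real \<Rightarrow> real^2 \<Rightarrow> real^8" where
  "M4_3 c T = vector [0, 0, c + T$1, T$2, c - T$1, - T$2, 0, 1 + 2 * c]"

definition M4_4 :: "real \<Rightarrow> real^2 \<Rightarrow> real^8" where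
  "M4_4 c T = vector [0, 0, 1 + T$1, T$2, 1 - T$1, - T$2, c, 2]"

definition M4_5 :: "real \<Rightarrow> real^2 \<Rightarrow> real^8" where
  "M4_5 c T = vector [1, 0, T$1, T$2, - T$1, - T$2, 1 + c\<^sup>2, 2 * c]"


section \<open>Coordinate vector fields\<close>

definition d1 :: "real^2 \<Rightarrow> real^2" where "d1 = (\<lambda>x. axis 1 1)"

definition d2 :: "real^2 \<Rightarrow> real^2" where "d2 = (\<lambda>x. axis 2 1)"

text \<open>Pitfall: \<^term>\<open>dim\<close> is 0 on infinite-dimensional spaces. This does no harm for spaces of
  Killing fields of type A models: the Killing equations express the second derivatives of a field
  linearly by its first derivatives, so these spaces have dimension at most 6.\<close>

abbreviation KK :: "real^8 \<Rightarrow> (real^2 \<Rightarrow> real^2) set" where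
  "KK \<xi> \<equiv> killing (type_A \<xi>)"

end

theory Submission
  imports Defs
begin

text \<open>
  The coefficients of the Killing equation of a type A model \<open>\<xi>\<close> are constant. It
  expresses the derivatives of the Jacobian \<open>P\<close> of a Killing field \<open>v\<close>
  linearly by \<open>P\<close>, so \<open>v\<close> is determined by its 1-jet at the origin
  (\<open>killing_jet_eq\<close>), and spaces of Killing fields can be compared by comparing 1-jets.
  The jets that occur are restricted by compatibility conditions, both consequences of the symmetry
  of second derivatives (\<open>partial_commute\<close>):

  \<^item> the part of the Killing equation that is antisymmetric in the two lower indices says that each
    column of \<open>P\<close> is a multiple of the torsion vector \<open>T\<close>, if \<open>T\<close> is not zero (\<open>torsion_invariant\<close>);
  \<^item> comparing third derivatives of \<open>v\<close> shows that \<open>P\<close> preserves infinitesimally the Ricci tensor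
    of the symmetric part of the connection (\<open>jet_system.ricci_invariant\<close>).

  More than two independent Killing fields means that some Killing field is not constant. A
  nondegenerate Ricci tensor excludes this: \<open>v\<close> is then a Killing field of a flat,
  possibly indefinite metric, so \<open>P\<close> is a constant derivation of the symmetric product
  given by the Christoffel symbols, and this product must vanish
  (\<open>jet_system.jet_zero_if_ricci_nondegenerate\<close>). If \<open>T\<close> is not zero or
  the Ricci tensor has rank 1, all columns of \<open>P\<close> lie on one fixed line everywhere, and
  differentiating this once more shows that the line is invariant under both multiplications with
  any vector (\<open>jet_system.parallel_jets_direction\<close>). The remaining models are torsion
  free and Ricci flat, and then the product is commutative and associative. Thus there are just two
  cases (\<open>invariant_direction_or_associative\<close>).

  In a basis that starts with the invariant direction the structure constants are triangular, and a
  triangular change of basis brings them to a normal form (\<open>triangular_listed\<close>). It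
  helps to think of the Killing fields \<open>f \<partial>\<^sub>1\<close> of such a model: if
  \<open>\<alpha>\<close>, the first structure constant, is not zero, then \<open>f\<close> is, up
  to a constant, an exponential in \<open>x\<^sup>1\<close> times a solution of a linear equation of
  order 2 with constant coefficients in \<open>x\<^sup>2\<close>, and the families correspond to its
  types of characteristic roots. The two-dimensional commutative associative real algebras are the
  six torsion free models \<open>M6_i\<close> (\<open>associative_listed\<close>): the zero product,
  the nilpotent algebra, the sum of the reals and a null algebra, the sum of two copies of the
  reals, the dual numbers, and the complex numbers.

  For the explicit models, each listed field is checked to be Killing, and the coefficients that
  match the jet of a given Killing field are written down. If \<open>T\<close> is not an invariant
  direction, only the constant fields remain (\<open>torsion_restriction\<close>).
\<close>

section \<open>Partial derivatives and smooth functions\<close>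

lemma has_derivative_partial:
  fixes f :: "real^2 \<Rightarrow> 'b::real_normed_vector"
  assumes "f differentiable (at x)"
  shows "(f has_derivative (\<lambda>h. \<Sum>i\<in>UNIV. h $ i *\<^sub>R partial i f x)) (at x)"
proof -
  have D: "(f has_derivative frechet_derivative f (at x)) (at x)"
    using assms by (simp add: frechet_derivative_works)
  then interpret bounded_linear "frechet_derivative f (at x)"
    by (rule has_derivative_bounded_linear)
  have "frechet_derivative f (at x) h = (\<Sum>i\<in>UNIV. h $ i *\<^sub>R partial i f x)" for h
  proof -
    have "frechet_derivative f (at x) h = frechet_derivative f (at x) (\<Sum>i\<in>UNIV. h $ i *\<^sub>R axis i 1)"
      by (simp add: basis_expansion flip: scalar_mult_eq_scaleR)
    also have "\<dots> = (\<Sum>i\<in>UNIV. h $ i *\<^sub>R partial i f x)"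
      by (simp add: sum scaleR partial_def)
    finally show ?thesis .
  qed
  then show ?thesis
    using D by presburger
qed

lemma partial_eqI: "(f has_derivative f') (at x) \<Longrightarrow> partial i f x = f' (axis i 1)"
  unfolding partial_def by (metis frechet_derivative_at)

lemma has_vector_derivative_line:
  fixes f :: "real^2 \<Rightarrow> 'b::real_normed_vector"
  assumes "\<And>x. f differentiable (at x)"
  shows "((\<lambda>t. f (x + t *\<^sub>R h)) has_vector_derivative (\<Sum>i\<in>UNIV. h $ i *\<^sub>R partial i f (x + t *\<^sub>R h))) (at t)"
proof -
  have "((\<lambda>t. x + t *\<^sub>R h) has_derivative (\<lambda>s. s *\<^sub>R h)) (at t)"
    by (auto intro!: derivative_eq_intros)
  from has_derivative_compose[OF this has_derivative_partial[OF assms]]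
  show ?thesis
    by (simp add: has_vector_derivative_def scaleR_sum_right)
qed

lemma DERIV_line:
  fixes f :: "real^2 \<Rightarrow> real"
  assumes "\<And>x. f differentiable (at x)"
  shows "((\<lambda>t. f (x + t *\<^sub>R axis i 1)) has_real_derivative partial i f (x + t *\<^sub>R axis i 1)) (at t)"
proof -
  have "axis i 1 $ k *\<^sub>R c = (if k = i then c else 0)" for k and c :: real
    by (simp add: axis_def)
  then show ?thesis
    using has_vector_derivative_line[OF assms, of x "axis i 1" t]
    by (simp only: has_real_derivative_iff_has_vector_derivative) (simp add: if_distrib cong: if_cong)
qed

lemma smooth_differentiable: "smooth f \<Longrightarrow> f differentiable (at x)"
  and smooth_partial: "smooth f \<Longrightarrow> smooth (partial i f)"
  by (metis smooth_def C_times.simps(2))+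

lemma smooth_continuous: "smooth f \<Longrightarrow> continuous_on UNIV f"
  by (metis smooth_def C_times.simps(1))

text \<open>Coinduction: no induction on the order of differentiability is needed for closure
  properties once a class of differentiable functions is known to be closed under partial
  derivatives.\<close>

lemma smooth_coinduct:
  assumes "\<And>f x. f \<in> F \<Longrightarrow> f differentiable (at x)"
    and "\<And>f i. f \<in> F \<Longrightarrow> partial i f \<in> F" and "f \<in> F"
  shows "smooth f"
proof -
  have "C_times n f" if "f \<in> F" for n f
    using that
  proof (induction n arbitrary: f)
    case 0
    then show ?case
      using assms(1) by (simp add: differentiable_imp_continuous_within continuous_on_eq_continuous_within)
  next
    case (Suc n)
    then show ?case using assms by simp
  qed
  then show ?thesis using assms(3) by (simp add: smooth_def)
qed

lemma partial_add [simp]: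
  assumes "f differentiable (at x)" "g differentiable (at x)"
  shows "partial i (\<lambda>x. f x + g x) x = partial i f x + partial i g x"
  using partial_eqI[OF has_derivative_add[OF assms[unfolded frechet_derivative_works]]]
  by (simp add: partial_def)

lemma partial_scaleR [simp]:
  assumes "f differentiable (at x)"
  shows "partial i (\<lambda>x. c *\<^sub>R f x) x = c *\<^sub>R partial i f x"
  using partial_eqI[OF has_derivative_scaleR_right[OF assms[unfolded frechet_derivative_works]]]
  by (simp add: partial_def)

lemma partial_cmult [simp]:
  fixes f :: "real^2 \<Rightarrow> real"
  assumes "f differentiable (at x)"
  shows "partial i (\<lambda>x. c * f x) x = c * partial i f x"
  using partial_scaleR[OF assms] by simp

lemma partial_component:
  fixes v :: "real^2 \<Rightarrow> real^'n"
  assumes "v differentiable (at x)"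
  shows "partial i (\<lambda>y. v y $ k) x = partial i v x $ k"
  using partial_eqI[OF bounded_linear.has_derivative[OF bounded_linear_vec_nth assms[unfolded frechet_derivative_works]]]
  by (simp add: partial_def)

lemma smooth_add: assumes "smooth f" "smooth g" shows "smooth (\<lambda>x. f x + g x)"
proof (rule smooth_coinduct[of "{\<lambda>x. f x + g x | f g. smooth f \<and> smooth g}"])
  show "(\<lambda>x. f x + g x) \<in> {\<lambda>x. f x + g x | f g. smooth f \<and> smooth g}"
    using assms by blast
next
  fix h :: "real^2 \<Rightarrow> 'a" and i assume "h \<in> {\<lambda>x. f x + g x | f g. smooth f \<and> smooth g}"
  then obtain f g where h: "h = (\<lambda>x. f x + g x)" and s: "smooth f" "smooth g" by blast
  show "h differentiable (at x)" for x
    using s by (simp add: h smooth_differentiable)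
  have "partial i h = (\<lambda>x. partial i f x + partial i g x)"
    using s by (simp add: h smooth_differentiable fun_eq_iff)
  then show "partial i h \<in> {\<lambda>x. f x + g x | f g. smooth f \<and> smooth g}"
    using s smooth_partial by blast
qed

lemma smooth_scaleR: assumes "smooth f" shows "smooth (\<lambda>x. c *\<^sub>R f x)"
proof (rule smooth_coinduct[of "{\<lambda>x. c *\<^sub>R f x | f. smooth f}"])
  show "(\<lambda>x. c *\<^sub>R f x) \<in> {\<lambda>x. c *\<^sub>R f x | f. smooth f}"
    using assms by blast
next
  fix h :: "real^2 \<Rightarrow> 'a" and i assume "h \<in> {\<lambda>x. c *\<^sub>R f x | f. smooth f}"
  then obtain f where h: "h = (\<lambda>x. c *\<^sub>R f x)" and s: "smooth f" by blast
  show "h differentiable (at x)" for x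
    using s by (simp add: h smooth_differentiable)
  have "partial i h = (\<lambda>x. c *\<^sub>R partial i f x)"
    using s by (simp add: h smooth_differentiable fun_eq_iff)
  then show "partial i h \<in> {\<lambda>x. c *\<^sub>R f x | f. smooth f}"
    using s smooth_partial by blast
qed

lemma differentiable_componentwise:
  fixes v :: "real^2 \<Rightarrow> real^'n"
  shows "v differentiable (at x) \<longleftrightarrow> (\<forall>k. (\<lambda>y. v y $ k) differentiable (at x))"
  by (subst differentiable_componentwise_within)
     (simp add: Basis_vec_def inner_axis)

lemma smooth_componentwise:
  fixes v :: "real^2 \<Rightarrow> real^'n"
  shows "smooth v \<longleftrightarrow> (\<forall>k. smooth (\<lambda>y. v y $ k))"
proof
  assume v: "smooth v"
  have "smooth (\<lambda>y. v y $ k)" for k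
  proof (rule smooth_coinduct[of "{\<lambda>y. v y $ k | v. smooth v}"])
    fix h :: "real^2 \<Rightarrow> real" and i assume "h \<in> {\<lambda>y. v y $ k | v. smooth v}"
    then obtain v where h: "h = (\<lambda>y. v y $ k)" and s: "smooth v" by blast
    then show "h differentiable (at x)" for x
      using differentiable_componentwise[of v x] smooth_differentiable[of v x] by simp
    have "partial i h = (\<lambda>y. partial i v y $ k)"
      using s by (simp add: h smooth_differentiable partial_component fun_eq_iff)
    then show "partial i h \<in> {\<lambda>y. v y $ k | v. smooth v}"
      using s smooth_partial by blast
  qed (use v in blast)
  then show "\<forall>k. smooth (\<lambda>y. v y $ k)" by blast
next
  assume v: "\<forall>k. smooth (\<lambda>y. v y $ k)"
  show "smooth v"
  proof (rule smooth_coinduct[of "{v. \<forall>k. smooth (\<lambda>y. v y $ k)}"])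
    fix v :: "real^2 \<Rightarrow> real^'n" and i assume v: "v \<in> {v. \<forall>k. smooth (\<lambda>y. v y $ k)}"
    then show D: "v differentiable (at x)" for x
      by (simp add: differentiable_componentwise smooth_differentiable)
    have "(\<lambda>y. partial i v y $ k) = partial i (\<lambda>y. v y $ k)" for k
      using D by (simp add: fun_eq_iff partial_component)
    then show "partial i v \<in> {v. \<forall>k. smooth (\<lambda>y. v y $ k)}"
      using v smooth_partial by auto
  qed (use v in blast)
qed

text \<open>Two applications of the mean value theorem, first in the direction \<open>i\<close>. The
  left hand side is symmetric in \<open>i\<close> and \<open>j\<close>, which yields the symmetry of
  second derivatives.\<close>

lemma second_difference:
  fixes f :: "real^2 \<Rightarrow> real"
  assumes "\<And>x. f differentiable (at x)" "\<And>x. partial i f differentiable (at x)" "h > 0"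
  obtains s t where "0 < s" "s < h" "0 < t" "t < h"
    "f (x + h *\<^sub>R axis i 1 + h *\<^sub>R axis j 1) - f (x + h *\<^sub>R axis i 1) - f (x + h *\<^sub>R axis j 1) + f x
      = h * h * partial j (partial i f) (x + s *\<^sub>R axis i 1 + t *\<^sub>R axis j 1)"
proof -
  let ?e = "axis i 1 :: real^2" and ?e' = "axis j 1 :: real^2"
  let ?g = "\<lambda>s. f (x + h *\<^sub>R ?e' + s *\<^sub>R ?e) - f (x + s *\<^sub>R ?e)"
  have "\<exists>s. 0 < s \<and> s < h \<and> ?g h - ?g 0 = (h - 0) * (partial i f (x + h *\<^sub>R ?e' + s *\<^sub>R ?e) - partial i f (x + s *\<^sub>R ?e))"
    using assms(3) by (intro MVT2) (auto intro!: derivative_eq_intros DERIV_line assms)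
  then obtain s where s: "0 < s" "s < h"
    "?g h - ?g 0 = h * (partial i f (x + h *\<^sub>R ?e' + s *\<^sub>R ?e) - partial i f (x + s *\<^sub>R ?e))"
    by auto
  let ?k = "\<lambda>t. partial i f (x + s *\<^sub>R ?e + t *\<^sub>R ?e')"
  have "\<exists>t. 0 < t \<and> t < h \<and> ?k h - ?k 0 = (h - 0) * partial j (partial i f) (x + s *\<^sub>R ?e + t *\<^sub>R ?e')"
    using assms(3) by (intro MVT2) (auto intro!: derivative_eq_intros DERIV_line assms)
  then obtain t where t: "0 < t" "t < h" "?k h - ?k 0 = h * partial j (partial i f) (x + s *\<^sub>R ?e + t *\<^sub>R ?e')"
    by auto
  have "x + h *\<^sub>R ?e' + s *\<^sub>R ?e = x + s *\<^sub>R ?e + h *\<^sub>R ?e'" "x + h *\<^sub>R ?e' + h *\<^sub>R ?e = x + h *\<^sub>R ?e + h *\<^sub>R ?e'"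
    by (simp_all add: algebra_simps)
  then show thesis
    using s t by (intro that[of s t]) (auto simp: algebra_simps)
qed

lemma partial_commute:
  fixes f :: "real^2 \<Rightarrow> real"
  assumes "smooth f"
  shows "partial i (partial j f) x = partial j (partial i f) x"
proof (rule ccontr)
  let ?a = "partial i (partial j f)" and ?b = "partial j (partial i f)"
  assume ne: "?a x \<noteq> ?b x"
  define \<epsilon> where "\<epsilon> = \<bar>?a x - ?b x\<bar> / 2"
  have "\<epsilon> > 0" using ne by (simp add: \<epsilon>_def)
  have "continuous (at x) ?a" "continuous (at x) ?b"
    using assms smooth_continuous smooth_partial continuous_on_eq_continuous_at open_UNIV by blast+
  then obtain d1 d2 where d: "d1 > 0" "d2 > 0"
    "\<And>y. dist y x < d1 \<Longrightarrow> dist (?a y) (?a x) < \<epsilon>" "\<And>y. dist y x < d2 \<Longrightarrow> dist (?b y) (?b x) < \<epsilon>"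
    using \<open>\<epsilon> > 0\<close> unfolding continuous_at_eps_delta by metis
  define h where "h = min d1 d2 / 2"
  have "h > 0" using d by (simp add: h_def)
  have near: "dist (x + s *\<^sub>R axis k 1 + t *\<^sub>R axis l 1) x < min d1 d2"
    if "0 < s" "s < h" "0 < t" "t < h" for s t and k l :: 2
  proof -
    have "dist (x + s *\<^sub>R axis k 1 + t *\<^sub>R axis l 1) x \<le> norm (s *\<^sub>R (axis k 1 :: real^2)) + norm (t *\<^sub>R (axis l 1 :: real^2))"
      by (simp add: dist_norm add.assoc norm_triangle_ineq del: norm_scaleR)
    also have "\<dots> < h + h" using that by simp
    finally show ?thesis by (simp add: h_def)
  qed
  have D: "f differentiable (at x)" "partial k f differentiable (at x)" for x k
    using assms smooth_differentiable smooth_partial by blast+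
  obtain s t where 1: "0 < s" "s < h" "0 < t" "t < h"
    "f (x + h *\<^sub>R axis i 1 + h *\<^sub>R axis j 1) - f (x + h *\<^sub>R axis i 1) - f (x + h *\<^sub>R axis j 1) + f x
      = h * h * ?b (x + s *\<^sub>R axis i 1 + t *\<^sub>R axis j 1)"
    using second_difference[OF D \<open>h > 0\<close>] by blast
  obtain s' t' where 2: "0 < s'" "s' < h" "0 < t'" "t' < h"
    "f (x + h *\<^sub>R axis j 1 + h *\<^sub>R axis i 1) - f (x + h *\<^sub>R axis j 1) - f (x + h *\<^sub>R axis i 1) + f x
      = h * h * ?a (x + s' *\<^sub>R axis j 1 + t' *\<^sub>R axis i 1)"
    using second_difference[OF D \<open>h > 0\<close>] by blast
  have swap: "x + h *\<^sub>R axis i 1 + h *\<^sub>R axis j 1 = x + h *\<^sub>R axis j 1 + h *\<^sub>R axis i 1"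
    by simp
  have "h * h * ?a (x + s' *\<^sub>R axis j 1 + t' *\<^sub>R axis i 1) = h * h * ?b (x + s *\<^sub>R axis i 1 + t *\<^sub>R axis j 1)"
    using 1(5) 2(5) unfolding swap by linarith
  then have eq: "?a (x + s' *\<^sub>R axis j 1 + t' *\<^sub>R axis i 1) = ?b (x + s *\<^sub>R axis i 1 + t *\<^sub>R axis j 1)"
    using \<open>h > 0\<close> by simp
  have "\<bar>?a (x + s' *\<^sub>R axis j 1 + t' *\<^sub>R axis i 1) - ?a x\<bar> < \<epsilon>"
       "\<bar>?b (x + s *\<^sub>R axis i 1 + t *\<^sub>R axis j 1) - ?b x\<bar> < \<epsilon>"
    using d(3)[of "x + s' *\<^sub>R axis j 1 + t' *\<^sub>R axis i 1"] d(4)[of "x + s *\<^sub>R axis i 1 + t *\<^sub>R axis j 1"]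
      near[OF 1(1-4)] near[OF 2(1-4)] by (simp_all add: dist_real_def)
  moreover have "\<bar>?a x - ?b x\<bar> \<le> \<bar>q - ?a x\<bar> + \<bar>q - ?b x\<bar>" for q
    by linarith
  ultimately show False
    unfolding eq \<epsilon>_def by (metis add_strict_mono field_sum_of_halves not_le)
qed

text \<open>Gronwall's argument: for \<open>C\<close> the operator bound of \<open>M\<close>, the
  function \<open>exp (- 2 C t) |g t|\<^sup>2\<close> has nonpositive derivative and starts at
  0.\<close>

lemma linear_ode_zero:
  fixes g :: "real \<Rightarrow> 'a::euclidean_space"
  assumes g: "\<And>t. (g has_vector_derivative M (g t)) (at t)" and M: "linear M"
    and "g 0 = 0" "t \<ge> 0"
  shows "g t = 0"
proof -
  obtain C where C: "\<And>u. norm (M u) \<le> C * norm u"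
    using linear_bounded[OF M] by blast
  let ?\<phi> = "\<lambda>t. exp (- (2 * C) * t) * (g t \<bullet> g t)"
  have D: "(?\<phi> has_real_derivative exp (- (2 * C) * t) * (2 * (g t \<bullet> M (g t)) - 2 * C * (g t \<bullet> g t))) (at t)" for t
  proof -
    have "((\<lambda>t. g t \<bullet> g t) has_vector_derivative (g t \<bullet> M (g t) + M (g t) \<bullet> g t)) (at t)"
      using bounded_bilinear.has_vector_derivative[OF bounded_bilinear_inner g g] .
    then have "((\<lambda>t. g t \<bullet> g t) has_real_derivative 2 * (g t \<bullet> M (g t))) (at t)"
      by (simp add: has_real_derivative_iff_has_vector_derivative inner_commute)
    then show ?thesis
      by (auto intro!: derivative_eq_intros simp: algebra_simps)
  qed
  have le: "exp (- (2 * C) * t) * (2 * (g t \<bullet> M (g t)) - 2 * C * (g t \<bullet> g t)) \<le> 0" for t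
  proof -
    have "g t \<bullet> M (g t) \<le> norm (g t) * norm (M (g t))"
      by (rule norm_cauchy_schwarz)
    also have "\<dots> \<le> norm (g t) * (C * norm (g t))"
      by (intro mult_left_mono C) simp
    also have "\<dots> = C * (g t \<bullet> g t)"
      by (simp add: dot_square_norm power2_eq_square)
    finally show ?thesis
      by (simp add: mult_nonneg_nonpos)
  qed
  have "?\<phi> t \<le> ?\<phi> 0"
    by (rule DERIV_nonpos_imp_nonincreasing[OF \<open>t \<ge> 0\<close>]) (use D le in blast)
  then have "g t \<bullet> g t \<le> 0"
    using \<open>g 0 = 0\<close> by (simp add: mult_le_0_iff)
  then show ?thesis by (metis inner_gt_zero_iff not_le)
qed

section \<open>Elementary functions\<close>

inductive elem :: "(real^2 \<Rightarrow> real) \<Rightarrow> bool" where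
  elem_const: "elem (\<lambda>x. c)"
| elem_coord: "elem (\<lambda>x. x $ k)"
| elem_add: "elem f \<Longrightarrow> elem g \<Longrightarrow> elem (\<lambda>x. f x + g x)"
| elem_mult: "elem f \<Longrightarrow> elem g \<Longrightarrow> elem (\<lambda>x. f x * g x)"
| elem_exp: "elem f \<Longrightarrow> elem (\<lambda>x. exp (f x))"
| elem_sin: "elem f \<Longrightarrow> elem (\<lambda>x. sin (f x))"
| elem_cos: "elem f \<Longrightarrow> elem (\<lambda>x. cos (f x))"

lemma partial_const [simp]: "partial i (\<lambda>x. c) x = 0"
  using partial_eqI[OF has_derivative_const] .

lemma partial_coord [simp]: "partial i (\<lambda>x. x $ k) x = (if k = i then 1 else 0)"
  using partial_eqI[OF bounded_linear.has_derivative[OF bounded_linear_vec_nth has_derivative_ident]]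
  by (simp add: axis_def)

lemma partial_compose:
  fixes f :: "real^2 \<Rightarrow> real"
  assumes "(\<phi> has_real_derivative \<phi>') (at (f x))" "f differentiable (at x)"
  shows "partial i (\<lambda>x. \<phi> (f x)) x = \<phi>' * partial i f x"
  using partial_eqI[OF has_derivative_compose[OF assms(2)[unfolded frechet_derivative_works]
        assms(1)[unfolded has_field_derivative_def]]]
  by (simp add: partial_def)

lemma differentiable_compose_real:
  fixes f :: "real^2 \<Rightarrow> real"
  assumes "(\<phi> has_real_derivative \<phi>') (at (f x))" "f differentiable (at x)"
  shows "(\<lambda>x. \<phi> (f x)) differentiable (at x)"
  using has_derivative_compose[OF assms(2)[unfolded frechet_derivative_works]
        assms(1)[unfolded has_field_derivative_def]] by (rule differentiableI)

lemma partial_mult: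
  fixes f :: "real^2 \<Rightarrow> real"
  assumes "f differentiable (at x)" "g differentiable (at x)"
  shows "partial i (\<lambda>x. f x * g x) x = f x * partial i g x + partial i f x * g x"
  using partial_eqI[OF has_derivative_mult[OF assms[unfolded frechet_derivative_works]]]
  by (simp add: partial_def)

text \<open>The class is closed under partial derivatives, so all its members are smooth. It is
  large enough for the components of all the Killing fields of the models.\<close>

lemma elem_partial:
  assumes "elem f"
  shows "(\<forall>x. f differentiable (at x)) \<and> (\<forall>i. elem (partial i f))"
  using assms
proof induction
  case (elem_const c)
  have "partial i (\<lambda>x. c) = (\<lambda>x. 0)" for i :: 2 by (simp add: fun_eq_iff)
  then show ?case by (simp add: elem.elem_const)
next
  case (elem_coord k)
  have "partial i (\<lambda>x. x $ k) = (\<lambda>x. if k = i then 1 else 0 :: real)" for i :: 2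
    by (simp add: fun_eq_iff)
  moreover have "(\<lambda>x::real^2. x $ k) differentiable (at x)" for x
    using bounded_linear_vec_nth bounded_linear_imp_differentiable by blast
  ultimately show ?case by (simp add: elem.elem_const)
next
  case (elem_add f g)
  then have "partial i (\<lambda>x. f x + g x) = (\<lambda>x. partial i f x + partial i g x)" for i
    by (simp add: fun_eq_iff)
  then show ?case using elem_add by (simp add: elem.elem_add)
next
  case (elem_mult f g)
  then have "partial i (\<lambda>x. f x * g x) = (\<lambda>x. f x * partial i g x + partial i f x * g x)" for i
    by (simp add: fun_eq_iff partial_mult)
  then show ?case using elem_mult by (simp add: elem.elem_add elem.elem_mult)
next
  case (elem_exp f)
  then have "partial i (\<lambda>x. exp (f x)) = (\<lambda>x. exp (f x) * partial i f x)" for i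
    by (simp add: fun_eq_iff partial_compose[OF DERIV_exp])
  moreover have "(\<lambda>x. exp (f x)) differentiable (at x)" for x
    using elem_exp by (intro differentiable_compose_real[OF DERIV_exp]) simp
  ultimately show ?case using elem_exp by (simp add: elem.elem_mult elem.elem_exp)
next
  case (elem_sin f)
  then have "partial i (\<lambda>x. sin (f x)) = (\<lambda>x. cos (f x) * partial i f x)" for i
    by (simp add: fun_eq_iff partial_compose[OF DERIV_sin])
  moreover have "(\<lambda>x. sin (f x)) differentiable (at x)" for x
    using elem_sin by (intro differentiable_compose_real[OF DERIV_sin]) simp
  ultimately show ?case using elem_sin by (simp add: elem.elem_mult elem.elem_cos)
next
  case (elem_cos f)
  then have "partial i (\<lambda>x. cos (f x)) = (\<lambda>x. -1 * (sin (f x) * partial i f x))" for i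
    by (simp add: fun_eq_iff partial_compose[OF DERIV_cos])
  moreover have "(\<lambda>x. cos (f x)) differentiable (at x)" for x
    using elem_cos by (intro differentiable_compose_real[OF DERIV_cos]) simp
  moreover have "elem (\<lambda>x. -1 * (sin (f x) * partial i f x))" for i
    by (intro elem.intros) (use elem_cos in auto)
  ultimately show ?case by auto
qed

lemma elem_differentiable: "elem f \<Longrightarrow> f differentiable (at x)"
  using elem_partial by blast

lemma elem_smooth: "elem f \<Longrightarrow> smooth f"
  using elem_partial by (intro smooth_coinduct[of "Collect elem"]) auto

lemma elem_minus: "elem f \<Longrightarrow> elem (\<lambda>x. - f x)"
  using elem_mult[OF elem_const[of "-1"], of f] by simp

lemma elem_diff: "elem f \<Longrightarrow> elem g \<Longrightarrow> elem (\<lambda>x. f x - g x)"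
  using elem_add[OF _ elem_minus, of f g] by simp

lemma elem_power: "elem f \<Longrightarrow> elem (\<lambda>x. f x ^ n)"
proof (induction n)
  case 0
  show ?case using elem_const[of 1] by (simp only: power_0)
next
  case (Suc n)
  then show ?case using elem_mult by (simp only: power_Suc)
qed

lemma elem_divide: "elem f \<Longrightarrow> elem (\<lambda>x. f x / c)"
  using elem_mult[OF _ elem_const[of "inverse c"], of f] by (simp add: divide_inverse)

lemmas elem_simps [simp] = elem_const elem_coord elem_add elem_mult elem_exp elem_sin elem_cos
  elem_minus elem_diff elem_power elem_divide

text \<open>As equations between functions rather than between values, these rules let the
  simplifier evaluate iterated partial derivatives.\<close>

lemma partial_elem:
  assumes "elem f"
  shows "partial i (\<lambda>x. - f x) = (\<lambda>x. - partial i f x)"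
    and "partial i (\<lambda>x. exp (f x)) = (\<lambda>x. exp (f x) * partial i f x)"
    and "partial i (\<lambda>x. sin (f x)) = (\<lambda>x. cos (f x) * partial i f x)"
    and "partial i (\<lambda>x. cos (f x)) = (\<lambda>x. - (sin (f x) * partial i f x))"
    and "partial i (\<lambda>x. f x ^ n) = (\<lambda>x. real n * f x ^ (n - 1) * partial i f x)"
    and "partial i (\<lambda>x. f x / c) = (\<lambda>x. partial i f x / c)"
proof -
  note D = elem_differentiable[OF assms]
  show "partial i (\<lambda>x. - f x) = (\<lambda>x. - partial i f x)"
    using partial_cmult[OF D, of i "-1"] by (simp add: fun_eq_iff)
  show "partial i (\<lambda>x. f x / c) = (\<lambda>x. partial i f x / c)"
    using partial_cmult[OF D, of i "inverse c"] by (simp add: fun_eq_iff field_simps)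
  show "partial i (\<lambda>x. f x ^ n) = (\<lambda>x. real n * f x ^ (n - 1) * partial i f x)"
    using D by (simp add: fun_eq_iff partial_compose[OF DERIV_pow])
qed (simp_all add: fun_eq_iff elem_differentiable[OF assms]
    partial_compose[OF DERIV_exp] partial_compose[OF DERIV_sin] partial_compose[OF DERIV_cos])

lemma partial_elem2:
  assumes "elem f" "elem g"
  shows "partial i (\<lambda>x. f x + g x) = (\<lambda>x. partial i f x + partial i g x)"
    and "partial i (\<lambda>x. f x - g x) = (\<lambda>x. partial i f x - partial i g x)"
    and "partial i (\<lambda>x. f x * g x) = (\<lambda>x. f x * partial i g x + partial i f x * g x)"
proof -
  note D = elem_differentiable[OF assms(1)] elem_differentiable[OF assms(2)]
  show "partial i (\<lambda>x. f x - g x) = (\<lambda>x. partial i f x - partial i g x)"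
    using partial_add[OF D(1) elem_differentiable[OF elem_minus[OF assms(2)]]] D
    by (simp add: fun_eq_iff partial_elem(1)[OF assms(2)])
qed (simp_all add: fun_eq_iff partial_mult elem_differentiable[OF assms(1)] elem_differentiable[OF assms(2)])

lemma partial_const_fun: "partial i (\<lambda>x. c) = (\<lambda>x. 0)"
  and partial_coord_fun: "partial i (\<lambda>x. x $ k) = (\<lambda>x. if k = i then 1 else 0)"
  by (simp_all add: fun_eq_iff)

lemmas partial_elem_simps = partial_elem partial_elem2 partial_const_fun partial_coord_fun

section \<open>Killing fields are determined by their first jet\<close>

lemma killing_type_A_iff:
  "v \<in> KK \<xi> \<longleftrightarrow> smooth v \<and> (\<forall>i j k x. partial i (partial j (\<lambda>y. v y $ k)) x =
     (\<Sum>l\<in>UNIV. christoffel \<xi> i j l * partial l (\<lambda>y. v y $ k) x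
              - christoffel \<xi> i l k * partial j (\<lambda>y. v y $ l) x
              - christoffel \<xi> l j k * partial i (\<lambda>y. v y $ l) x))"
proof -
  have "lie_connection (type_A \<xi>) v i j k x = 0 \<longleftrightarrow> partial i (partial j (\<lambda>y. v y $ k)) x =
     (\<Sum>l\<in>UNIV. christoffel \<xi> i j l * partial l (\<lambda>y. v y $ k) x
              - christoffel \<xi> i l k * partial j (\<lambda>y. v y $ l) x
              - christoffel \<xi> l j k * partial i (\<lambda>y. v y $ l) x)" for i j k x
    by (auto simp: lie_connection_def type_A_def sum_2 algebra_simps)
  then show ?thesis
    by (simp add: killing_def)
qed

lemma killing_type_A_eq:
  assumes "v \<in> KK \<xi>"
  shows "partial i (partial j (\<lambda>y. v y $ k)) x =
     (\<Sum>l\<in>UNIV. christoffel \<xi> i j l * partial l (\<lambda>y. v y $ k) x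
              - christoffel \<xi> i l k * partial j (\<lambda>y. v y $ l) x
              - christoffel \<xi> l j k * partial i (\<lambda>y. v y $ l) x)"
  using assms unfolding killing_type_A_iff by blast

lemma killing_elemI:
  assumes "\<And>k. elem (\<lambda>x. v x $ k)"
    and "\<And>i j k x. partial i (partial j (\<lambda>y. v y $ k)) x =
     (\<Sum>l\<in>UNIV. christoffel \<xi> i j l * partial l (\<lambda>y. v y $ k) x
              - christoffel \<xi> i l k * partial j (\<lambda>y. v y $ l) x
              - christoffel \<xi> l j k * partial i (\<lambda>y. v y $ l) x)"
  shows "v \<in> KK \<xi>"
  unfolding killing_type_A_iff using assms elem_smooth smooth_componentwise by blast

lemma has_vector_derivative_matrix:
  fixes g :: "real \<Rightarrow> real^'n^'m"
  assumes "\<And>k j. ((\<lambda>t. g t $ k $ j) has_vector_derivative D $ k $ j) (at t)"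
  shows "(g has_vector_derivative D) (at t)"
  using assms unfolding has_vector_derivative_def
  by (subst has_derivative_componentwise_within) (auto simp: Basis_vec_def inner_axis)

lemma smooth_component:
  fixes v :: "real^2 \<Rightarrow> real^'n"
  shows "smooth v \<Longrightarrow> smooth (\<lambda>y. v y $ k)"
  using smooth_componentwise by blast

text \<open>Along each ray from the origin the Jacobian solves a linear differential equation with
  constant coefficients, so it vanishes when it vanishes at the origin.\<close>

lemma killing_zero_jet:
  assumes v: "v \<in> KK \<xi>" and "v 0 = 0" and jet: "\<And>k j. partial j (\<lambda>y. v y $ k) 0 = 0"
  shows "v = 0"
proof -
  have s: "smooth v"
    using v unfolding killing_type_A_iff by blast
  have zero: "partial j (\<lambda>y. v y $ k) h = 0" for k j h
  proof -
    define g :: "real \<Rightarrow> real^2^2" where "g t = (\<chi> k j. partial j (\<lambda>y. v y $ k) (t *\<^sub>R h))" for t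
    define M :: "real^2^2 \<Rightarrow> real^2^2" where
      "M P = (\<chi> k j. \<Sum>i\<in>UNIV. h $ i * (\<Sum>l\<in>UNIV. christoffel \<xi> i j l * P $ k $ l
              - christoffel \<xi> i l k * P $ l $ j - christoffel \<xi> l j k * P $ l $ i))" for P
    have "linear M"
      by (rule linearI) (simp_all add: M_def vec_eq_iff distrib_left right_diff_distrib
          sum.distrib sum_subtractf sum_distrib_left mult.left_commute)
    moreover have "(g has_vector_derivative M (g t)) (at t)" for t
    proof (rule has_vector_derivative_matrix)
      fix k j
      have "((\<lambda>t. partial j (\<lambda>y. v y $ k) (0 + t *\<^sub>R h)) has_vector_derivative
        (\<Sum>i\<in>UNIV. h $ i *\<^sub>R partial i (partial j (\<lambda>y. v y $ k)) (0 + t *\<^sub>R h))) (at t)"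
        using s by (intro has_vector_derivative_line smooth_differentiable smooth_partial smooth_component)
      then show "((\<lambda>t. g t $ k $ j) has_vector_derivative M (g t) $ k $ j) (at t)"
        by (simp add: g_def M_def killing_type_A_eq[OF v])
    qed
    moreover have "g 0 = 0"
      by (simp add: g_def vec_eq_iff jet)
    ultimately have "g 1 = 0"
      using linear_ode_zero[of g M 1] zero_le_one by blast
    then show ?thesis
      by (simp add: g_def vec_eq_iff)
  qed
  have "v x $ k = v 0 $ k" for x k
  proof -
    have "((\<lambda>y. v y $ k) has_derivative (\<lambda>h. 0)) (at x)" for x
      using has_derivative_partial[OF smooth_differentiable[OF smooth_component[OF s]]] by (simp add: zero)
    then show ?thesis
      using has_derivative_zero_constant[of UNIV "\<lambda>y. v y $ k"] by auto
  qed
  then show ?thesis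
    by (simp add: \<open>v 0 = 0\<close> fun_eq_iff vec_eq_iff)
qed

lemma subspace_KK: "subspace (KK \<xi>)"
proof (rule subspaceI)
  show "0 \<in> KK \<xi>"
    by (rule killing_elemI) (simp_all add: partial_const_fun)
next
  fix v w assume v: "v \<in> KK \<xi>" and w: "w \<in> KK \<xi>"
  then have s: "smooth v" "smooth w" by (simp_all add: killing_type_A_iff)
  have P: "partial j (\<lambda>y. (v + w) y $ k) = (\<lambda>x. partial j (\<lambda>y. v y $ k) x + partial j (\<lambda>y. w y $ k) x)" for j k
    using s by (simp add: fun_eq_iff smooth_differentiable smooth_component)
  have PP: "partial i (partial j (\<lambda>y. (v + w) y $ k)) x
      = partial i (partial j (\<lambda>y. v y $ k)) x + partial i (partial j (\<lambda>y. w y $ k)) x" for i j k x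
    unfolding P using s by (simp add: smooth_differentiable smooth_component smooth_partial)
  have "smooth (v + w)"
    using smooth_add[OF s] by (simp add: plus_fun_def)
  moreover have "partial i (partial j (\<lambda>y. (v + w) y $ k)) x =
     (\<Sum>l\<in>UNIV. christoffel \<xi> i j l * partial l (\<lambda>y. (v + w) y $ k) x
              - christoffel \<xi> i l k * partial j (\<lambda>y. (v + w) y $ l) x
              - christoffel \<xi> l j k * partial i (\<lambda>y. (v + w) y $ l) x)" for i j k x
    unfolding PP unfolding killing_type_A_eq[OF v] killing_type_A_eq[OF w] P by (simp add: sum_2 algebra_simps)
  ultimately show "v + w \<in> KK \<xi>"
    unfolding killing_type_A_iff by blast
next
  fix c v assume v: "v \<in> KK \<xi>"
  then have s: "smooth v" by (simp add: killing_type_A_iff)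
  have P: "partial j (\<lambda>y. (c *\<^sub>R v) y $ k) = (\<lambda>x. c * partial j (\<lambda>y. v y $ k) x)" for j k
    using s by (simp add: fun_eq_iff smooth_differentiable smooth_component)
  have PP: "partial i (partial j (\<lambda>y. (c *\<^sub>R v) y $ k)) x = c * partial i (partial j (\<lambda>y. v y $ k)) x" for i j k x
    unfolding P using s by (simp add: smooth_differentiable smooth_component smooth_partial)
  have "smooth (c *\<^sub>R v)"
    using smooth_scaleR[OF s] by (simp add: scaleR_fun_def)
  moreover have "partial i (partial j (\<lambda>y. (c *\<^sub>R v) y $ k)) x =
     (\<Sum>l\<in>UNIV. christoffel \<xi> i j l * partial l (\<lambda>y. (c *\<^sub>R v) y $ k) x
              - christoffel \<xi> i l k * partial j (\<lambda>y. (c *\<^sub>R v) y $ l) x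
              - christoffel \<xi> l j k * partial i (\<lambda>y. (c *\<^sub>R v) y $ l) x)" for i j k x
    unfolding PP unfolding killing_type_A_eq[OF v] P by (simp add: sum_2 algebra_simps)
  ultimately show "c *\<^sub>R v \<in> KK \<xi>"
    unfolding killing_type_A_iff by blast
qed

lemma killing_jet_eq:
  assumes v: "v \<in> KK \<xi>" and w: "w \<in> KK \<xi>" and "v 0 = w 0"
    and "\<And>k j. partial j (\<lambda>y. v y $ k) 0 = partial j (\<lambda>y. w y $ k) 0"
  shows "v = w"
proof -
  have "v - w = 0"
  proof (rule killing_zero_jet)
    show "v - w \<in> KK \<xi>" using subspace_diff[OF subspace_KK v w] .
    show "(v - w) 0 = 0" using assms(3) by simp
    have s: "smooth v" "smooth w" using v w by (simp_all add: killing_type_A_iff)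
    fix k j
    have "(\<lambda>y. (v - w) y $ k) = (\<lambda>y. v y $ k + (-1) * w y $ k)" by (simp add: fun_eq_iff)
    then show "partial j (\<lambda>y. (v - w) y $ k) 0 = 0"
      using s partial_add[of "\<lambda>y. v y $ k" 0 "\<lambda>y. (-1) * w y $ k" j] partial_cmult[of "\<lambda>y. w y $ k" 0 j "-1"]
        smooth_differentiable[OF smooth_component[OF s(1)]] smooth_differentiable[OF smooth_component[OF s(2)]]
      by (simp add: assms(4) differentiable_minus)
  qed
  then show ?thesis by simp
qed

lemma KK_eq_spanI:
  assumes "B \<subseteq> KK \<xi>"
    and "\<And>v. v \<in> KK \<xi> \<Longrightarrow> \<exists>w\<in>span B. v 0 = w 0 \<and> (\<forall>k j. partial j (\<lambda>y. v y $ k) 0 = partial j (\<lambda>y. w y $ k) 0)"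
  shows "KK \<xi> = span B"
proof
  show sub: "span B \<subseteq> KK \<xi>" using span_minimal[OF assms(1) subspace_KK] .
  show "KK \<xi> \<subseteq> span B"
  proof
    fix v assume v: "v \<in> KK \<xi>"
    from assms(2)[OF this] obtain w where w: "w \<in> span B" "v 0 = w 0"
      "\<And>k j. partial j (\<lambda>y. v y $ k) 0 = partial j (\<lambda>y. w y $ k) 0"
      by blast
    then show "v \<in> span B"
      using killing_jet_eq[OF v, of w] sub by auto
  qed
qed

lemma d_in_KK: "d1 \<in> KK \<xi>" "d2 \<in> KK \<xi>"
proof -
  have "(\<lambda>x::real^2. c) \<in> KK \<xi>" for c
    by (rule killing_elemI) (simp_all only: elem_const partial_const_fun mult_zero_right diff_self sum.neutral_const)
  then show "d1 \<in> KK \<xi>" "d2 \<in> KK \<xi>"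
    by (auto simp only: d1_def d2_def)
qed

section \<open>The Ricci tensor and the torsion as invariants of Killing fields\<close>

lemma partial_cong: "(\<And>q. f q = g q) \<Longrightarrow> partial i f p = partial i g p"
  by presburger

text \<open>The symmetric part of the Killing equation, for \<open>x\<close>, \<open>y\<close> the
  partial derivatives of the first and \<open>z\<close>, \<open>w\<close> those of the second
  component of the field. The symmetrized symbols are \<open>a\<close>, \<open>b\<close> for the
  indices 11, \<open>c\<close>, \<open>d\<close> for 12 and \<open>e\<close>, \<open>f\<close> for
  22, the upper index 1 first.\<close>

locale jet_system =
  fixes a b c d e f :: real and x y z w :: "real^2 \<Rightarrow> real"
  assumes smooth: "smooth x" "smooth y" "smooth z" "smooth w"
    and x1: "partial 1 x p = - a * x p + b * y p - 2 * c * z p"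
    and x2: "partial 2 x p = (d - a) * y p - e * z p - c * w p"
    and y1: "partial 1 y p = (d - a) * y p - e * z p - c * w p"
    and y2: "partial 2 y p = e * x p + (f - 2 * c) * y p - 2 * e * w p"
    and z1: "partial 1 z p = - 2 * b * x p + (a - 2 * d) * z p + b * w p"
    and z2: "partial 2 z p = - d * x p - b * y p + (c - f) * z p"
    and w1: "partial 1 w p = - d * x p - b * y p + (c - f) * z p"
    and w2: "partial 2 w p = - 2 * d * y p + e * z p - f * w p"
begin

lemma partial_lincomb:
  "partial i (\<lambda>p. k1 * x p + k2 * y p + k3 * z p + k4 * w p) p
    = k1 * partial i x p + k2 * partial i y p + k3 * partial i z p + k4 * partial i w p"
  using smooth by (simp add: smooth_differentiable)

abbreviation "r11 \<equiv> a * d + b * f - b * c - d * d"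
abbreviation "r12 \<equiv> c * d - b * e"
abbreviation "r22 \<equiv> a * e + c * f - e * d - c * c"

text \<open>The numbers \<open>r11\<close>, \<open>r12\<close>, \<open>r22\<close> are the
  components of the (symmetric) Ricci tensor, and the equations say that its Lie derivative
  vanishes. They are the integrability conditions of the system.\<close>

lemma ricci_invariant:
  "r11 * x p + r12 * z p = 0"
  "r12 * y p + r22 * w p = 0"
  "r11 * y p + r12 * w p + r12 * x p + r22 * z p = 0"
proof -
  have X: "partial 1 x = (\<lambda>p. (- a) * x p + b * y p + (- 2 * c) * z p + 0 * w p)"
          "partial 2 x = (\<lambda>p. 0 * x p + (d - a) * y p + (- e) * z p + (- c) * w p)"
   and Y: "partial 1 y = (\<lambda>p. 0 * x p + (d - a) * y p + (- e) * z p + (- c) * w p)"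
          "partial 2 y = (\<lambda>p. e * x p + (f - 2 * c) * y p + 0 * z p + (- 2 * e) * w p)"
   and Z: "partial 1 z = (\<lambda>p. (- 2 * b) * x p + 0 * y p + (a - 2 * d) * z p + b * w p)"
          "partial 2 z = (\<lambda>p. (- d) * x p + (- b) * y p + (c - f) * z p + 0 * w p)"
   and W: "partial 1 w = (\<lambda>p. (- d) * x p + (- b) * y p + (c - f) * z p + 0 * w p)"
          "partial 2 w = (\<lambda>p. 0 * x p + (- 2 * d) * y p + e * z p + (- f) * w p)"
    by (simp_all add: fun_eq_iff x1 x2 y1 y2 z1 z2 w1 w2)
  note S = x1 x2 y1 y2 z1 z2 w1 w2
  have C1: "partial 1 (partial 2 x) p = partial 2 (partial 1 x) p"
   and C2: "partial 1 (partial 2 y) p = partial 2 (partial 1 y) p"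
   and C3: "partial 1 (partial 2 z) p = partial 2 (partial 1 z) p"
   and C4: "partial 1 (partial 2 w) p = partial 2 (partial 1 w) p"
    using smooth partial_commute by blast+
  note D1 = C1[unfolded X partial_lincomb, unfolded S]
  note D2 = C2[unfolded Y partial_lincomb, unfolded S]
  note D3 = C3[unfolded Z partial_lincomb, unfolded S]
  note D4 = C4[unfolded W partial_lincomb, unfolded S]
  show "r11 * x p + r12 * z p = 0"
    using D1 D2 D3 D4 by (simp add: algebra_simps)
  show "r12 * y p + r22 * w p = 0"
    using D1 D2 D3 D4 by (simp add: algebra_simps)
  show "r11 * y p + r12 * w p + r12 * x p + r22 * z p = 0"
    using D1 D2 D3 D4 by (simp add: algebra_simps)
qed

text \<open>If both columns of the Jacobian are multiples \<open>k\<close>, \<open>l\<close> of a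
  fixed vector \<open>U = (u, v)\<close> everywhere, then so are their derivatives. Modulo
  \<open>U\<close>, the Killing equation expresses these by the products of \<open>U\<close> with
  the two basis vectors, \<open>s1\<close> and \<open>s2\<close> in the proof.\<close>

lemma parallel_jets_direction:
  assumes line: "\<And>q. u * z q = v * x q" "\<And>q. u * w q = v * y q" and "(u, v) \<noteq> (0, 0)"
    and jet: "(x p, y p, z p, w p) \<noteq> (0, 0, 0, 0)"
  shows "u * (b * u + d * v) = v * (a * u + c * v)"
    and "u * (d * u + f * v) = v * (c * u + e * v)"
proof -
  have fact: "\<exists>k. s = u * k \<and> t = v * k" if "u * t = v * s" for s t
    using that \<open>(u, v) \<noteq> (0, 0)\<close>
    by (cases "u = 0") (auto intro: exI[of _ "t / v"] exI[of _ "s / u"] simp: field_simps)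
  obtain k where k: "x p = u * k" "z p = v * k"
    using fact[OF line(1)] by blast
  obtain l where l: "y p = u * l" "w p = v * l"
    using fact[OF line(2)] by blast
  have kl: "k \<noteq> 0 \<or> l \<noteq> 0"
    using jet k l by auto
  have "partial i (\<lambda>q. u * z q) p = partial i (\<lambda>q. v * x q) p"
    "partial i (\<lambda>q. u * w q) p = partial i (\<lambda>q. v * y q) p" for i
    by (rule partial_cong, rule line)+
  then have dz: "u * partial i z p = v * partial i x p" and dw: "u * partial i w p = v * partial i y p" for i
    using smooth by (simp_all add: smooth_differentiable)
  define s1 where "s1 = u * (b * u + d * v) - v * (a * u + c * v)"
  define s2 where "s2 = u * (d * u + f * v) - v * (c * u + e * v)"
  have "k * s1 = 0" "k * s2 + l * s1 = 0" "l * s2 = 0"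
    using dz[of 1, unfolded z1 x1 k l] dz[of 2, unfolded z2 x2 k l] dw[of 2, unfolded w2 y2 k l]
    unfolding s1_def s2_def by (simp_all add: algebra_simps)
  then have "s1 = 0 \<and> s2 = 0"
    using kl by (cases "k = 0") auto
  then show "u * (b * u + d * v) = v * (a * u + c * v)"
    and "u * (d * u + f * v) = v * (c * u + e * v)"
    by (simp_all add: s1_def s2_def)
qed

text \<open>A field that preserves a nondegenerate constant bilinear form has constant Jacobian
  \<open>P\<close>. Then \<open>P\<close> is a derivation of the symmetric product \<open>S\<close>.
  As \<open>P\<close> is trace free, its square is a scalar \<open>m\<close>; the eigenvalues of its
  action on products are odd multiples of \<open>\<surd>m\<close>, so \<open>S = 0\<close> unless
  \<open>m = 0\<close>. The first contradicts nondegeneracy, and \<open>m = 0\<close> forces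
  \<open>P = 0\<close>, since \<open>P\<close> is a multiple of the inverse Ricci matrix times a
  rotation by a right angle.\<close>

lemma jet_zero_if_ricci_nondegenerate:
  assumes det: "r11 * r22 \<noteq> r12 * r12"
  shows "(x p, y p, z p, w p) = (0, 0, 0, 0)"
proof -
  define A B C where "A = r11" and "B = r12" and "C = r22"
  have det': "A * C \<noteq> B * B"
    using det by (simp only: A_def B_def C_def not_False_eq_True)
  have inv: "A * x q + 0 * y q + B * z q + 0 * w q = 0" "0 * x q + B * y q + 0 * z q + C * w q = 0"
      "B * x q + A * y q + C * z q + B * w q = 0" for q
    using ricci_invariant[of q] unfolding A_def B_def C_def by (simp_all only: mult_zero_left add_0_left add_0_right add.commute add.left_commute)
  have "partial i (\<lambda>q. A * x q + 0 * y q + B * z q + 0 * w q) p = partial i (\<lambda>q. 0) p"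
    "partial i (\<lambda>q. 0 * x q + B * y q + 0 * z q + C * w q) p = partial i (\<lambda>q. 0) p"
    "partial i (\<lambda>q. B * x q + A * y q + C * z q + B * w q) p = partial i (\<lambda>q. 0) p" for i
    by (rule partial_cong, rule inv)+
  then have der: "A * partial i x p + B * partial i z p = 0" "B * partial i y p + C * partial i w p = 0"
      "B * partial i x p + A * partial i y p + C * partial i z p + B * partial i w p = 0" for i
    unfolding partial_lincomb partial_const by simp_all
  have solve: "s = 0 \<and> t = 0" if "A * s + B * t = 0" "B * s + C * t = 0" for s t
  proof -
    have "(A * C - B * B) * s = 0" "(A * C - B * B) * t = 0"
      using that by algebra+
    then show ?thesis using det' by simp
  qed
  have sym: "partial 2 x q = partial 1 y q" "partial 2 z q = partial 1 w q" for q
    by (simp_all add: x2 y1 z2 w1)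
  \<comment> \<open>As for metrics: the second derivatives of the field, lowered by the Ricci
    tensor, are symmetric in one pair of indices and antisymmetric in another, so they
    vanish.\<close>
  have "partial 1 x p = 0 \<and> partial 1 z p = 0"
    using der(1,3)[of 1] der(2)[of 1] der(1)[of 2] sym[of p]
    by (intro solve) simp_all
  moreover have "partial 2 y p = 0 \<and> partial 2 w p = 0"
    using der(2,3)[of 2] der(1)[of 2] der(2)[of 1] sym[of p]
    by (intro solve) simp_all
  moreover have "partial 1 y p = 0 \<and> partial 1 w p = 0"
    using der[of 1] der[of 2] sym[of p] calculation
    by (intro solve) simp_all
  ultimately have const: "partial i x p = 0" "partial i y p = 0" "partial i z p = 0" "partial i w p = 0" for i
    using exhaust_2[of i] sym[of p] by auto
  have "(A * C - B * B) * (x p + w p) = 0"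
    using inv[of p] by algebra
  then have w: "w p = - x p"
    using det' by simp
  note S0 = x1[of p] x2[of p] y2[of p] z1[of p] z2[of p] w2[of p]
  note S = S0[unfolded const w]
  define m where "m = x p * x p + y p * z p"
  have "(A * C - B * B) * (x p * x p) = - (B * B * m)" "(A * C - B * B) * (y p * y p) = - (C * C * m)"
       "(A * C - B * B) * (z p * z p) = - (A * A * m)"
    using inv[of p, unfolded w] unfolding m_def by algebra+
  then have "m = 0 \<Longrightarrow> ?thesis"
    using det' w by simp
  moreover have "m = 0"
  proof (rule ccontr)
    assume "m \<noteq> 0"
    \<comment> \<open>The \<open>n\<close> are the image of the \<open>q\<close> under the action
      \<open>N\<close> of \<open>P\<close> on the two arguments of a symmetric form. It satisfies
      \<open>N\<^sup>3 = 4 m N\<close>, so \<open>N\<^sup>2 q = m q\<close> implies \<open>N q =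
      0\<close>.\<close>
    have vanish: "q11 = 0 \<and> q12 = 0 \<and> q22 = 0"
      if n: "n11 = 2 * (x p * q11 + z p * q12)" "n12 = z p * q22 + y p * q11"
          "n22 = 2 * (y p * q12 - x p * q22)"
        and mq: "m * q11 = 2 * (x p * n11 + z p * n12)" "m * q12 = z p * n22 + y p * n11"
          "m * q22 = 2 * (y p * n12 - x p * n22)" for n11 n12 n22 q11 q12 q22
    proof -
      have "m * n11 = 4 * m * n11" "m * n12 = 4 * m * n12" "m * n22 = 4 * m * n22"
        using n mq m_def by algebra+
      then have "n11 = 0" "n12 = 0" "n22 = 0"
        using \<open>m \<noteq> 0\<close> by simp_all
      then show ?thesis
        using mq \<open>m \<noteq> 0\<close> by simp
    qed
    have "a = 0 \<and> c = 0 \<and> e = 0"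
      by (rule vanish[where ?n11.0 = "x p * a + y p * b" and ?n12.0 = "x p * c + y p * d" and ?n22.0 = "x p * e + y p * f"])
        (use S m_def in algebra)+
    moreover have "b = 0 \<and> d = 0 \<and> f = 0"
      by (rule vanish[where ?n11.0 = "z p * a - x p * b" and ?n12.0 = "z p * c - x p * d" and ?n22.0 = "z p * e - x p * f"])
        (use S m_def in algebra)+
    ultimately show False
      using det by simp
  qed
  ultimately show ?thesis by blast
qed

end

text \<open>The bilinear product whose structure constants are the Christoffel symbols. Linear
  equivalence of models is isomorphism of these algebras.\<close>

definition mult_of :: "real^8 \<Rightarrow> real^2 \<Rightarrow> real^2 \<Rightarrow> real^2" where
  "mult_of \<xi> u w = (\<chi> k. \<Sum>i\<in>UNIV. \<Sum>j\<in>UNIV. u $ i * w $ j * christoffel \<xi> i j k)"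

definition wedge :: "real^2 \<Rightarrow> real^2 \<Rightarrow> real" where
  "wedge u w = u $ 1 * w $ 2 - u $ 2 * w $ 1"

lemma christoffel_simps [simp]:
  "christoffel \<xi> 1 1 1 = \<xi> $ 1" "christoffel \<xi> 1 1 2 = \<xi> $ 2"
  "christoffel \<xi> 1 2 1 = \<xi> $ 3" "christoffel \<xi> 1 2 2 = \<xi> $ 4"
  "christoffel \<xi> 2 1 1 = \<xi> $ 5" "christoffel \<xi> 2 1 2 = \<xi> $ 6"
  "christoffel \<xi> 2 2 1 = \<xi> $ 7" "christoffel \<xi> 2 2 2 = \<xi> $ 8"
  by (simp_all add: christoffel_def)

lemma killing_jet_system:
  assumes v: "v \<in> KK \<xi>"
  shows "jet_system (\<xi> $ 1) (\<xi> $ 2) ((\<xi> $ 3 + \<xi> $ 5) / 2) ((\<xi> $ 4 + \<xi> $ 6) / 2) (\<xi> $ 7) (\<xi> $ 8)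
    (partial 1 (\<lambda>y. v y $ 1)) (partial 2 (\<lambda>y. v y $ 1)) (partial 1 (\<lambda>y. v y $ 2)) (partial 2 (\<lambda>y. v y $ 2))"
    (is "jet_system ?a ?b ?c ?d ?e ?f ?x ?y ?z ?w")
proof
  have s: "smooth (\<lambda>y. v y $ k)" for k
    using v by (simp add: killing_type_A_iff smooth_component)
  then show "smooth ?x" "smooth ?y" "smooth ?z" "smooth ?w"
    by (simp_all add: smooth_partial)
  fix p
  have com: "partial 1 (partial 2 (\<lambda>y. v y $ k)) p = partial 2 (partial 1 (\<lambda>y. v y $ k)) p" for k
    using s partial_commute by blast
  note E = killing_type_A_eq[OF v, unfolded sum_2]
  note E1 = E[of 1 1 1 p] E[of 1 2 1 p] E[of 2 1 1 p] E[of 2 2 1 p]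
  note E2 = E[of 1 1 2 p] E[of 1 2 2 p] E[of 2 1 2 p] E[of 2 2 2 p]
  show "partial 1 ?x p = - ?a * ?x p + ?b * ?y p - 2 * ?c * ?z p"
    and x2: "partial 2 ?x p = (?d - ?a) * ?y p - ?e * ?z p - ?c * ?w p"
    and "partial 2 ?y p = ?e * ?x p + (?f - 2 * ?c) * ?y p - 2 * ?e * ?w p"
    and "partial 1 ?z p = - 2 * ?b * ?x p + (?a - 2 * ?d) * ?z p + ?b * ?w p"
    and z2: "partial 2 ?z p = - ?d * ?x p - ?b * ?y p + (?c - ?f) * ?z p"
    and "partial 2 ?w p = - 2 * ?d * ?y p + ?e * ?z p - ?f * ?w p"
    using com[of 1] com[of 2] E1 E2 unfolding christoffel_simps by (simp_all add: field_simps)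
  show "partial 1 ?y p = (?d - ?a) * ?y p - ?e * ?z p - ?c * ?w p"
    and "partial 1 ?w p = - ?d * ?x p - ?b * ?y p + (?c - ?f) * ?z p"
    using x2 z2 com by simp_all
qed

lemma torsion_nth [simp]:
  "torsion \<xi> $ 1 = (\<xi> $ 3 - \<xi> $ 5) / 2" "torsion \<xi> $ 2 = (\<xi> $ 4 - \<xi> $ 6) / 2"
  by (simp_all add: torsion_def)

text \<open>The difference of the Killing equations for the indices 12 and 21.\<close>

lemma torsion_invariant:
  assumes v: "v \<in> KK \<xi>"
  shows "torsion \<xi> $ 1 * partial j (\<lambda>y. v y $ 2) p = torsion \<xi> $ 2 * partial j (\<lambda>y. v y $ 1) p"
proof -
  have s: "smooth (\<lambda>y. v y $ k)" for k
    using v by (simp add: killing_type_A_iff smooth_component)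
  have com: "partial 1 (partial 2 (\<lambda>y. v y $ k)) p = partial 2 (partial 1 (\<lambda>y. v y $ k)) p" for k
    using s partial_commute by blast
  note E = killing_type_A_eq[OF v, unfolded sum_2]
  show ?thesis
    using com[of 1] com[of 2] E[of 1 2 1 p] E[of 2 1 1 p] E[of 1 2 2 p] E[of 2 1 2 p] exhaust_2[of j]
    unfolding christoffel_simps by (auto simp: field_simps)
qed

definition invariant_direction :: "real^8 \<Rightarrow> real^2 \<Rightarrow> bool" where
  "invariant_direction \<xi> u \<longleftrightarrow>
     u \<noteq> 0 \<and> (\<forall>w. wedge u (mult_of \<xi> u w) = 0 \<and> wedge u (mult_of \<xi> w u) = 0)"

lemma invariant_directionI:
  assumes v: "v \<in> KK \<xi>" and "u \<noteq> 0" and t: "wedge u (torsion \<xi>) = 0"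
    and line: "\<And>j q. u $ 1 * partial j (\<lambda>y. v y $ 2) q = u $ 2 * partial j (\<lambda>y. v y $ 1) q"
    and jet: "partial j (\<lambda>y. v y $ k) p \<noteq> 0"
  shows "invariant_direction \<xi> u"
proof -
  interpret jet_system "\<xi> $ 1" "\<xi> $ 2" "(\<xi> $ 3 + \<xi> $ 5) / 2" "(\<xi> $ 4 + \<xi> $ 6) / 2" "\<xi> $ 7" "\<xi> $ 8"
    "partial 1 (\<lambda>y. v y $ 1)" "partial 2 (\<lambda>y. v y $ 1)" "partial 1 (\<lambda>y. v y $ 2)" "partial 2 (\<lambda>y. v y $ 2)"
    using killing_jet_system[OF v] .
  have u: "(u $ 1, u $ 2) \<noteq> (0, 0)"
    using \<open>u \<noteq> 0\<close> by (auto simp: vec_eq_iff forall_2)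
  have j: "(partial 1 (\<lambda>y. v y $ 1) p, partial 2 (\<lambda>y. v y $ 1) p, partial 1 (\<lambda>y. v y $ 2) p, partial 2 (\<lambda>y. v y $ 2) p)
     \<noteq> (0, 0, 0, 0)"
    using jet exhaust_2[of j] exhaust_2[of k] by auto
  note L = parallel_jets_direction[OF line line u j]
  have sym: "wedge u (mult_of \<xi> u w) + wedge u (mult_of \<xi> w u) = 0" for w
  proof -
    have "wedge u (mult_of \<xi> u w) + wedge u (mult_of \<xi> w u) =
      2 * w $ 1 * (u $ 1 * (\<xi> $ 2 * u $ 1 + (\<xi> $ 4 + \<xi> $ 6) / 2 * u $ 2)
                   - u $ 2 * (\<xi> $ 1 * u $ 1 + (\<xi> $ 3 + \<xi> $ 5) / 2 * u $ 2))
      + 2 * w $ 2 * (u $ 1 * ((\<xi> $ 4 + \<xi> $ 6) / 2 * u $ 1 + \<xi> $ 8 * u $ 2)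
                   - u $ 2 * ((\<xi> $ 3 + \<xi> $ 5) / 2 * u $ 1 + \<xi> $ 7 * u $ 2))"
      by (simp add: wedge_def mult_of_def sum_2 field_simps)
    then show ?thesis using L by simp
  qed
  have anti: "wedge u (mult_of \<xi> u w) - wedge u (mult_of \<xi> w u) = 0" for w
  proof -
    have "wedge u (mult_of \<xi> u w) - wedge u (mult_of \<xi> w u) = 2 * wedge u w * wedge u (torsion \<xi>)"
      by (simp add: wedge_def mult_of_def sum_2 field_simps)
    then show ?thesis using t by simp
  qed
  have "wedge u (mult_of \<xi> u w) = 0 \<and> wedge u (mult_of \<xi> w u) = 0" for w
    using sym[of w] anti[of w] by linarith
  then show ?thesis
    using \<open>u \<noteq> 0\<close> by (simp add: invariant_direction_def)
qed

lemma killing_nonconstant: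
  assumes "KK \<xi> \<noteq> span {d1, d2}"
  obtains v k j where "v \<in> KK \<xi>" "partial j (\<lambda>y. v y $ k) 0 \<noteq> 0"
proof -
  have False if const: "\<And>v k j. v \<in> KK \<xi> \<Longrightarrow> partial j (\<lambda>y. v y $ k) 0 = 0"
  proof -
    have "\<exists>w\<in>span {d1, d2}. v 0 = w 0 \<and> (\<forall>k j. partial j (\<lambda>y. v y $ k) 0 = partial j (\<lambda>y. w y $ k) 0)"
      if v: "v \<in> KK \<xi>" for v
    proof
      let ?w = "(v 0 $ 1) *\<^sub>R d1 + (v 0 $ 2) *\<^sub>R d2"
      show w: "?w \<in> span {d1, d2}"
        by (intro span_add span_scale span_base) simp_all
      have "?w \<in> KK \<xi>"
        using d_in_KK subspace_KK by (intro subspace_add subspace_scale)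
      then show "v 0 = ?w 0 \<and> (\<forall>k j. partial j (\<lambda>y. v y $ k) 0 = partial j (\<lambda>y. ?w y $ k) 0)"
        using const v by (simp add: d1_def d2_def vec_eq_iff forall_2 axis_def)
    qed
    then have "KK \<xi> = span {d1, d2}"
      using d_in_KK by (intro KK_eq_spanI) auto
    then show False using assms by simp
  qed
  then show thesis using that by blast
qed

lemma dim_gt_2: "dim (KK \<xi>) > 2 \<Longrightarrow> KK \<xi> \<noteq> span {d1, d2}"
  using dim_le_card[of "KK \<xi>" "{d1, d2}"] card_2_iff[of "{d1,d2}"] by (auto simp: card_insert_if split: if_splits)

text \<open>The associator of a commutative product is its curvature, which in dimension 2 is
  determined by the Ricci tensor.\<close>

lemma associative_if_ricci_flat:
  assumes "\<xi> $ 3 = \<xi> $ 5" "\<xi> $ 4 = \<xi> $ 6"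
    and "\<xi> $ 1 * \<xi> $ 4 + \<xi> $ 2 * \<xi> $ 8 - \<xi> $ 2 * \<xi> $ 3 - \<xi> $ 4 * \<xi> $ 4 = 0"
    and "\<xi> $ 3 * \<xi> $ 4 - \<xi> $ 2 * \<xi> $ 7 = 0"
    and "\<xi> $ 1 * \<xi> $ 7 + \<xi> $ 3 * \<xi> $ 8 - \<xi> $ 7 * \<xi> $ 4 - \<xi> $ 3 * \<xi> $ 3 = 0"
  shows "mult_of \<xi> (mult_of \<xi> u v) w = mult_of \<xi> u (mult_of \<xi> v w)"
proof -
  have "mult_of \<xi> (mult_of \<xi> u v) w $ 1 - mult_of \<xi> u (mult_of \<xi> v w) $ 1 = wedge w u *
      (v $ 1 * (\<xi> $ 3 * \<xi> $ 4 - \<xi> $ 2 * \<xi> $ 7)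
       + v $ 2 * (\<xi> $ 1 * \<xi> $ 7 + \<xi> $ 3 * \<xi> $ 8 - \<xi> $ 7 * \<xi> $ 4 - \<xi> $ 3 * \<xi> $ 3))"
    "mult_of \<xi> (mult_of \<xi> u v) w $ 2 - mult_of \<xi> u (mult_of \<xi> v w) $ 2 = - wedge w u *
      (v $ 1 * (\<xi> $ 1 * \<xi> $ 4 + \<xi> $ 2 * \<xi> $ 8 - \<xi> $ 2 * \<xi> $ 3 - \<xi> $ 4 * \<xi> $ 4)
       + v $ 2 * (\<xi> $ 3 * \<xi> $ 4 - \<xi> $ 2 * \<xi> $ 7))"
    using assms(1,2) by (simp_all add: wedge_def mult_of_def sum_2 algebra_simps)
  then show ?thesis
    using assms(3-5) by (simp add: vec_eq_iff forall_2)
qed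

text \<open>The direction is the torsion if that is not zero, and otherwise the kernel of a Ricci
  tensor of rank 1.\<close>

lemma invariant_direction_or_associative:
  assumes "KK \<xi> \<noteq> span {d1, d2}"
  shows "(\<exists>u. invariant_direction \<xi> u) \<or>
    (\<forall>u w. mult_of \<xi> u w = mult_of \<xi> w u) \<and>
    (\<forall>u v w. mult_of \<xi> (mult_of \<xi> u v) w = mult_of \<xi> u (mult_of \<xi> v w))"
proof -
  obtain v k j where v: "v \<in> KK \<xi>" and jet: "partial j (\<lambda>y. v y $ k) 0 \<noteq> 0"
    using killing_nonconstant[OF assms] .
  interpret jet_system "\<xi> $ 1" "\<xi> $ 2" "(\<xi> $ 3 + \<xi> $ 5) / 2" "(\<xi> $ 4 + \<xi> $ 6) / 2" "\<xi> $ 7" "\<xi> $ 8"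
    "partial 1 (\<lambda>y. v y $ 1)" "partial 2 (\<lambda>y. v y $ 1)" "partial 1 (\<lambda>y. v y $ 2)" "partial 2 (\<lambda>y. v y $ 2)"
    using killing_jet_system[OF v] .
  show ?thesis
  proof (cases "torsion \<xi> = 0")
    case False
    have "wedge (torsion \<xi>) (torsion \<xi>) = 0"
      by (simp add: wedge_def)
    then show ?thesis
      using invariant_directionI[OF v False _ torsion_invariant[OF v] jet] by blast
  next
    case True
    then have sym: "\<xi> $ 3 = \<xi> $ 5" "\<xi> $ 4 = \<xi> $ 6"
      by (simp_all add: vec_eq_iff forall_2)
    have [simp]: "wedge u (torsion \<xi>) = 0" for u
      by (simp add: True wedge_def)
    define A B C where "A = r11" and "B = r12" and "C = r22"
    note abc = A_def B_def C_def
    note R = ricci_invariant[folded abc]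
    have det: "A * C = B * B"
      using jet_zero_if_ricci_nondegenerate[folded abc, of 0] jet exhaust_2[of j] exhaust_2[of k] by auto
    have "A = 0 \<Longrightarrow> B = 0"
      using det by (metis mult_eq_0_iff)
    then consider "A \<noteq> 0" | "A = 0" "B = 0" "C \<noteq> 0" | "A = 0" "B = 0" "C = 0"
      by blast
    then show ?thesis
    proof cases
      case 1
      let ?u = "vector [B, - A] :: real^2"
      have "B * partial 2 (\<lambda>y. v y $ 2) q = - A * partial 2 (\<lambda>y. v y $ 1) q" for q
      proof -
        have "A * (B * partial 2 (\<lambda>y. v y $ 2) q + A * partial 2 (\<lambda>y. v y $ 1) q) = 0"
          using R[of q] det by algebra
        then show ?thesis using \<open>A \<noteq> 0\<close> by simp
      qed
      moreover have "B * partial 1 (\<lambda>y. v y $ 2) q = - A * partial 1 (\<lambda>y. v y $ 1) q" for q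
        using R(1)[of q] by simp
      ultimately have "?u $ 1 * partial j (\<lambda>y. v y $ 2) q = ?u $ 2 * partial j (\<lambda>y. v y $ 1) q" for j q
        using exhaust_2[of j] by auto
      moreover have "?u \<noteq> 0"
        using \<open>A \<noteq> 0\<close> by (simp add: vec_eq_iff forall_2)
      ultimately show ?thesis
        using invariant_directionI[OF v _ _ _ jet, of ?u] by auto
    next
      case 2
      let ?u = "vector [1, 0] :: real^2"
      have "?u $ 1 * partial j (\<lambda>y. v y $ 2) q = ?u $ 2 * partial j (\<lambda>y. v y $ 1) q" for j q
        using exhaust_2[of j] R[of q] 2 by auto
      moreover have "?u \<noteq> 0"
        by (simp add: vec_eq_iff forall_2)
      ultimately show ?thesis
        using invariant_directionI[OF v _ _ _ jet, of ?u] by auto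
    next
      case 3
      have "mult_of \<xi> u w = mult_of \<xi> w u" for u w
        using sym by (simp add: mult_of_def vec_eq_iff forall_2 sum_2 algebra_simps)
      moreover have "mult_of \<xi> (mult_of \<xi> u v) w = mult_of \<xi> u (mult_of \<xi> v w)" for u v w
        using 3 unfolding abc sym[symmetric] by (intro associative_if_ricci_flat sym) simp_all
      ultimately show ?thesis by blast
    qed
  qed
qed

section \<open>Linear equivalence and listed_if_nonconstant of the structure constants\<close>

lemma vector_2_eq: "(v :: real^2) = w \<longleftrightarrow> v $ 1 = w $ 1 \<and> v $ 2 = w $ 2"
  by (simp add: vec_eq_iff forall_2)

lemma exhaust_8:
  fixes x :: 8
  shows "x = 1 \<or> x = 2 \<or> x = 3 \<or> x = 4 \<or> x = 5 \<or> x = 6 \<or> x = 7 \<or> x = 8"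
proof (induct x)
  case (of_int z)
  then have "0 \<le> z" and "z < 8" by simp_all
  then have "z = 0 \<or> z = 1 \<or> z = 2 \<or> z = 3 \<or> z = 4 \<or> z = 5 \<or> z = 6 \<or> z = 7" by arith
  then show ?case by auto
qed

lemma mult_of_nth:
  "mult_of \<xi> u w $ 1 = u $ 1 * w $ 1 * \<xi> $ 1 + u $ 1 * w $ 2 * \<xi> $ 3 + u $ 2 * w $ 1 * \<xi> $ 5 + u $ 2 * w $ 2 * \<xi> $ 7"
  "mult_of \<xi> u w $ 2 = u $ 1 * w $ 1 * \<xi> $ 2 + u $ 1 * w $ 2 * \<xi> $ 4 + u $ 2 * w $ 1 * \<xi> $ 6 + u $ 2 * w $ 2 * \<xi> $ 8"
  by (simp_all add: mult_of_def sum_2)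

lemma mult_of_inject:
  assumes "\<And>u w. mult_of \<xi> u w = mult_of \<eta> u w"
  shows "\<xi> = \<eta>"
proof -
  let ?e1 = "vector [1, 0] :: real^2" and ?e2 = "vector [0, 1] :: real^2"
  have "\<xi> $ m = \<eta> $ m" for m
    using assms[of ?e1 ?e1] assms[of ?e1 ?e2] assms[of ?e2 ?e1] assms[of ?e2 ?e2] exhaust_8[of m]
    by (auto simp: vector_2_eq mult_of_nth)
  then show ?thesis
    by (simp add: vec_eq_iff)
qed

lemma mult_of_gl_act:
  "mult_of (gl_act A \<xi>) u w = A *v mult_of \<xi> (matrix_inv A *v u) (matrix_inv A *v w)"
proof -
  have "mult_of (gl_act A \<xi>) u w $ k = (A *v mult_of \<xi> (matrix_inv A *v u) (matrix_inv A *v w)) $ k" for k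
  unfolding mult_of_def christoffel_gl_act transformed_symbol_def matrix_vector_mult_def sum_2 vec_lambda_beta
  christoffel_simps by algebra
  then show ?thesis by (simp add: vec_eq_iff)
qed

lemma matrix_inv_left: "invertible A \<Longrightarrow> matrix_inv A ** A = mat 1"
  and matrix_inv_right: "invertible A \<Longrightarrow> A ** matrix_inv A = mat 1"
  for A :: "real^'n^'n"
  unfolding invertible_def matrix_inv_def by (metis (mono_tags, lifting) someI_ex)+

lemma linearly_equivalent_iff:
  "linearly_equivalent \<xi> \<eta> \<longleftrightarrow>
    (\<exists>A. invertible A \<and> (\<forall>u w. mult_of \<eta> (A *v u) (A *v w) = A *v mult_of \<xi> u w))"
proof
  assume "linearly_equivalent \<xi> \<eta>"
  then obtain A where "invertible A" and \<eta>: "\<eta> = gl_act A \<xi>"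
    unfolding linearly_equivalent_def by blast
  then have "matrix_inv A *v (A *v u) = u" for u
    by (simp add: matrix_vector_mul_assoc matrix_inv_left)
  then show "\<exists>A. invertible A \<and> (\<forall>u w. mult_of \<eta> (A *v u) (A *v w) = A *v mult_of \<xi> u w)"
    using \<open>invertible A\<close> by (auto simp: \<eta> mult_of_gl_act)
next
  assume "\<exists>A. invertible A \<and> (\<forall>u w. mult_of \<eta> (A *v u) (A *v w) = A *v mult_of \<xi> u w)"
  then obtain A where A: "invertible A" and m: "\<And>u w. mult_of \<eta> (A *v u) (A *v w) = A *v mult_of \<xi> u w"
    by blast
  have "A *v (matrix_inv A *v u) = u" for u
    using A by (simp add: matrix_vector_mul_assoc matrix_inv_right)
  then have "mult_of \<eta> u w = mult_of (gl_act A \<xi>) u w" for u w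
    using m[of "matrix_inv A *v u" "matrix_inv A *v w"] by (simp add: mult_of_gl_act)
  then show "linearly_equivalent \<xi> \<eta>"
    using A mult_of_inject unfolding linearly_equivalent_def by blast
qed

lemma linearly_equivalent_trans:
  assumes "linearly_equivalent \<xi> \<zeta>" "linearly_equivalent \<zeta> \<eta>"
  shows "linearly_equivalent \<xi> \<eta>"
proof -
  obtain A B where "invertible A" "invertible B"
    "\<And>u w. mult_of \<zeta> (A *v u) (A *v w) = A *v mult_of \<xi> u w"
    "\<And>u w. mult_of \<eta> (B *v u) (B *v w) = B *v mult_of \<zeta> u w"
    using assms unfolding linearly_equivalent_iff by blast
  then show ?thesis
    unfolding linearly_equivalent_iff
    by (intro exI[of _ "B ** A"]) (simp add: invertible_mult flip: matrix_vector_mul_assoc)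
qed

text \<open>Exhibiting the new basis in the old coordinates spares computing with the inverse of the
  change of basis matrix.\<close>

lemma linearly_equivalent_basis:
  assumes "wedge u w \<noteq> 0"
    and "mult_of \<xi> u u = \<eta> $ 1 *\<^sub>R u + \<eta> $ 2 *\<^sub>R w" "mult_of \<xi> u w = \<eta> $ 3 *\<^sub>R u + \<eta> $ 4 *\<^sub>R w"
    and "mult_of \<xi> w u = \<eta> $ 5 *\<^sub>R u + \<eta> $ 6 *\<^sub>R w" "mult_of \<xi> w w = \<eta> $ 7 *\<^sub>R u + \<eta> $ 8 *\<^sub>R w"
  shows "linearly_equivalent \<xi> \<eta>"
proof -
  define B :: "real^2^2" where "B = (\<chi> p i. if i = 1 then u $ p else w $ p)"
  have Bv: "B *v t = t $ 1 *\<^sub>R u + t $ 2 *\<^sub>R w" for t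
    by (simp add: B_def matrix_vector_mult_def vector_2_eq sum_2)
  have "det B \<noteq> 0"
    using assms(1) by (simp add: B_def det_2 wedge_def algebra_simps)
  then have inv: "invertible B"
    by (simp add: invertible_det_nz)
  have mB: "mult_of \<xi> (B *v s) (B *v t) = B *v mult_of \<eta> s t" for s t
  proof -
    have "mult_of \<xi> (B *v s) (B *v t) = (s $ 1 * t $ 1) *\<^sub>R mult_of \<xi> u u + (s $ 1 * t $ 2) *\<^sub>R mult_of \<xi> u w
        + (s $ 2 * t $ 1) *\<^sub>R mult_of \<xi> w u + (s $ 2 * t $ 2) *\<^sub>R mult_of \<xi> w w"
      by (simp add: Bv vector_2_eq mult_of_nth algebra_simps)
    also have "\<dots> = B *v mult_of \<eta> s t"
      unfolding assms(2-5) by (simp add: Bv vector_2_eq mult_of_nth algebra_simps)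
    finally show ?thesis .
  qed
  let ?A = "matrix_inv B"
  have AB: "?A *v (B *v t) = t" "B *v (?A *v t) = t" for t
    using inv by (simp_all add: matrix_vector_mul_assoc matrix_inv_left matrix_inv_right)
  have "invertible ?A"
    using inv by (metis invertible_def matrix_inv_left matrix_inv_right)
  moreover have "mult_of \<eta> (?A *v s) (?A *v t) = ?A *v mult_of \<xi> s t" for s t
    using arg_cong[OF mB[of "?A *v s" "?A *v t"], of "\<lambda>z. ?A *v z"] by (simp add: AB)
  ultimately show ?thesis
    unfolding linearly_equivalent_iff by blast
qed

lemma linearly_equivalent_swap:
  "linearly_equivalent (vector [a, b, c, d, e, f, g, h]) (vector [h, g, f, e, d, c, b, a])"
  by (rule linearly_equivalent_basis[of "vector [0, 1]" "vector [1, 0]"])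
    (simp_all add: wedge_def vector_2_eq mult_of_nth)

text \<open>The parameter \<open>t\<close> is the torsion; the other parameters describe the
  symmetric part.\<close>

abbreviation triangular :: "real \<Rightarrow> real \<Rightarrow> real \<Rightarrow> real \<Rightarrow> real \<Rightarrow> real^8" where
  "triangular \<alpha> \<beta> t \<gamma> \<delta> \<equiv> vector [\<alpha>, 0, \<beta> + t, 0, \<beta> - t, 0, \<gamma>, \<delta>]"

lemma triangular_change:
  assumes "r \<noteq> 0" "s \<noteq> 0"
    and "\<alpha>' = r * \<alpha>" "\<beta>' = s * \<beta> + q * \<alpha>" "t' = s * t" "\<delta>' = s * \<delta>"
    and "r * \<gamma>' = s\<^sup>2 * \<gamma> + 2 * s * q * \<beta> + q\<^sup>2 * \<alpha> - s * q * \<delta>"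
  shows "linearly_equivalent (triangular \<alpha> \<beta> t \<gamma> \<delta>) (triangular \<alpha>' \<beta>' t' \<gamma>' \<delta>')"
proof (rule linearly_equivalent_basis[of "vector [r, 0]" "vector [q, s]"])
  show "wedge (vector [r, 0]) (vector [q, s]) \<noteq> 0"
    using assms(1,2) by (simp add: wedge_def)
qed (use assms(7) in \<open>simp_all add: assms(3-6) vector_2_eq mult_of_nth algebra_simps power2_eq_square\<close>)

text \<open>The basis consists of the invariant vector \<open>u\<close> and the orthogonal vector;
  products with \<open>u\<close> are multiples of \<open>u\<close>.\<close>

lemma invariant_direction_triangular:
  assumes "invariant_direction \<xi> u"
  obtains \<alpha> \<beta> t \<gamma> \<delta> where "linearly_equivalent \<xi> (triangular \<alpha> \<beta> t \<gamma> \<delta>)"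
proof -
  have "u \<noteq> 0" and W: "\<And>w. wedge u (mult_of \<xi> u w) = 0" "\<And>w. wedge u (mult_of \<xi> w u) = 0"
    using assms unfolding invariant_direction_def by blast+
  let ?w = "vector [- u $ 2, u $ 1] :: real^2"
  define N where "N = (u $ 1)\<^sup>2 + (u $ 2)\<^sup>2"
  have "N \<noteq> 0"
    using \<open>u \<noteq> 0\<close> by (simp add: N_def vector_2_eq sum_power2_eq_zero_iff)
  have wedge: "wedge u ?w = N"
    by (simp add: wedge_def N_def power2_eq_square)
  have dec: "m = ((u $ 1 * m $ 1 + u $ 2 * m $ 2) / N) *\<^sub>R u + (wedge u m / N) *\<^sub>R ?w" for m
    using \<open>N \<noteq> 0\<close> by (simp add: vector_2_eq wedge_def field_simps) (simp add: N_def power2_eq_square algebra_simps)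
  have "\<exists>k. m = k *\<^sub>R u" if "wedge u m = 0" for m
    using dec[of m] that by auto
  then obtain a b c where "mult_of \<xi> u u = a *\<^sub>R u" "mult_of \<xi> u ?w = b *\<^sub>R u" "mult_of \<xi> ?w u = c *\<^sub>R u"
    using W by metis
  moreover obtain g d where "mult_of \<xi> ?w ?w = g *\<^sub>R u + d *\<^sub>R ?w"
    using dec by blast
  ultimately have "linearly_equivalent \<xi> (triangular a ((b + c) / 2) ((b - c) / 2) g d)"
    using wedge \<open>N \<noteq> 0\<close> by (intro linearly_equivalent_basis[of u ?w]) (simp_all add: field_simps)
  then show thesis using that by blast
qed

text \<open>The list of models in the theorem, with the restrictions on the torsion. A predicate in
  one argument keeps the existence claims about equivalences short.\<close>

inductive listed :: "real^8 \<Rightarrow> bool" where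
  "listed (M6_0 T)"
| "T $ 1 = 0 \<Longrightarrow> listed (M6_1 T)"
| "T $ 1 * T $ 2 = 0 \<Longrightarrow> listed (M6_2 T)"
| "T $ 1 * T $ 2 = 0 \<Longrightarrow> listed (M6_3 T)"
| "T $ 2 = 0 \<Longrightarrow> listed (M6_4 T)"
| "T = 0 \<Longrightarrow> listed (M6_5 T)"
| "T $ 2 = 0 \<Longrightarrow> listed (M4_1 T)"
| "c \<noteq> 0 \<Longrightarrow> c \<noteq> - 1 \<Longrightarrow> T $ 2 = 0 \<Longrightarrow> listed (M4_2 c T)"
| "c \<noteq> 0 \<Longrightarrow> c \<noteq> - 1 \<Longrightarrow> T $ 2 = 0 \<Longrightarrow> listed (M4_3 c T)"
| "T $ 2 = 0 \<Longrightarrow> listed (M4_4 c T)"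
| "T $ 2 = 0 \<Longrightarrow> listed (M4_5 c T)"

lemmas M_defs = M6_0_def M6_1_def M6_2_def M6_3_def M6_4_def M6_5_def
  M4_1_def M4_2_def M4_3_def M4_4_def M4_5_def

lemma torsion_models [simp]:
  "torsion (M6_0 T) = T" "torsion (M6_1 T) = T" "torsion (M6_2 T) = T" "torsion (M6_3 T) = T"
  "torsion (M6_4 T) = T" "torsion (M6_5 T) = T" "torsion (M4_1 T) = T" "torsion (M4_2 c T) = T"
  "torsion (M4_3 c T) = T" "torsion (M4_4 c T) = T" "torsion (M4_5 c T) = T"
  by (simp_all add: vector_2_eq M_defs)

lemma triangular_models:
  "triangular 0 0 t 0 0 = M6_0 (vector [t, 0])"
  "triangular (- 1) 0 t 0 1 = M6_2 (vector [t, 0])"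
  "triangular 0 0 t 0 1 = M6_3 (vector [t, 0])"
  "triangular 0 0 t 1 0 = M6_4 (vector [t, 0])"
  "triangular (- 1) 1 t 0 2 = M4_1 (vector [t, 0])"
  "triangular (- 1) c t 0 (1 + 2 * c) = M4_2 c (vector [t, 0])"
  "triangular 0 c t 0 (1 + 2 * c) = M4_3 c (vector [t, 0])"
  "triangular 0 1 t c 2 = M4_4 c (vector [t, 0])"
  "triangular 1 0 t (1 + c\<^sup>2) (2 * c) = M4_5 c (vector [t, 0])"
  by (simp_all add: M_defs)

lemma listedI: "linearly_equivalent \<xi> \<eta> \<Longrightarrow> listed \<eta> \<Longrightarrow> \<exists>\<eta>. linearly_equivalent \<xi> \<eta> \<and> listed \<eta>"
  by blast

lemma listed_trans:
  assumes "linearly_equivalent \<xi> \<zeta>" "\<exists>\<eta>. linearly_equivalent \<zeta> \<eta> \<and> listed \<eta>"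
  shows "\<exists>\<eta>. linearly_equivalent \<xi> \<eta> \<and> listed \<eta>"
proof -
  obtain \<eta> where \<eta>: "linearly_equivalent \<zeta> \<eta>" "listed \<eta>"
    using assms(2) by blast
  from listedI[OF linearly_equivalent_trans[OF assms(1) \<eta>(1)] \<eta>(2)] show ?thesis .
qed

lemma triangular_models_listed:
  "listed (triangular 0 0 t 0 0)" "listed (triangular (- 1) 0 t 0 1)" "listed (triangular 0 0 t 0 1)"
  "listed (triangular 0 0 t 1 0)" "listed (triangular (- 1) 1 t 0 2)"
  "c \<noteq> 0 \<Longrightarrow> c \<noteq> - 1 \<Longrightarrow> listed (triangular (- 1) c t 0 (1 + 2 * c))"
  "c \<noteq> 0 \<Longrightarrow> c \<noteq> - 1 \<Longrightarrow> listed (triangular 0 c t 0 (1 + 2 * c))"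
  "listed (triangular 0 1 t c 2)" "listed (triangular 1 0 t (1 + c\<^sup>2) (2 * c))"
  unfolding triangular_models by (simp_all add: listed.intros)

text \<open>If \<open>\<alpha>\<close> is not zero, it is scaled to \<open>- 1\<close>, and
  \<open>\<beta>\<close> is removed. The Killing fields along the first axis are then, up to
  constants, \<open>exp x\<^sup>1\<close> times the solutions of an equation with characteristic
  polynomial \<open>r\<^sup>2 - \<delta> r - g\<close>, of discriminant \<open>D\<close>. A further
  change of basis shifts and scales the roots; the cases are two real roots, one of them 0 or not, a
  double root, 0 or not, and complex roots. Two real roots become 0 and 1, a nonzero double root
  becomes 0 and complex roots get imaginary part 1. If \<open>\<alpha> = 0\<close>, the second
  derivative of \<open>f\<close> in the direction 2 is \<open>\<gamma>\<close> times the first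
  derivative in the direction 1 plus \<open>\<delta> - 2 \<beta>\<close> times that in the direction
  2, and the cases are whether these coefficients and \<open>\<beta>\<close> vanish.\<close>

lemma triangular_listed:
  shows "\<exists>\<eta>. linearly_equivalent (triangular \<alpha> \<beta> t \<gamma> \<delta>) \<eta> \<and> listed \<eta>"
proof (cases "\<alpha> = 0")
  case True
  show ?thesis
  proof (cases "\<delta> = 2 * \<beta>")
    case eq: True
    consider "\<beta> \<noteq> 0" | "\<beta> = 0" "\<gamma> \<noteq> 0" | "\<beta> = 0" "\<gamma> = 0" by blast
    then show ?thesis
    proof cases
      case 1
      have "linearly_equivalent (triangular \<alpha> \<beta> t \<gamma> \<delta>) (triangular 0 1 (t / \<beta>) (\<gamma> / \<beta>\<^sup>2) 2)"
        by (rule triangular_change[where r = 1 and s = "1 / \<beta>" and q = 0]) (use True eq 1 in \<open>simp_all add: power_divide\<close>)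
      from listedI[OF this triangular_models_listed(8)] show ?thesis .
    next
      case 2
      have "linearly_equivalent (triangular \<alpha> \<beta> t \<gamma> \<delta>) (triangular 0 0 t 1 0)"
        by (rule triangular_change[where r = \<gamma> and s = 1 and q = 0]) (use True eq 2 in simp_all)
      from listedI[OF this triangular_models_listed(4)] show ?thesis .
    next
      case 3
      have "linearly_equivalent (triangular \<alpha> \<beta> t \<gamma> \<delta>) (triangular 0 0 t 0 0)"
        by (rule triangular_change[where r = 1 and s = 1 and q = 0]) (use True eq 3 in simp_all)
      from listedI[OF this triangular_models_listed(1)] show ?thesis .
    qed
  next
    case ne: False
    define s where "s = 1 / (\<delta> - 2 * \<beta>)"
    have s: "s \<noteq> 0" "s * \<delta> = 1 + 2 * (s * \<beta>)"
      using ne by (simp_all add: s_def field_simps)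
    have "s\<^sup>2 * \<gamma> + 2 * s * (s * \<gamma> * s) * \<beta> - s * (s * \<gamma> * s) * \<delta> = 0"
      using s(2) by algebra
    then have E: "linearly_equivalent (triangular \<alpha> \<beta> t \<gamma> \<delta>) (triangular 0 (s * \<beta>) (s * t) 0 (1 + 2 * (s * \<beta>)))"
      by (intro triangular_change[where r = 1 and s = s and q = "s * \<gamma> * s"]) (use True s in simp_all)
    consider "s * \<beta> \<noteq> 0" "s * \<beta> \<noteq> - 1" | "s * \<beta> = 0" | "s * \<beta> = - 1" by blast
    then show ?thesis
    proof cases
      case 1
      from listedI[OF E triangular_models_listed(7)[OF 1]] show ?thesis .
    next
      case 2
      then have "linearly_equivalent (triangular \<alpha> \<beta> t \<gamma> \<delta>) (triangular 0 0 (s * t) 0 1)"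
        using E unfolding 2 by simp
      from listedI[OF this triangular_models_listed(3)] show ?thesis .
    next
      case 3
      \<comment> \<open>minus the second basis vector is a unit of the symmetric part, which is the
        algebra of dual numbers\<close>
      then have "linearly_equivalent (triangular \<alpha> \<beta> t \<gamma> \<delta>) (triangular 0 (- 1) (s * t) 0 (- 1))"
        using E unfolding 3 by simp
      moreover have "linearly_equivalent (triangular 0 (- 1) (s * t) 0 (- 1)) (triangular 0 1 (- (s * t)) 0 1)"
        by (rule triangular_change[where r = 1 and s = "-1" and q = 0]) simp_all
      moreover have "linearly_equivalent (triangular 0 1 (- (s * t)) 0 1) (M6_1 (vector [0, s * t]))"
        using linearly_equivalent_swap[of 0 0 "1 - s * t" 0 "1 + s * t" 0 0 1] by (simp add: M6_1_def)
      ultimately have "linearly_equivalent (triangular \<alpha> \<beta> t \<gamma> \<delta>) (M6_1 (vector [0, s * t]))"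
        by (meson linearly_equivalent_trans)
      moreover have "listed (M6_1 (vector [0, s * t]))"
        by (simp add: listed.intros)
      ultimately show ?thesis by blast
    qed
  qed
next
  case False
  have "linearly_equivalent (triangular \<alpha> \<beta> t \<gamma> \<delta>) (triangular (- 1) 0 t (\<beta>\<^sup>2 - \<alpha> * \<gamma> - \<beta> * \<delta>) \<delta>)"
    by (rule triangular_change[where r = "- 1 / \<alpha>" and s = 1 and q = "- \<beta> / \<alpha>"])
       (use False in \<open>simp_all add: field_simps power2_eq_square\<close>)
  then obtain g where E: "linearly_equivalent (triangular \<alpha> \<beta> t \<gamma> \<delta>) (triangular (- 1) 0 t g \<delta>)"
    by blast
  note T = linearly_equivalent_trans[OF E]
  define D where "D = \<delta>\<^sup>2 + 4 * g"
  show ?thesis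
  proof (cases "g = 0 \<and> \<delta> \<noteq> 0")
    case True
    have "linearly_equivalent (triangular (- 1) 0 t g \<delta>) (triangular (- 1) 0 (t / \<delta>) 0 1)"
      by (rule triangular_change[where r = 1 and s = "1 / \<delta>" and q = 0]) (use True in simp_all)
    from listedI[OF T[OF this] triangular_models_listed(2)] show ?thesis .
  next
    case g: False
    consider "D > 0" | "D = 0" "\<delta> \<noteq> 0" | "D = 0" "\<delta> = 0" | "D < 0" by linarith
    then show ?thesis
    proof cases
      case 1
      then have "g \<noteq> 0"
        using g by (auto simp: D_def)
      define R where "R = sqrt D"
      have R: "R > 0" "R\<^sup>2 = D"
        using 1 by (simp_all add: R_def)
      define c where "c = (\<delta> - R) / 2 / R"
      have c: "\<delta> = R * (1 + 2 * c)"
        using R by (simp add: c_def field_simps)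
      have g_c: "g = - R\<^sup>2 * c * (1 + c)"
        using R(2) c unfolding D_def by algebra
      have "c \<noteq> 0" "c \<noteq> - 1"
        using \<open>g \<noteq> 0\<close> g_c by auto
      define s where "s = 1 / R"
      have s: "s \<noteq> 0" "s * R = 1"
        using R by (simp_all add: s_def)
      have "1 * 0 = s\<^sup>2 * g + 2 * s * (- c) * 0 + (- c)\<^sup>2 * (- 1) - s * (- c) * \<delta>" "1 + 2 * c = s * \<delta>"
        using s(2) g_c c by algebra+
      then have "linearly_equivalent (triangular (- 1) 0 t g \<delta>) (triangular (- 1) c (s * t) 0 (1 + 2 * c))"
        by (intro triangular_change[where r = 1 and s = s and q = "- c"]) (use s in simp_all)
      from listedI[OF T[OF this] triangular_models_listed(6)[OF \<open>c \<noteq> 0\<close> \<open>c \<noteq> - 1\<close>]] show ?thesis .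
    next
      case 2
      define s where "s = 2 / \<delta>"
      have s: "s \<noteq> 0" "2 = s * \<delta>"
        using 2 by (simp_all add: s_def)
      have "1 * 0 = s\<^sup>2 * g + 2 * s * (- 1) * 0 + (- 1)\<^sup>2 * (- 1) - s * (- 1) * \<delta>"
        using s(2) 2(1) unfolding D_def by algebra
      then have "linearly_equivalent (triangular (- 1) 0 t g \<delta>) (triangular (- 1) 1 (s * t) 0 2)"
        by (intro triangular_change[where r = 1 and s = s and q = "- 1"]) (use s in simp_all)
      from listedI[OF T[OF this] triangular_models_listed(5)] show ?thesis .
    next
      case 3
      then have "g = 0" by (simp add: D_def)
      \<comment> \<open>an idempotent spans the invariant direction, but \<open>M6_3\<close> has its
        idempotent in the second place\<close>
      have "linearly_equivalent (triangular (- 1) 0 t g \<delta>) (triangular 1 0 t 0 0)"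
        by (rule triangular_change[where r = "- 1" and s = 1 and q = 0]) (use 3 \<open>g = 0\<close> in simp_all)
      moreover have "linearly_equivalent (triangular 1 0 t 0 0) (M6_3 (vector [0, - t]))"
        using linearly_equivalent_swap[of 1 0 t 0 "- t" 0 0 0] by (simp add: M6_3_def)
      ultimately have "linearly_equivalent (triangular \<alpha> \<beta> t \<gamma> \<delta>) (M6_3 (vector [0, - t]))"
        by (meson T linearly_equivalent_trans)
      moreover have "listed (M6_3 (vector [0, - t]))"
        by (simp add: listed.intros)
      ultimately show ?thesis by blast
    next
      case 4
      define H where "H = sqrt (- D) / 2"
      have H: "H > 0" "H\<^sup>2 = - D / 4"
        using 4 by (simp_all add: H_def power_divide)
      define c where "c = \<delta> / (2 * H)"
      have c: "\<delta> = 2 * (H * c)"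
        using H by (simp add: c_def)
      have g_c: "g = - H\<^sup>2 * (1 + c\<^sup>2)"
        using H(2) unfolding D_def c by (simp add: power_mult_distrib field_simps)
      define s where "s = 1 / H"
      have s: "s \<noteq> 0" "s * H = 1"
        using H by (simp_all add: s_def)
      have "s\<^sup>2 * g = - 1 - c\<^sup>2" "2 * c = s * \<delta>"
        using s(2) g_c c by algebra+
      then have "linearly_equivalent (triangular (- 1) 0 t g \<delta>) (triangular 1 0 (s * t) (1 + c\<^sup>2) (2 * c))"
        by (intro triangular_change[where r = "- 1" and s = s and q = 0]) (use s in simp_all)
      from listedI[OF T[OF this] triangular_models_listed(9)] show ?thesis .
    qed
  qed
qed

text \<open>The algebra generated by a unit and an element with square \<open>\<kappa>\<close>: the
  sign of \<open>\<kappa>\<close> distinguishes the sum of two copies of the reals, the dual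
  numbers, and the complex numbers.\<close>

lemma unital_listed:
  "\<exists>\<eta>. linearly_equivalent (vector [1, 0, 0, 1, 0, 1, \<kappa>, 0]) \<eta> \<and> listed \<eta>"
proof -
  have listed0: "listed (M6_1 0)" "listed (M6_2 0)" "listed (M6_5 0)"
    by (simp_all add: listed.intros)
  consider "\<kappa> > 0" | "\<kappa> = 0" | "\<kappa> < 0" by linarith
  then show ?thesis
  proof cases
    case 1
    define r where "r = 1 / sqrt \<kappa>"
    have r: "r \<noteq> 0" "r * r * \<kappa> = 1"
      using 1 by (simp_all add: r_def)
    have "linearly_equivalent (vector [1, 0, 0, 1, 0, 1, \<kappa>, 0]) (M6_2 0)"
      by (rule linearly_equivalent_basis[of "vector [- 1 / 2, r / 2]" "vector [1 / 2, r / 2]"])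
         (use r in \<open>simp_all add: M_defs wedge_def vector_2_eq mult_of_nth field_simps\<close>)
    then show ?thesis using listed0 by blast
  next
    case 2
    have "linearly_equivalent (vector [1, 0, 0, 1, 0, 1, \<kappa>, 0]) (M6_1 0)"
      by (rule linearly_equivalent_basis[of "vector [1, 0]" "vector [0, 1]"])
         (simp_all add: 2 M_defs wedge_def vector_2_eq mult_of_nth)
    then show ?thesis using listed0 by blast
  next
    case 3
    define r where "r = 1 / sqrt (- \<kappa>)"
    have r: "r \<noteq> 0" "r * r * \<kappa> = - 1"
      using 3 by (simp_all add: r_def field_simps)
    have "linearly_equivalent (vector [1, 0, 0, 1, 0, 1, \<kappa>, 0]) (M6_5 0)"
      by (rule linearly_equivalent_basis[of "vector [1, 0]" "vector [0, r]"])
         (use r in \<open>simp_all add: M_defs wedge_def vector_2_eq mult_of_nth\<close>)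
    then show ?thesis using listed0 by blast
  qed
qed

text \<open>The algebra with basis \<open>x\<close>, \<open>x\<^sup>2\<close> and \<open>x\<^sup>3 =
  p x + q x\<^sup>2\<close>. For \<open>p\<close> not 0 it has the unit \<open>(x\<^sup>2 - q x) /
  p\<close>, and \<open>x - q / 2\<close> has square \<open>q\<^sup>2 / 4 + p\<close>. For \<open>p
  = 0\<close> and \<open>q\<close> not 0, \<open>x\<^sup>2 / q\<^sup>2\<close> is idempotent and
  \<open>x - x\<^sup>2 / q\<close> annihilates the algebra.\<close>

lemma monogenic_listed:
  "\<exists>\<eta>. linearly_equivalent (vector [0, 1, p, q, p, q, p * q, p + q\<^sup>2]) \<eta> \<and> listed \<eta>"
    (is "\<exists>\<eta>. linearly_equivalent ?\<zeta> \<eta> \<and> listed \<eta>")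
proof -
  have listed0: "listed (M6_3 0)" "listed (M6_4 0)"
    by (simp_all add: listed.intros)
  consider "p = 0" "q = 0" | "p = 0" "q \<noteq> 0" | "p \<noteq> 0" by blast
  then show ?thesis
  proof cases
    case 1
    have "linearly_equivalent ?\<zeta> (M6_4 0)"
      by (rule linearly_equivalent_basis[of "vector [0, 1]" "vector [1, 0]"])
         (simp_all add: 1 M_defs wedge_def vector_2_eq mult_of_nth)
    then show ?thesis using listed0 by blast
  next
    case 2
    have "linearly_equivalent ?\<zeta> (M6_3 0)"
      by (rule linearly_equivalent_basis[of "vector [1, - 1 / q]" "vector [0, 1 / q\<^sup>2]"])
         (use 2 in \<open>simp_all add: M_defs wedge_def vector_2_eq mult_of_nth field_simps power2_eq_square\<close>)
    then show ?thesis using listed0 by blast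
  next
    case 3
    have "linearly_equivalent ?\<zeta> (vector [1, 0, 0, 1, 0, 1, q\<^sup>2 / 4 + p, 0])"
      by (rule linearly_equivalent_basis[of "vector [- q / p, 1 / p]" "vector [1 + q\<^sup>2 / (2 * p), - q / (2 * p)]"])
         (use 3 in \<open>simp_all add: wedge_def vector_2_eq mult_of_nth field_simps power2_eq_square\<close>)
    from listed_trans[OF this unital_listed] show ?thesis .
  qed
qed

text \<open>If some \<open>x\<close> is independent of its square \<open>y\<close>, these generate
  the algebra. Otherwise squaring maps every vector to a multiple of itself, the product has the
  form \<open>(\<lambda>(u) w + \<lambda>(w) u) / 2\<close> with a linear form
  \<open>\<lambda>\<close>, and associativity forces \<open>\<lambda> = 0\<close>.\<close>

lemma associative_listed:
  assumes com: "\<And>u w. mult_of \<xi> u w = mult_of \<xi> w u"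
    and assoc: "\<And>u v w. mult_of \<xi> (mult_of \<xi> u v) w = mult_of \<xi> u (mult_of \<xi> v w)"
  shows "\<exists>\<eta>. linearly_equivalent \<xi> \<eta> \<and> listed \<eta>"
proof (cases "\<exists>x. wedge x (mult_of \<xi> x x) \<noteq> 0")
  case True
  then obtain x where x: "wedge x (mult_of \<xi> x x) \<noteq> 0" by blast
  define y where "y = mult_of \<xi> x x"
  have "\<exists>p q. m = p *\<^sub>R x + q *\<^sub>R y" for m
  proof -
    have "wedge x y *\<^sub>R m = wedge m y *\<^sub>R x + wedge x m *\<^sub>R y"
      by (simp add: vector_2_eq wedge_def algebra_simps)
    then have "inverse (wedge x y) *\<^sub>R (wedge x y *\<^sub>R m) = inverse (wedge x y) *\<^sub>R (wedge m y *\<^sub>R x + wedge x m *\<^sub>R y)"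
      by (rule arg_cong)
    then have "m = (inverse (wedge x y) * wedge m y) *\<^sub>R x + (inverse (wedge x y) * wedge x m) *\<^sub>R y"
      using x unfolding y_def[symmetric] scaleR_add_right scaleR_scaleR by simp
    then show ?thesis by blast
  qed
  then obtain p q where pq: "mult_of \<xi> x y = p *\<^sub>R x + q *\<^sub>R y"
    by blast
  have lin: "mult_of \<xi> x (a *\<^sub>R u + b *\<^sub>R v) = a *\<^sub>R mult_of \<xi> x u + b *\<^sub>R mult_of \<xi> x v" for a b u v
    by (simp add: vector_2_eq mult_of_nth algebra_simps)
  have "mult_of \<xi> y y = mult_of \<xi> x (mult_of \<xi> x y)"
    by (subst y_def) (simp add: assoc)
  also have "\<dots> = p *\<^sub>R y + q *\<^sub>R (p *\<^sub>R x + q *\<^sub>R y)"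
    by (simp only: pq lin flip: y_def)
  finally have yy: "mult_of \<xi> y y = (p * q) *\<^sub>R x + (p + q\<^sup>2) *\<^sub>R y"
    by (simp add: algebra_simps power2_eq_square)
  have "linearly_equivalent \<xi> (vector [0, 1, p, q, p, q, p * q, p + q\<^sup>2])"
    by (rule linearly_equivalent_basis[of x y])
       (use x pq yy com[of y x] in \<open>simp_all flip: y_def\<close>)
  from listed_trans[OF this monogenic_listed] show ?thesis .
next
  case False
  then have W: "wedge x (mult_of \<xi> x x) = 0" for x by blast
  let ?e = "\<lambda>s t. vector [s, t] :: real^2"
  have sym: "\<xi> $ 5 = \<xi> $ 3" "\<xi> $ 6 = \<xi> $ 4"
    using com[of "?e 1 0" "?e 0 1"] by (simp_all add: vector_2_eq mult_of_nth)
  have Z: "\<xi> $ 2 = 0" "\<xi> $ 7 = 0" "\<xi> $ 1 = 2 * \<xi> $ 4" "\<xi> $ 8 = 2 * \<xi> $ 3"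
    using W[of "?e 1 0"] W[of "?e 0 1"] W[of "?e 1 1"] W[of "?e 1 (- 1)"]
    by (simp_all add: wedge_def mult_of_nth sym)
  \<comment> \<open>here \<open>\<lambda> = (\<xi>$1, \<xi>$8)\<close>\<close>
  have "\<xi> $ 4 = 0" "\<xi> $ 3 = 0"
    using assoc[of "?e 1 0" "?e 1 0" "?e 0 1"] assoc[of "?e 0 1" "?e 0 1" "?e 1 0"]
    by (simp_all add: vector_2_eq mult_of_nth sym Z)
  then have "mult_of \<xi> u w = mult_of (M6_0 0) u w" for u w
    using sym Z by (simp add: vector_2_eq mult_of_nth M6_0_def)
  then have "\<xi> = M6_0 0"
    by (rule mult_of_inject)
  moreover have "linearly_equivalent (M6_0 0) (M6_0 0)"
    by (rule linearly_equivalent_basis[of "vector [1, 0]" "vector [0, 1]"])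
       (simp_all add: M_defs wedge_def vector_2_eq mult_of_nth)
  moreover have "listed (M6_0 0)"
    by (simp add: listed.intros)
  ultimately show ?thesis by blast
qed

lemma listed_if_nonconstant:
  assumes "KK \<xi> \<noteq> span {d1, d2}"
  shows "\<exists>\<eta>. linearly_equivalent \<xi> \<eta> \<and> listed \<eta>"
  using invariant_direction_or_associative[OF assms]
proof (elim disjE exE conjE)
  fix u assume "invariant_direction \<xi> u"
  then obtain \<alpha> \<beta> t \<gamma> \<delta> where "linearly_equivalent \<xi> (triangular \<alpha> \<beta> t \<gamma> \<delta>)"
    by (rule invariant_direction_triangular)
  from listed_trans[OF this triangular_listed] show ?thesis .
next
  assume "\<forall>u w. mult_of \<xi> u w = mult_of \<xi> w u"
    "\<forall>u v w. mult_of \<xi> (mult_of \<xi> u v) w = mult_of \<xi> u (mult_of \<xi> v w)"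
  then show ?thesis by (intro associative_listed) blast+
qed

section \<open>The Killing fields of the models\<close>

lemma d_nth [simp]: "d1 x $ 1 = 1" "d1 x $ 2 = 0" "d2 x $ 1 = 0" "d2 x $ 2 = 1"
  by (simp_all add: d1_def d2_def axis_def)

text \<open>The index pairs 12 and 21 have to be checked separately, since their difference encodes
  the torsion.\<close>

lemma killing_fieldI:
  assumes v: "\<And>x. v x $ 1 = f x" "\<And>x. v x $ 2 = g x" and "elem f" "elem g"
    and "\<And>x. partial 1 (partial 1 f) x = \<xi> $ 2 * partial 2 f x - \<xi> $ 1 * partial 1 f x - (\<xi> $ 3 + \<xi> $ 5) * partial 1 g x"
    and "\<And>x. partial 1 (partial 2 f) x = (\<xi> $ 4 - \<xi> $ 1) * partial 2 f x - \<xi> $ 3 * partial 2 g x - \<xi> $ 7 * partial 1 g x"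
    and "\<And>x. partial 2 (partial 1 f) x = (\<xi> $ 6 - \<xi> $ 1) * partial 2 f x - \<xi> $ 5 * partial 2 g x - \<xi> $ 7 * partial 1 g x"
    and "\<And>x. partial 2 (partial 2 f) x = \<xi> $ 7 * partial 1 f x + (\<xi> $ 8 - \<xi> $ 3 - \<xi> $ 5) * partial 2 f x - 2 * \<xi> $ 7 * partial 2 g x"
    and "\<And>x. partial 1 (partial 1 g) x = (\<xi> $ 1 - \<xi> $ 4 - \<xi> $ 6) * partial 1 g x + \<xi> $ 2 * partial 2 g x - 2 * \<xi> $ 2 * partial 1 f x"
    and "\<And>x. partial 1 (partial 2 g) x = (\<xi> $ 3 - \<xi> $ 8) * partial 1 g x - \<xi> $ 2 * partial 2 f x - \<xi> $ 4 * partial 1 f x"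
    and "\<And>x. partial 2 (partial 1 g) x = (\<xi> $ 5 - \<xi> $ 8) * partial 1 g x - \<xi> $ 2 * partial 2 f x - \<xi> $ 6 * partial 1 f x"
    and "\<And>x. partial 2 (partial 2 g) x = \<xi> $ 7 * partial 1 g x - \<xi> $ 8 * partial 2 g x - (\<xi> $ 4 + \<xi> $ 6) * partial 2 f x"
  shows "v \<in> KK \<xi>"
proof (rule killing_elemI)
  fix i j k
  have vk: "(\<lambda>x. v x $ 1) = f" "(\<lambda>x. v x $ 2) = g"
    using v by (simp_all add: fun_eq_iff)
  show "elem (\<lambda>x. v x $ k)"
    using exhaust_2[of k] assms(3,4) vk by auto
  show "partial i (partial j (\<lambda>y. v y $ k)) x =
     (\<Sum>l\<in>UNIV. christoffel \<xi> i j l * partial l (\<lambda>y. v y $ k) x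
              - christoffel \<xi> i l k * partial j (\<lambda>y. v y $ l) x
              - christoffel \<xi> l j k * partial i (\<lambda>y. v y $ l) x)" for x
    using exhaust_2[of i] exhaust_2[of j] exhaust_2[of k]
    by (elim disjE; hypsubst) (simp_all only: vk sum_2 christoffel_simps assms, simp_all add: algebra_simps)
qed

definition jet :: "(real^2 \<Rightarrow> real^2) \<Rightarrow> real \<times> real \<times> real \<times> real \<times> real \<times> real" where
  "jet v = (v 0 $ 1, v 0 $ 2, partial 1 (\<lambda>y. v y $ 1) 0, partial 2 (\<lambda>y. v y $ 1) 0,
     partial 1 (\<lambda>y. v y $ 2) 0, partial 2 (\<lambda>y. v y $ 2) 0)"

lemma KK_eq_span_jetI:
  assumes "B \<subseteq> KK \<xi>" and "\<And>v. v \<in> KK \<xi> \<Longrightarrow> \<exists>w\<in>span B. jet v = jet w"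
  shows "KK \<xi> = span B"
  using assms by (intro KK_eq_spanI) (auto simp: vector_2_eq forall_2 jet_def)

lemma torsion_factor:
  assumes "v \<in> KK \<xi>" "torsion \<xi> \<noteq> 0"
  obtains p q where "partial 1 (\<lambda>y. v y $ 1) 0 = torsion \<xi> $ 1 * p" "partial 1 (\<lambda>y. v y $ 2) 0 = torsion \<xi> $ 2 * p"
    "partial 2 (\<lambda>y. v y $ 1) 0 = torsion \<xi> $ 1 * q" "partial 2 (\<lambda>y. v y $ 2) 0 = torsion \<xi> $ 2 * q"
proof -
  let ?t = "torsion \<xi>"
  have "\<exists>p. a = ?t $ 1 * p \<and> b = ?t $ 2 * p" if "?t $ 1 * b = ?t $ 2 * a" for a b
    using that assms(2) unfolding vector_2_eq
    by (cases "?t $ 1 = 0") (auto intro: exI[of _ "b / ?t $ 2"] exI[of _ "a / ?t $ 1"] simp del: torsion_nth simp: field_simps)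
  from this[OF torsion_invariant[OF assms(1)]] show thesis
    using that by metis
qed

text \<open>A Ricci tensor with the 22 component as its only nonzero one kills the second component
  of the Jacobian, for every value of the torsion.\<close>

lemma killing_ricci:
  assumes "v \<in> KK \<xi>" "\<xi> $ 2 = 0" "\<xi> $ 4 + \<xi> $ 6 = 0"
    and "\<xi> $ 1 * \<xi> $ 7 + (\<xi> $ 3 + \<xi> $ 5) / 2 * \<xi> $ 8 - ((\<xi> $ 3 + \<xi> $ 5) / 2)\<^sup>2 \<noteq> 0"
  shows "partial 1 (\<lambda>y. v y $ 2) p = 0 \<and> partial 2 (\<lambda>y. v y $ 2) p = 0"
  using jet_system.ricci_invariant(2,3)[OF killing_jet_system[OF assms(1)], of p] assms(2-4)
  by (simp_all add: power2_eq_square)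

lemma torsion_direction:
  assumes "KK \<xi> \<noteq> span {d1, d2}" "torsion \<xi> \<noteq> 0"
  shows "wedge (torsion \<xi>) (mult_of \<xi> (torsion \<xi>) w) = 0"
proof -
  obtain v k j where v: "v \<in> KK \<xi>" and jet: "partial j (\<lambda>y. v y $ k) 0 \<noteq> 0"
    using killing_nonconstant[OF assms(1)] .
  have "wedge (torsion \<xi>) (torsion \<xi>) = 0"
    by (simp add: wedge_def)
  then have "invariant_direction \<xi> (torsion \<xi>)"
    using invariant_directionI[OF v assms(2) _ torsion_invariant[OF v] jet] by blast
  then show ?thesis
    by (simp add: invariant_direction_def)
qed

lemma torsion_direction_nth:
  assumes "KK \<xi> \<noteq> span {d1, d2}" "torsion \<xi> = T"
  shows "T $ 1 * (T $ 1 * \<xi> $ 2 + T $ 2 * \<xi> $ 6) = T $ 2 * (T $ 1 * \<xi> $ 1 + T $ 2 * \<xi> $ 5)"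
    "T $ 1 * (T $ 1 * \<xi> $ 4 + T $ 2 * \<xi> $ 8) = T $ 2 * (T $ 1 * \<xi> $ 3 + T $ 2 * \<xi> $ 7)"
proof -
  have W: "wedge T (mult_of \<xi> T w) = 0" for w
    using torsion_direction[OF assms(1)] assms(2) by (cases "T = 0") (auto simp: wedge_def)
  show "T $ 1 * (T $ 1 * \<xi> $ 2 + T $ 2 * \<xi> $ 6) = T $ 2 * (T $ 1 * \<xi> $ 1 + T $ 2 * \<xi> $ 5)"
    "T $ 1 * (T $ 1 * \<xi> $ 4 + T $ 2 * \<xi> $ 8) = T $ 2 * (T $ 1 * \<xi> $ 3 + T $ 2 * \<xi> $ 7)"
    using W[of "vector [1, 0]"] W[of "vector [0, 1]"] by (simp_all add: wedge_def mult_of_nth)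
qed

text \<open>A nonconstant Killing field makes a nonzero torsion vector an invariant direction; in
  each family this is a polynomial condition on its components.\<close>

lemma torsion_restriction:
  "KK (M6_1 T) \<noteq> span {d1, d2} \<Longrightarrow> T $ 1 = 0"
  "KK (M6_2 T) \<noteq> span {d1, d2} \<Longrightarrow> T $ 1 * T $ 2 = 0"
  "KK (M6_3 T) \<noteq> span {d1, d2} \<Longrightarrow> T $ 1 * T $ 2 = 0"
  "KK (M6_4 T) \<noteq> span {d1, d2} \<Longrightarrow> T $ 2 = 0"
  "KK (M6_5 T) \<noteq> span {d1, d2} \<Longrightarrow> T = 0"
  "KK (M4_1 T) \<noteq> span {d1, d2} \<Longrightarrow> T $ 2 = 0"
  "c \<noteq> 0 \<and> c \<noteq> -1 \<Longrightarrow> KK (M4_2 c T) \<noteq> span {d1, d2} \<Longrightarrow> T $ 2 = 0"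
  "c \<noteq> 0 \<and> c \<noteq> -1 \<Longrightarrow> KK (M4_3 c T) \<noteq> span {d1, d2} \<Longrightarrow> T $ 2 = 0"
  "KK (M4_4 c T) \<noteq> span {d1, d2} \<Longrightarrow> T $ 2 = 0"
  "KK (M4_5 c T) \<noteq> span {d1, d2} \<Longrightarrow> T $ 2 = 0"
proof -
  let ?p = "T $ 1" and ?q = "T $ 2"
  show "?p = 0" if "KK (M6_1 T) \<noteq> span {d1, d2}"
    using torsion_direction_nth(2)[OF that torsion_models(2)] by (simp add: M6_1_def algebra_simps)
  show "?p * ?q = 0" if "KK (M6_2 T) \<noteq> span {d1, d2}"
    using torsion_direction_nth(1)[OF that torsion_models(3)] by (simp add: M6_2_def algebra_simps)
  show "?p * ?q = 0" if "KK (M6_3 T) \<noteq> span {d1, d2}"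
    using torsion_direction_nth(2)[OF that torsion_models(4)] by (simp add: M6_3_def algebra_simps)
  show "?q = 0" if "KK (M6_4 T) \<noteq> span {d1, d2}"
    using torsion_direction_nth(2)[OF that torsion_models(5)] by (simp add: M6_4_def algebra_simps)
  show "T = 0" if "KK (M6_5 T) \<noteq> span {d1, d2}"
  proof -
    have "?p\<^sup>2 + ?q\<^sup>2 = 0"
      using torsion_direction_nth(2)[OF that torsion_models(6)]
      by (simp add: M6_5_def power2_eq_square algebra_simps)
    then show ?thesis
      by (simp add: sum_power2_eq_zero_iff vector_2_eq)
  qed
  show "?q = 0" if "KK (M4_1 T) \<noteq> span {d1, d2}"
  proof -
    have "?q * ?q = ?p * ?q" "?p * ?q = 0"
      using torsion_direction_nth[OF that torsion_models(7)] by (auto simp add: M4_1_def algebra_simps)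
    then show ?thesis by auto
  qed
  show "?q = 0" if c: "c \<noteq> 0 \<and> c \<noteq> -1" and "KK (M4_2 c T) \<noteq> span {d1, d2}"
  proof -
    have "?p * ?q = c * (?q * ?q)" "(1 + c) * (?p * ?q) = 0"
      using torsion_direction_nth[OF that(2) torsion_models(8)] by (simp_all add: M4_2_def algebra_simps)
    moreover have "1 + c \<noteq> 0" using c by auto
    ultimately show ?thesis using c by auto
  qed
  show "?q = 0" if c: "c \<noteq> 0 \<and> c \<noteq> -1" and "KK (M4_3 c T) \<noteq> span {d1, d2}"
    using torsion_direction_nth(1)[OF that(2) torsion_models(9)] c by (simp add: M4_3_def algebra_simps)
  show "?q = 0" if "KK (M4_4 c T) \<noteq> span {d1, d2}"
    using torsion_direction_nth(1)[OF that torsion_models(10)] by (simp add: M4_4_def algebra_simps)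
  show "?q = 0" if "KK (M4_5 c T) \<noteq> span {d1, d2}"
  proof -
    have "?p * ?q = 0" "?q * ?q * (1 + c\<^sup>2) = 2 * c * (?p * ?q)"
      using torsion_direction_nth[OF that torsion_models(11)] by (auto simp: M4_5_def algebra_simps)
    moreover have "1 + c\<^sup>2 \<noteq> 0"
      by (metis power_one sum_power2_eq_zero_iff zero_neq_one)
    ultimately show ?thesis by auto
  qed
qed

lemma only_translations:
  "T $ 1 \<noteq> 0 \<Longrightarrow> KK (M6_1 T) = span {d1, d2}"
  "T $ 1 * T $ 2 \<noteq> 0 \<Longrightarrow> KK (M6_2 T) = span {d1, d2}"
  "T $ 1 * T $ 2 \<noteq> 0 \<Longrightarrow> KK (M6_3 T) = span {d1, d2}"
  "T $ 2 \<noteq> 0 \<Longrightarrow> KK (M6_4 T) = span {d1, d2}"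
  "T \<noteq> 0 \<Longrightarrow> KK (M6_5 T) = span {d1, d2}"
  "T $ 2 \<noteq> 0 \<Longrightarrow> KK (M4_1 T) = span {d1, d2}"
  "c \<noteq> 0 \<and> c \<noteq> -1 \<Longrightarrow> T $ 2 \<noteq> 0 \<Longrightarrow> KK (M4_2 c T) = span {d1, d2}"
  "c \<noteq> 0 \<and> c \<noteq> -1 \<Longrightarrow> T $ 2 \<noteq> 0 \<Longrightarrow> KK (M4_3 c T) = span {d1, d2}"
  "T $ 2 \<noteq> 0 \<Longrightarrow> KK (M4_4 c T) = span {d1, d2}"
  "T $ 2 \<noteq> 0 \<Longrightarrow> KK (M4_5 c T) = span {d1, d2}"
  by (erule contrapos_np, erule torsion_restriction | assumption)+

lemmas killing_simps = partial_elem_simps algebra_simps power2_eq_square vector_2_eq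

text \<open>In each of the following proofs the coefficients of \<open>?w\<close> solve the linear
  system saying that \<open>?w\<close> has the same 1-jet at the origin as \<open>v\<close>. The
  system is solvable by the restrictions on the jet: none for the six torsion free models, otherwise
  those given by the torsion or by the Ricci tensor.\<close>

lemma M6_0_flat:
  assumes T: "T = 0"
  shows "KK (M6_0 T) = span {d1,
    d2,
    \<lambda>x. x$1 *\<^sub>R d1 x,
    \<lambda>x. x$1 *\<^sub>R d2 x,
    \<lambda>x. x$2 *\<^sub>R d1 x,
    \<lambda>x. x$2 *\<^sub>R d2 x}" (is "_ = span ?B")
proof (rule KK_eq_span_jetI)
  show "?B \<subseteq> KK (M6_0 T)"
  proof (intro insert_subsetI empty_subsetI d_in_KK)
    show "(\<lambda>x. x$1 *\<^sub>R d1 x) \<in> KK (M6_0 T)"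
      by (rule killing_fieldI[where f = "\<lambda>x. x$1" and g = "\<lambda>x. 0"])
         (use T in \<open>simp_all add: M6_0_def killing_simps\<close>)
    show "(\<lambda>x. x$1 *\<^sub>R d2 x) \<in> KK (M6_0 T)"
      by (rule killing_fieldI[where f = "\<lambda>x. 0" and g = "\<lambda>x. x$1"])
         (use T in \<open>simp_all add: M6_0_def killing_simps\<close>)
    show "(\<lambda>x. x$2 *\<^sub>R d1 x) \<in> KK (M6_0 T)"
      by (rule killing_fieldI[where f = "\<lambda>x. x$2" and g = "\<lambda>x. 0"])
         (use T in \<open>simp_all add: M6_0_def killing_simps\<close>)
    show "(\<lambda>x. x$2 *\<^sub>R d2 x) \<in> KK (M6_0 T)"
      by (rule killing_fieldI[where f = "\<lambda>x. 0" and g = "\<lambda>x. x$2"])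
         (use T in \<open>simp_all add: M6_0_def killing_simps\<close>)
  qed
next
  fix v assume v: "v \<in> KK (M6_0 T)"
  let ?X = "partial 1 (\<lambda>y. v y $ 1) 0" and ?Y = "partial 2 (\<lambda>y. v y $ 1) 0" and ?Z = "partial 1 (\<lambda>y. v y $ 2) 0" and ?W = "partial 2 (\<lambda>y. v y $ 2) 0"
  let ?w = "(v 0 $ 1) *\<^sub>R (d1) + (v 0 $ 2) *\<^sub>R (d2) + (?X) *\<^sub>R (\<lambda>x. x$1 *\<^sub>R d1 x) + (?Z) *\<^sub>R (\<lambda>x. x$1 *\<^sub>R d2 x) + (?Y) *\<^sub>R (\<lambda>x. x$2 *\<^sub>R d1 x) + (?W) *\<^sub>R (\<lambda>x. x$2 *\<^sub>R d2 x)"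
  have "?w \<in> span ?B"
    by (intro span_add span_scale span_base) simp_all
  moreover have "jet v = jet ?w"
    by (simp add: jet_def partial_elem_simps field_simps)
  ultimately show "\<exists>w\<in>span ?B. jet v = jet w"
    by blast
qed

lemma M6_0_torsion:
  assumes T: "T \<noteq> 0"
  shows "KK (M6_0 T) = span {d1,
    d2,
    \<lambda>x. x$1 *\<^sub>R (T$1 *\<^sub>R d1 x + T$2 *\<^sub>R d2 x),
    \<lambda>x. x$2 *\<^sub>R (T$1 *\<^sub>R d1 x + T$2 *\<^sub>R d2 x)}" (is "_ = span ?B")
proof (rule KK_eq_span_jetI)
  show "?B \<subseteq> KK (M6_0 T)"
  proof (intro insert_subsetI empty_subsetI d_in_KK)
    show "(\<lambda>x. x$1 *\<^sub>R (T$1 *\<^sub>R d1 x + T$2 *\<^sub>R d2 x)) \<in> KK (M6_0 T)"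
      by (rule killing_fieldI[where f = "\<lambda>x. x$1 * T$1" and g = "\<lambda>x. x$1 * T$2"])
         (use T in \<open>simp_all add: M6_0_def killing_simps\<close>)
    show "(\<lambda>x. x$2 *\<^sub>R (T$1 *\<^sub>R d1 x + T$2 *\<^sub>R d2 x)) \<in> KK (M6_0 T)"
      by (rule killing_fieldI[where f = "\<lambda>x. x$2 * T$1" and g = "\<lambda>x. x$2 * T$2"])
         (use T in \<open>simp_all add: M6_0_def killing_simps\<close>)
  qed
next
  fix v assume v: "v \<in> KK (M6_0 T)"
  let ?X = "partial 1 (\<lambda>y. v y $ 1) 0" and ?Y = "partial 2 (\<lambda>y. v y $ 1) 0" and ?Z = "partial 1 (\<lambda>y. v y $ 2) 0" and ?W = "partial 2 (\<lambda>y. v y $ 2) 0"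
  obtain p q where jet: "?X = T$1 * p" "?Z = T$2 * p" "?Y = T$1 * q" "?W = T$2 * q"
    using torsion_factor[OF v] T unfolding torsion_models by blast
  let ?w = "(v 0 $ 1) *\<^sub>R (d1) + (v 0 $ 2) *\<^sub>R (d2) + (p) *\<^sub>R (\<lambda>x. x$1 *\<^sub>R (T$1 *\<^sub>R d1 x + T$2 *\<^sub>R d2 x)) + (q) *\<^sub>R (\<lambda>x. x$2 *\<^sub>R (T$1 *\<^sub>R d1 x + T$2 *\<^sub>R d2 x))"
  have "?w \<in> span ?B"
    by (intro span_add span_scale span_base) simp_all
  moreover have "jet v = jet ?w"
    by (simp add: jet_def jet partial_elem_simps field_simps)
  ultimately show "\<exists>w\<in>span ?B. jet v = jet w"
    by blast
qed

lemma M6_1_flat: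
  assumes T: "T = 0"
  shows "KK (M6_1 T) = span {d1,
    \<lambda>x. exp (- x$1) *\<^sub>R (d1 x - x$2 *\<^sub>R d2 x),
    \<lambda>x. x$2 *\<^sub>R d2 x,
    \<lambda>x. x$2 *\<^sub>R (d1 x - x$2 *\<^sub>R d2 x),
    d2,
    \<lambda>x. exp (- x$1) *\<^sub>R d2 x}" (is "_ = span ?B")
proof (rule KK_eq_span_jetI)
  show "?B \<subseteq> KK (M6_1 T)"
  proof (intro insert_subsetI empty_subsetI d_in_KK)
    show "(\<lambda>x. exp (- x$1) *\<^sub>R (d1 x - x$2 *\<^sub>R d2 x)) \<in> KK (M6_1 T)"
      by (rule killing_fieldI[where f = "\<lambda>x. exp (- x$1)" and g = "\<lambda>x. - (exp (- x$1) * x$2)"])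
         (use T in \<open>simp_all add: M6_1_def killing_simps\<close>)
    show "(\<lambda>x. x$2 *\<^sub>R d2 x) \<in> KK (M6_1 T)"
      by (rule killing_fieldI[where f = "\<lambda>x. 0" and g = "\<lambda>x. x$2"])
         (use T in \<open>simp_all add: M6_1_def killing_simps\<close>)
    show "(\<lambda>x. x$2 *\<^sub>R (d1 x - x$2 *\<^sub>R d2 x)) \<in> KK (M6_1 T)"
      by (rule killing_fieldI[where f = "\<lambda>x. x$2" and g = "\<lambda>x. - (x$2 * x$2)"])
         (use T in \<open>simp_all add: M6_1_def killing_simps\<close>)
    show "(\<lambda>x. exp (- x$1) *\<^sub>R d2 x) \<in> KK (M6_1 T)"
      by (rule killing_fieldI[where f = "\<lambda>x. 0" and g = "\<lambda>x. exp (- x$1)"])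
         (use T in \<open>simp_all add: M6_1_def killing_simps\<close>)
  qed
next
  fix v assume v: "v \<in> KK (M6_1 T)"
  let ?X = "partial 1 (\<lambda>y. v y $ 1) 0" and ?Y = "partial 2 (\<lambda>y. v y $ 1) 0" and ?Z = "partial 1 (\<lambda>y. v y $ 2) 0" and ?W = "partial 2 (\<lambda>y. v y $ 2) 0"
  let ?w = "(v 0 $ 1 + ?X) *\<^sub>R (d1) + (- ?X) *\<^sub>R (\<lambda>x. exp (- x$1) *\<^sub>R (d1 x - x$2 *\<^sub>R d2 x)) + (?W - ?X) *\<^sub>R (\<lambda>x. x$2 *\<^sub>R d2 x) + (?Y) *\<^sub>R (\<lambda>x. x$2 *\<^sub>R (d1 x - x$2 *\<^sub>R d2 x)) + (v 0 $ 2 + ?Z) *\<^sub>R (d2) + (- ?Z) *\<^sub>R (\<lambda>x. exp (- x$1) *\<^sub>R d2 x)"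
  have "?w \<in> span ?B"
    by (intro span_add span_scale span_base) simp_all
  moreover have "jet v = jet ?w"
    by (simp add: jet_def partial_elem_simps field_simps)
  ultimately show "\<exists>w\<in>span ?B. jet v = jet w"
    by blast
qed

lemma M6_1_torsion:
  assumes T: "T$1 = 0 \<and> T$2 \<noteq> 0"
  shows "KK (M6_1 T) = span {d1,
    d2,
    \<lambda>x. x$2 *\<^sub>R d2 x,
    \<lambda>x. exp (- x$1) *\<^sub>R d2 x}" (is "_ = span ?B")
proof (rule KK_eq_span_jetI)
  show "?B \<subseteq> KK (M6_1 T)"
  proof (intro insert_subsetI empty_subsetI d_in_KK)
    show "(\<lambda>x. x$2 *\<^sub>R d2 x) \<in> KK (M6_1 T)"
      by (rule killing_fieldI[where f = "\<lambda>x. 0" and g = "\<lambda>x. x$2"])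
         (use T in \<open>simp_all add: M6_1_def killing_simps\<close>)
    show "(\<lambda>x. exp (- x$1) *\<^sub>R d2 x) \<in> KK (M6_1 T)"
      by (rule killing_fieldI[where f = "\<lambda>x. 0" and g = "\<lambda>x. exp (- x$1)"])
         (use T in \<open>simp_all add: M6_1_def killing_simps\<close>)
  qed
next
  fix v assume v: "v \<in> KK (M6_1 T)"
  let ?X = "partial 1 (\<lambda>y. v y $ 1) 0" and ?Y = "partial 2 (\<lambda>y. v y $ 1) 0" and ?Z = "partial 1 (\<lambda>y. v y $ 2) 0" and ?W = "partial 2 (\<lambda>y. v y $ 2) 0"
  have jet: "?X = 0" "?Y = 0"
    using torsion_invariant[OF v, of 1 0] torsion_invariant[OF v, of 2 0] T unfolding torsion_models by auto
  let ?w = "(v 0 $ 1) *\<^sub>R (d1) + (v 0 $ 2 + ?Z) *\<^sub>R (d2) + (?W) *\<^sub>R (\<lambda>x. x$2 *\<^sub>R d2 x) + (- ?Z) *\<^sub>R (\<lambda>x. exp (- x$1) *\<^sub>R d2 x)"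
  have "?w \<in> span ?B"
    by (intro span_add span_scale span_base) simp_all
  moreover have "jet v = jet ?w"
    by (simp add: jet_def jet partial_elem_simps field_simps)
  ultimately show "\<exists>w\<in>span ?B. jet v = jet w"
    by blast
qed

lemma M6_2_flat:
  assumes T: "T = 0"
  shows "KK (M6_2 T) = span {d1,
    \<lambda>x. exp (x$1) *\<^sub>R d1 x,
    \<lambda>x. exp (x$1 + x$2) *\<^sub>R d1 x,
    d2,
    \<lambda>x. exp (- x$1 - x$2) *\<^sub>R d2 x,
    \<lambda>x. exp (- x$2) *\<^sub>R d2 x}" (is "_ = span ?B")
proof (rule KK_eq_span_jetI)
  show "?B \<subseteq> KK (M6_2 T)"
  proof (intro insert_subsetI empty_subsetI d_in_KK)
    show "(\<lambda>x. exp (x$1) *\<^sub>R d1 x) \<in> KK (M6_2 T)"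
      by (rule killing_fieldI[where f = "\<lambda>x. exp (x$1)" and g = "\<lambda>x. 0"])
         (use T in \<open>simp_all add: M6_2_def killing_simps\<close>)
    show "(\<lambda>x. exp (x$1 + x$2) *\<^sub>R d1 x) \<in> KK (M6_2 T)"
      by (rule killing_fieldI[where f = "\<lambda>x. exp (x$1 + x$2)" and g = "\<lambda>x. 0"])
         (use T in \<open>simp_all add: M6_2_def killing_simps\<close>)
    show "(\<lambda>x. exp (- x$1 - x$2) *\<^sub>R d2 x) \<in> KK (M6_2 T)"
      by (rule killing_fieldI[where f = "\<lambda>x. 0" and g = "\<lambda>x. exp (- x$1 - x$2)"])
         (use T in \<open>simp_all add: M6_2_def killing_simps\<close>)
    show "(\<lambda>x. exp (- x$2) *\<^sub>R d2 x) \<in> KK (M6_2 T)"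
      by (rule killing_fieldI[where f = "\<lambda>x. 0" and g = "\<lambda>x. exp (- x$2)"])
         (use T in \<open>simp_all add: M6_2_def killing_simps\<close>)
  qed
next
  fix v assume v: "v \<in> KK (M6_2 T)"
  let ?X = "partial 1 (\<lambda>y. v y $ 1) 0" and ?Y = "partial 2 (\<lambda>y. v y $ 1) 0" and ?Z = "partial 1 (\<lambda>y. v y $ 2) 0" and ?W = "partial 2 (\<lambda>y. v y $ 2) 0"
  let ?w = "(v 0 $ 1 - ?X) *\<^sub>R (d1) + (?X - ?Y) *\<^sub>R (\<lambda>x. exp (x$1) *\<^sub>R d1 x) + (?Y) *\<^sub>R (\<lambda>x. exp (x$1 + x$2) *\<^sub>R d1 x) + (v 0 $ 2 + ?W) *\<^sub>R (d2) + (- ?Z) *\<^sub>R (\<lambda>x. exp (- x$1 - x$2) *\<^sub>R d2 x) + (?Z - ?W) *\<^sub>R (\<lambda>x. exp (- x$2) *\<^sub>R d2 x)"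
  have "?w \<in> span ?B"
    by (intro span_add span_scale span_base) simp_all
  moreover have "jet v = jet ?w"
    by (simp add: jet_def partial_elem_simps field_simps)
  ultimately show "\<exists>w\<in>span ?B. jet v = jet w"
    by blast
qed

lemma M6_2_torsion2:
  assumes T: "T$1 = 0 \<and> T$2 \<noteq> 0"
  shows "KK (M6_2 T) = span {d1,
    d2,
    \<lambda>x. exp (- x$1 - x$2) *\<^sub>R d2 x,
    \<lambda>x. exp (- x$2) *\<^sub>R d2 x}" (is "_ = span ?B")
proof (rule KK_eq_span_jetI)
  show "?B \<subseteq> KK (M6_2 T)"
  proof (intro insert_subsetI empty_subsetI d_in_KK)
    show "(\<lambda>x. exp (- x$1 - x$2) *\<^sub>R d2 x) \<in> KK (M6_2 T)"
      by (rule killing_fieldI[where f = "\<lambda>x. 0" and g = "\<lambda>x. exp (- x$1 - x$2)"])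
         (use T in \<open>simp_all add: M6_2_def killing_simps\<close>)
    show "(\<lambda>x. exp (- x$2) *\<^sub>R d2 x) \<in> KK (M6_2 T)"
      by (rule killing_fieldI[where f = "\<lambda>x. 0" and g = "\<lambda>x. exp (- x$2)"])
         (use T in \<open>simp_all add: M6_2_def killing_simps\<close>)
  qed
next
  fix v assume v: "v \<in> KK (M6_2 T)"
  let ?X = "partial 1 (\<lambda>y. v y $ 1) 0" and ?Y = "partial 2 (\<lambda>y. v y $ 1) 0" and ?Z = "partial 1 (\<lambda>y. v y $ 2) 0" and ?W = "partial 2 (\<lambda>y. v y $ 2) 0"
  have jet: "?X = 0" "?Y = 0"
    using torsion_invariant[OF v, of 1 0] torsion_invariant[OF v, of 2 0] T unfolding torsion_models by auto
  let ?w = "(v 0 $ 1) *\<^sub>R (d1) + (v 0 $ 2 + ?W) *\<^sub>R (d2) + (- ?Z) *\<^sub>R (\<lambda>x. exp (- x$1 - x$2) *\<^sub>R d2 x) + (?Z - ?W) *\<^sub>R (\<lambda>x. exp (- x$2) *\<^sub>R d2 x)"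
  have "?w \<in> span ?B"
    by (intro span_add span_scale span_base) simp_all
  moreover have "jet v = jet ?w"
    by (simp add: jet_def jet partial_elem_simps field_simps)
  ultimately show "\<exists>w\<in>span ?B. jet v = jet w"
    by blast
qed

lemma M6_2_torsion1:
  assumes T: "T$1 \<noteq> 0 \<and> T$2 = 0"
  shows "KK (M6_2 T) = span {d1,
    \<lambda>x. exp (x$1) *\<^sub>R d1 x,
    \<lambda>x. exp (x$1 + x$2) *\<^sub>R d1 x,
    d2}" (is "_ = span ?B")
proof (rule KK_eq_span_jetI)
  show "?B \<subseteq> KK (M6_2 T)"
  proof (intro insert_subsetI empty_subsetI d_in_KK)
    show "(\<lambda>x. exp (x$1) *\<^sub>R d1 x) \<in> KK (M6_2 T)"
      by (rule killing_fieldI[where f = "\<lambda>x. exp (x$1)" and g = "\<lambda>x. 0"])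
         (use T in \<open>simp_all add: M6_2_def killing_simps\<close>)
    show "(\<lambda>x. exp (x$1 + x$2) *\<^sub>R d1 x) \<in> KK (M6_2 T)"
      by (rule killing_fieldI[where f = "\<lambda>x. exp (x$1 + x$2)" and g = "\<lambda>x. 0"])
         (use T in \<open>simp_all add: M6_2_def killing_simps\<close>)
  qed
next
  fix v assume v: "v \<in> KK (M6_2 T)"
  let ?X = "partial 1 (\<lambda>y. v y $ 1) 0" and ?Y = "partial 2 (\<lambda>y. v y $ 1) 0" and ?Z = "partial 1 (\<lambda>y. v y $ 2) 0" and ?W = "partial 2 (\<lambda>y. v y $ 2) 0"
  have jet: "?Z = 0" "?W = 0"
    using torsion_invariant[OF v, of 1 0] torsion_invariant[OF v, of 2 0] T unfolding torsion_models by auto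
  let ?w = "(v 0 $ 1 - ?X) *\<^sub>R (d1) + (?X - ?Y) *\<^sub>R (\<lambda>x. exp (x$1) *\<^sub>R d1 x) + (?Y) *\<^sub>R (\<lambda>x. exp (x$1 + x$2) *\<^sub>R d1 x) + (v 0 $ 2) *\<^sub>R (d2)"
  have "?w \<in> span ?B"
    by (intro span_add span_scale span_base) simp_all
  moreover have "jet v = jet ?w"
    by (simp add: jet_def jet partial_elem_simps field_simps)
  ultimately show "\<exists>w\<in>span ?B. jet v = jet w"
    by blast
qed

lemma M6_3_flat:
  assumes T: "T = 0"
  shows "KK (M6_3 T) = span {d1,
    \<lambda>x. x$1 *\<^sub>R d1 x,
    \<lambda>x. exp (x$2) *\<^sub>R d1 x,
    d2,
    \<lambda>x. exp (- x$2) *\<^sub>R d2 x,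
    \<lambda>x. (x$1 * exp (- x$2)) *\<^sub>R d2 x}" (is "_ = span ?B")
proof (rule KK_eq_span_jetI)
  show "?B \<subseteq> KK (M6_3 T)"
  proof (intro insert_subsetI empty_subsetI d_in_KK)
    show "(\<lambda>x. x$1 *\<^sub>R d1 x) \<in> KK (M6_3 T)"
      by (rule killing_fieldI[where f = "\<lambda>x. x$1" and g = "\<lambda>x. 0"])
         (use T in \<open>simp_all add: M6_3_def killing_simps\<close>)
    show "(\<lambda>x. exp (x$2) *\<^sub>R d1 x) \<in> KK (M6_3 T)"
      by (rule killing_fieldI[where f = "\<lambda>x. exp (x$2)" and g = "\<lambda>x. 0"])
         (use T in \<open>simp_all add: M6_3_def killing_simps\<close>)
    show "(\<lambda>x. exp (- x$2) *\<^sub>R d2 x) \<in> KK (M6_3 T)"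
      by (rule killing_fieldI[where f = "\<lambda>x. 0" and g = "\<lambda>x. exp (- x$2)"])
         (use T in \<open>simp_all add: M6_3_def killing_simps\<close>)
    show "(\<lambda>x. (x$1 * exp (- x$2)) *\<^sub>R d2 x) \<in> KK (M6_3 T)"
      by (rule killing_fieldI[where f = "\<lambda>x. 0" and g = "\<lambda>x. (x$1 * exp (- x$2))"])
         (use T in \<open>simp_all add: M6_3_def killing_simps\<close>)
  qed
next
  fix v assume v: "v \<in> KK (M6_3 T)"
  let ?X = "partial 1 (\<lambda>y. v y $ 1) 0" and ?Y = "partial 2 (\<lambda>y. v y $ 1) 0" and ?Z = "partial 1 (\<lambda>y. v y $ 2) 0" and ?W = "partial 2 (\<lambda>y. v y $ 2) 0"
  let ?w = "(v 0 $ 1 - ?Y) *\<^sub>R (d1) + (?X) *\<^sub>R (\<lambda>x. x$1 *\<^sub>R d1 x) + (?Y) *\<^sub>R (\<lambda>x. exp (x$2) *\<^sub>R d1 x) + (v 0 $ 2 + ?W) *\<^sub>R (d2) + (- ?W) *\<^sub>R (\<lambda>x. exp (- x$2) *\<^sub>R d2 x) + (?Z) *\<^sub>R (\<lambda>x. (x$1 * exp (- x$2)) *\<^sub>R d2 x)"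
  have "?w \<in> span ?B"
    by (intro span_add span_scale span_base) simp_all
  moreover have "jet v = jet ?w"
    by (simp add: jet_def partial_elem_simps field_simps)
  ultimately show "\<exists>w\<in>span ?B. jet v = jet w"
    by blast
qed

lemma M6_3_torsion2:
  assumes T: "T$1 = 0 \<and> T$2 \<noteq> 0"
  shows "KK (M6_3 T) = span {d1,
    d2,
    \<lambda>x. exp (- x$2) *\<^sub>R d2 x,
    \<lambda>x. (x$1 * exp (- x$2)) *\<^sub>R d2 x}" (is "_ = span ?B")
proof (rule KK_eq_span_jetI)
  show "?B \<subseteq> KK (M6_3 T)"
  proof (intro insert_subsetI empty_subsetI d_in_KK)
    show "(\<lambda>x. exp (- x$2) *\<^sub>R d2 x) \<in> KK (M6_3 T)"
      by (rule killing_fieldI[where f = "\<lambda>x. 0" and g = "\<lambda>x. exp (- x$2)"])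
         (use T in \<open>simp_all add: M6_3_def killing_simps\<close>)
    show "(\<lambda>x. (x$1 * exp (- x$2)) *\<^sub>R d2 x) \<in> KK (M6_3 T)"
      by (rule killing_fieldI[where f = "\<lambda>x. 0" and g = "\<lambda>x. (x$1 * exp (- x$2))"])
         (use T in \<open>simp_all add: M6_3_def killing_simps\<close>)
  qed
next
  fix v assume v: "v \<in> KK (M6_3 T)"
  let ?X = "partial 1 (\<lambda>y. v y $ 1) 0" and ?Y = "partial 2 (\<lambda>y. v y $ 1) 0" and ?Z = "partial 1 (\<lambda>y. v y $ 2) 0" and ?W = "partial 2 (\<lambda>y. v y $ 2) 0"
  have jet: "?X = 0" "?Y = 0"
    using torsion_invariant[OF v, of 1 0] torsion_invariant[OF v, of 2 0] T unfolding torsion_models by auto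
  let ?w = "(v 0 $ 1) *\<^sub>R (d1) + (v 0 $ 2 + ?W) *\<^sub>R (d2) + (- ?W) *\<^sub>R (\<lambda>x. exp (- x$2) *\<^sub>R d2 x) + (?Z) *\<^sub>R (\<lambda>x. (x$1 * exp (- x$2)) *\<^sub>R d2 x)"
  have "?w \<in> span ?B"
    by (intro span_add span_scale span_base) simp_all
  moreover have "jet v = jet ?w"
    by (simp add: jet_def jet partial_elem_simps field_simps)
  ultimately show "\<exists>w\<in>span ?B. jet v = jet w"
    by blast
qed

lemma M6_3_torsion1:
  assumes T: "T$1 \<noteq> 0 \<and> T$2 = 0"
  shows "KK (M6_3 T) = span {d1,
    d2,
    \<lambda>x. x$1 *\<^sub>R d1 x,
    \<lambda>x. exp (x$2) *\<^sub>R d1 x}" (is "_ = span ?B")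
proof (rule KK_eq_span_jetI)
  show "?B \<subseteq> KK (M6_3 T)"
  proof (intro insert_subsetI empty_subsetI d_in_KK)
    show "(\<lambda>x. x$1 *\<^sub>R d1 x) \<in> KK (M6_3 T)"
      by (rule killing_fieldI[where f = "\<lambda>x. x$1" and g = "\<lambda>x. 0"])
         (use T in \<open>simp_all add: M6_3_def killing_simps\<close>)
    show "(\<lambda>x. exp (x$2) *\<^sub>R d1 x) \<in> KK (M6_3 T)"
      by (rule killing_fieldI[where f = "\<lambda>x. exp (x$2)" and g = "\<lambda>x. 0"])
         (use T in \<open>simp_all add: M6_3_def killing_simps\<close>)
  qed
next
  fix v assume v: "v \<in> KK (M6_3 T)"
  let ?X = "partial 1 (\<lambda>y. v y $ 1) 0" and ?Y = "partial 2 (\<lambda>y. v y $ 1) 0" and ?Z = "partial 1 (\<lambda>y. v y $ 2) 0" and ?W = "partial 2 (\<lambda>y. v y $ 2) 0"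
  have jet: "?Z = 0" "?W = 0"
    using torsion_invariant[OF v, of 1 0] torsion_invariant[OF v, of 2 0] T unfolding torsion_models by auto
  let ?w = "(v 0 $ 1 - ?Y) *\<^sub>R (d1) + (v 0 $ 2) *\<^sub>R (d2) + (?X) *\<^sub>R (\<lambda>x. x$1 *\<^sub>R d1 x) + (?Y) *\<^sub>R (\<lambda>x. exp (x$2) *\<^sub>R d1 x)"
  have "?w \<in> span ?B"
    by (intro span_add span_scale span_base) simp_all
  moreover have "jet v = jet ?w"
    by (simp add: jet_def jet partial_elem_simps field_simps)
  ultimately show "\<exists>w\<in>span ?B. jet v = jet w"
    by blast
qed

lemma M6_4_flat:
  assumes T: "T = 0"
  shows "KK (M6_4 T) = span {d1,
    d2,
    \<lambda>x. (x$1 + 1/2 * (x$2)\<^sup>2) *\<^sub>R d1 x,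
    \<lambda>x. x$2 *\<^sub>R d1 x,
    \<lambda>x. (- (x$1 * x$2) - 1/2 * (x$2)^3) *\<^sub>R d1 x + (x$1 + 1/2 * (x$2)\<^sup>2) *\<^sub>R d2 x,
    \<lambda>x. - ((x$2)\<^sup>2 *\<^sub>R d1 x) + x$2 *\<^sub>R d2 x}" (is "_ = span ?B")
proof (rule KK_eq_span_jetI)
  show "?B \<subseteq> KK (M6_4 T)"
  proof (intro insert_subsetI empty_subsetI d_in_KK)
    show "(\<lambda>x. (x$1 + 1/2 * (x$2)\<^sup>2) *\<^sub>R d1 x) \<in> KK (M6_4 T)"
      by (rule killing_fieldI[where f = "\<lambda>x. (x$1 + 1/2 * (x$2)\<^sup>2)" and g = "\<lambda>x. 0"])
         (use T in \<open>simp_all add: M6_4_def killing_simps\<close>)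
    show "(\<lambda>x. x$2 *\<^sub>R d1 x) \<in> KK (M6_4 T)"
      by (rule killing_fieldI[where f = "\<lambda>x. x$2" and g = "\<lambda>x. 0"])
         (use T in \<open>simp_all add: M6_4_def killing_simps\<close>)
    show "(\<lambda>x. (- (x$1 * x$2) - 1/2 * (x$2)^3) *\<^sub>R d1 x + (x$1 + 1/2 * (x$2)\<^sup>2) *\<^sub>R d2 x) \<in> KK (M6_4 T)"
      by (rule killing_fieldI[where f = "\<lambda>x. - (x$1 * x$2) - 1/2 * (x$2)^3" and g = "\<lambda>x. x$1 + 1/2 * (x$2)\<^sup>2"])
         (use T in \<open>simp_all add: M6_4_def killing_simps\<close>)
    show "(\<lambda>x. - ((x$2)\<^sup>2 *\<^sub>R d1 x) + x$2 *\<^sub>R d2 x) \<in> KK (M6_4 T)"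
      by (rule killing_fieldI[where f = "\<lambda>x. - (x$2)\<^sup>2" and g = "\<lambda>x. x$2"])
         (use T in \<open>simp_all add: M6_4_def killing_simps\<close>)
  qed
next
  fix v assume v: "v \<in> KK (M6_4 T)"
  let ?X = "partial 1 (\<lambda>y. v y $ 1) 0" and ?Y = "partial 2 (\<lambda>y. v y $ 1) 0" and ?Z = "partial 1 (\<lambda>y. v y $ 2) 0" and ?W = "partial 2 (\<lambda>y. v y $ 2) 0"
  let ?w = "(v 0 $ 1) *\<^sub>R (d1) + (v 0 $ 2) *\<^sub>R (d2) + (?X) *\<^sub>R (\<lambda>x. (x$1 + 1/2 * (x$2)\<^sup>2) *\<^sub>R d1 x) + (?Y) *\<^sub>R (\<lambda>x. x$2 *\<^sub>R d1 x) + (?Z) *\<^sub>R (\<lambda>x. (- (x$1 * x$2) - 1/2 * (x$2)^3) *\<^sub>R d1 x + (x$1 + 1/2 * (x$2)\<^sup>2) *\<^sub>R d2 x) + (?W) *\<^sub>R (\<lambda>x. - ((x$2)\<^sup>2 *\<^sub>R d1 x) + x$2 *\<^sub>R d2 x)"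
  have "?w \<in> span ?B"
    by (intro span_add span_scale span_base) simp_all
  moreover have "jet v = jet ?w"
    by (simp add: jet_def partial_elem_simps field_simps)
  ultimately show "\<exists>w\<in>span ?B. jet v = jet w"
    by blast
qed

lemma M6_4_torsion:
  assumes T: "T$1 \<noteq> 0 \<and> T$2 = 0"
  shows "KK (M6_4 T) = span {d1,
    d2,
    \<lambda>x. (x$1 + 1/2 * (x$2)\<^sup>2) *\<^sub>R d1 x,
    \<lambda>x. x$2 *\<^sub>R d1 x}" (is "_ = span ?B")
proof (rule KK_eq_span_jetI)
  show "?B \<subseteq> KK (M6_4 T)"
  proof (intro insert_subsetI empty_subsetI d_in_KK)
    show "(\<lambda>x. (x$1 + 1/2 * (x$2)\<^sup>2) *\<^sub>R d1 x) \<in> KK (M6_4 T)"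
      by (rule killing_fieldI[where f = "\<lambda>x. (x$1 + 1/2 * (x$2)\<^sup>2)" and g = "\<lambda>x. 0"])
         (use T in \<open>simp_all add: M6_4_def killing_simps\<close>)
    show "(\<lambda>x. x$2 *\<^sub>R d1 x) \<in> KK (M6_4 T)"
      by (rule killing_fieldI[where f = "\<lambda>x. x$2" and g = "\<lambda>x. 0"])
         (use T in \<open>simp_all add: M6_4_def killing_simps\<close>)
  qed
next
  fix v assume v: "v \<in> KK (M6_4 T)"
  let ?X = "partial 1 (\<lambda>y. v y $ 1) 0" and ?Y = "partial 2 (\<lambda>y. v y $ 1) 0" and ?Z = "partial 1 (\<lambda>y. v y $ 2) 0" and ?W = "partial 2 (\<lambda>y. v y $ 2) 0"
  have jet: "?Z = 0" "?W = 0"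
    using torsion_invariant[OF v, of 1 0] torsion_invariant[OF v, of 2 0] T unfolding torsion_models by auto
  let ?w = "(v 0 $ 1) *\<^sub>R (d1) + (v 0 $ 2) *\<^sub>R (d2) + (?X) *\<^sub>R (\<lambda>x. (x$1 + 1/2 * (x$2)\<^sup>2) *\<^sub>R d1 x) + (?Y) *\<^sub>R (\<lambda>x. x$2 *\<^sub>R d1 x)"
  have "?w \<in> span ?B"
    by (intro span_add span_scale span_base) simp_all
  moreover have "jet v = jet ?w"
    by (simp add: jet_def jet partial_elem_simps field_simps)
  ultimately show "\<exists>w\<in>span ?B. jet v = jet w"
    by blast
qed

lemma M6_5_flat:
  assumes T: "T = 0"
  shows "KK (M6_5 T) = span {d1,
    d2,
    \<lambda>x. cos (2 * x$2) *\<^sub>R d1 x - sin (2 * x$2) *\<^sub>R d2 x,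
    \<lambda>x. sin (2 * x$2) *\<^sub>R d1 x + cos (2 * x$2) *\<^sub>R d2 x,
    \<lambda>x. exp (- x$1) *\<^sub>R (cos (x$2) *\<^sub>R d1 x - sin (x$2) *\<^sub>R d2 x),
    \<lambda>x. exp (- x$1) *\<^sub>R (sin (x$2) *\<^sub>R d1 x + cos (x$2) *\<^sub>R d2 x)}" (is "_ = span ?B")
proof (rule KK_eq_span_jetI)
  show "?B \<subseteq> KK (M6_5 T)"
  proof (intro insert_subsetI empty_subsetI d_in_KK)
    show "(\<lambda>x. cos (2 * x$2) *\<^sub>R d1 x - sin (2 * x$2) *\<^sub>R d2 x) \<in> KK (M6_5 T)"
      by (rule killing_fieldI[where f = "\<lambda>x. cos (2 * x$2)" and g = "\<lambda>x. - sin (2 * x$2)"])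
         (use T in \<open>simp_all add: M6_5_def killing_simps\<close>)
    show "(\<lambda>x. sin (2 * x$2) *\<^sub>R d1 x + cos (2 * x$2) *\<^sub>R d2 x) \<in> KK (M6_5 T)"
      by (rule killing_fieldI[where f = "\<lambda>x. sin (2 * x$2)" and g = "\<lambda>x. cos (2 * x$2)"])
         (use T in \<open>simp_all add: M6_5_def killing_simps\<close>)
    show "(\<lambda>x. exp (- x$1) *\<^sub>R (cos (x$2) *\<^sub>R d1 x - sin (x$2) *\<^sub>R d2 x)) \<in> KK (M6_5 T)"
      by (rule killing_fieldI[where f = "\<lambda>x. exp (- x$1) * cos (x$2)" and g = "\<lambda>x. - (exp (- x$1) * sin (x$2))"])
         (use T in \<open>simp_all add: M6_5_def killing_simps\<close>)
    show "(\<lambda>x. exp (- x$1) *\<^sub>R (sin (x$2) *\<^sub>R d1 x + cos (x$2) *\<^sub>R d2 x)) \<in> KK (M6_5 T)"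
      by (rule killing_fieldI[where f = "\<lambda>x. exp (- x$1) * sin (x$2)" and g = "\<lambda>x. exp (- x$1) * cos (x$2)"])
         (use T in \<open>simp_all add: M6_5_def killing_simps\<close>)
  qed
next
  fix v assume v: "v \<in> KK (M6_5 T)"
  let ?X = "partial 1 (\<lambda>y. v y $ 1) 0" and ?Y = "partial 2 (\<lambda>y. v y $ 1) 0" and ?Z = "partial 1 (\<lambda>y. v y $ 2) 0" and ?W = "partial 2 (\<lambda>y. v y $ 2) 0"
  let ?w = "(v 0 $ 1 + (?X + ?W) / 2) *\<^sub>R (d1) + (v 0 $ 2 + (?Z - ?Y) / 2) *\<^sub>R (d2) + ((?X - ?W) / 2) *\<^sub>R (\<lambda>x. cos (2 * x$2) *\<^sub>R d1 x - sin (2 * x$2) *\<^sub>R d2 x) + ((?Y + ?Z) / 2) *\<^sub>R (\<lambda>x. sin (2 * x$2) *\<^sub>R d1 x + cos (2 * x$2) *\<^sub>R d2 x) + (- ?X) *\<^sub>R (\<lambda>x. exp (- x$1) *\<^sub>R (cos (x$2) *\<^sub>R d1 x - sin (x$2) *\<^sub>R d2 x)) + (- ?Z) *\<^sub>R (\<lambda>x. exp (- x$1) *\<^sub>R (sin (x$2) *\<^sub>R d1 x + cos (x$2) *\<^sub>R d2 x))"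
  have "?w \<in> span ?B"
    by (intro span_add span_scale span_base) simp_all
  moreover have "jet v = jet ?w"
    by (simp add: jet_def partial_elem_simps field_simps)
  ultimately show "\<exists>w\<in>span ?B. jet v = jet w"
    by blast
qed

lemma M4_1_span:
  assumes T: "T$2 = 0"
  shows "KK (M4_1 T) = span {d1,
    d2,
    \<lambda>x. exp (x$1) *\<^sub>R d1 x,
    \<lambda>x. (x$2 * exp (x$1)) *\<^sub>R d1 x}" (is "_ = span ?B")
proof (rule KK_eq_span_jetI)
  show "?B \<subseteq> KK (M4_1 T)"
  proof (intro insert_subsetI empty_subsetI d_in_KK)
    show "(\<lambda>x. exp (x$1) *\<^sub>R d1 x) \<in> KK (M4_1 T)"
      by (rule killing_fieldI[where f = "\<lambda>x. exp (x$1)" and g = "\<lambda>x. 0"])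
         (use T in \<open>simp_all add: M4_1_def killing_simps\<close>)
    show "(\<lambda>x. (x$2 * exp (x$1)) *\<^sub>R d1 x) \<in> KK (M4_1 T)"
      by (rule killing_fieldI[where f = "\<lambda>x. (x$2 * exp (x$1))" and g = "\<lambda>x. 0"])
         (use T in \<open>simp_all add: M4_1_def killing_simps\<close>)
  qed
next
  fix v assume v: "v \<in> KK (M4_1 T)"
  let ?X = "partial 1 (\<lambda>y. v y $ 1) 0" and ?Y = "partial 2 (\<lambda>y. v y $ 1) 0" and ?Z = "partial 1 (\<lambda>y. v y $ 2) 0" and ?W = "partial 2 (\<lambda>y. v y $ 2) 0"
   have jet: "?Z = 0 \<and> ?W = 0"
    using T by (intro killing_ricci[OF v]) (simp_all add: M4_1_def power2_eq_square algebra_simps)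
  let ?w = "(v 0 $ 1 - ?X) *\<^sub>R (d1) + (v 0 $ 2) *\<^sub>R (d2) + (?X) *\<^sub>R (\<lambda>x. exp (x$1) *\<^sub>R d1 x) + (?Y) *\<^sub>R (\<lambda>x. (x$2 * exp (x$1)) *\<^sub>R d1 x)"
  have "?w \<in> span ?B"
    by (intro span_add span_scale span_base) simp_all
  moreover have "jet v = jet ?w"
    by (simp add: jet_def jet partial_elem_simps field_simps)
  ultimately show "\<exists>w\<in>span ?B. jet v = jet w"
    by blast
qed

lemma M4_2_span:
  assumes c: "c \<noteq> 0 \<and> c \<noteq> -1" and T: "T$2 = 0"
  shows "KK (M4_2 c T) = span {d1,
    d2,
    \<lambda>x. exp (x$1) *\<^sub>R d1 x,
    \<lambda>x. exp (x$1 + x$2) *\<^sub>R d1 x}" (is "_ = span ?B")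
proof (rule KK_eq_span_jetI)
  show "?B \<subseteq> KK (M4_2 c T)"
  proof (intro insert_subsetI empty_subsetI d_in_KK)
    show "(\<lambda>x. exp (x$1) *\<^sub>R d1 x) \<in> KK (M4_2 c T)"
      by (rule killing_fieldI[where f = "\<lambda>x. exp (x$1)" and g = "\<lambda>x. 0"])
         (use T in \<open>simp_all add: M4_2_def killing_simps\<close>)
    show "(\<lambda>x. exp (x$1 + x$2) *\<^sub>R d1 x) \<in> KK (M4_2 c T)"
      by (rule killing_fieldI[where f = "\<lambda>x. exp (x$1 + x$2)" and g = "\<lambda>x. 0"])
         (use T in \<open>simp_all add: M4_2_def killing_simps\<close>)
  qed
next
  fix v assume v: "v \<in> KK (M4_2 c T)"
  let ?X = "partial 1 (\<lambda>y. v y $ 1) 0" and ?Y = "partial 2 (\<lambda>y. v y $ 1) 0" and ?Z = "partial 1 (\<lambda>y. v y $ 2) 0" and ?W = "partial 2 (\<lambda>y. v y $ 2) 0"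
  have "c * (1 + c) \<noteq> 0"
    using c by (auto simp: add_eq_0_iff)
  then have jet: "?Z = 0 \<and> ?W = 0"
    using T by (intro killing_ricci[OF v]) (simp_all add: M4_2_def power2_eq_square algebra_simps)
  let ?w = "(v 0 $ 1 - ?X) *\<^sub>R (d1) + (v 0 $ 2) *\<^sub>R (d2) + (?X - ?Y) *\<^sub>R (\<lambda>x. exp (x$1) *\<^sub>R d1 x) + (?Y) *\<^sub>R (\<lambda>x. exp (x$1 + x$2) *\<^sub>R d1 x)"
  have "?w \<in> span ?B"
    by (intro span_add span_scale span_base) simp_all
  moreover have "jet v = jet ?w"
    by (simp add: jet_def jet partial_elem_simps field_simps)
  ultimately show "\<exists>w\<in>span ?B. jet v = jet w"
    by blast
qed

lemma M4_3_span:
  assumes c: "c \<noteq> 0 \<and> c \<noteq> -1" and T: "T$2 = 0"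
  shows "KK (M4_3 c T) = span {d1,
    d2,
    \<lambda>x. exp (x$2) *\<^sub>R d1 x,
    \<lambda>x. x$1 *\<^sub>R d1 x}" (is "_ = span ?B")
proof (rule KK_eq_span_jetI)
  show "?B \<subseteq> KK (M4_3 c T)"
  proof (intro insert_subsetI empty_subsetI d_in_KK)
    show "(\<lambda>x. exp (x$2) *\<^sub>R d1 x) \<in> KK (M4_3 c T)"
      by (rule killing_fieldI[where f = "\<lambda>x. exp (x$2)" and g = "\<lambda>x. 0"])
         (use T in \<open>simp_all add: M4_3_def killing_simps\<close>)
    show "(\<lambda>x. x$1 *\<^sub>R d1 x) \<in> KK (M4_3 c T)"
      by (rule killing_fieldI[where f = "\<lambda>x. x$1" and g = "\<lambda>x. 0"])
         (use T in \<open>simp_all add: M4_3_def killing_simps\<close>)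
  qed
next
  fix v assume v: "v \<in> KK (M4_3 c T)"
  let ?X = "partial 1 (\<lambda>y. v y $ 1) 0" and ?Y = "partial 2 (\<lambda>y. v y $ 1) 0" and ?Z = "partial 1 (\<lambda>y. v y $ 2) 0" and ?W = "partial 2 (\<lambda>y. v y $ 2) 0"
  have "c * (1 + c) \<noteq> 0"
    using c by (auto simp: add_eq_0_iff)
  then have jet: "?Z = 0 \<and> ?W = 0"
    using T by (intro killing_ricci[OF v]) (simp_all add: M4_3_def power2_eq_square algebra_simps)
  let ?w = "(v 0 $ 1 - ?Y) *\<^sub>R (d1) + (v 0 $ 2) *\<^sub>R (d2) + (?Y) *\<^sub>R (\<lambda>x. exp (x$2) *\<^sub>R d1 x) + (?X) *\<^sub>R (\<lambda>x. x$1 *\<^sub>R d1 x)"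
  have "?w \<in> span ?B"
    by (intro span_add span_scale span_base) simp_all
  moreover have "jet v = jet ?w"
    by (simp add: jet_def jet partial_elem_simps field_simps)
  ultimately show "\<exists>w\<in>span ?B. jet v = jet w"
    by blast
qed

lemma M4_4_span:
  assumes T: "T$2 = 0"
  shows "KK (M4_4 c T) = span {d1,
    d2,
    \<lambda>x. (x$1 + c/2 * (x$2)\<^sup>2) *\<^sub>R d1 x,
    \<lambda>x. x$2 *\<^sub>R d1 x}" (is "_ = span ?B")
proof (rule KK_eq_span_jetI)
  show "?B \<subseteq> KK (M4_4 c T)"
  proof (intro insert_subsetI empty_subsetI d_in_KK)
    show "(\<lambda>x. (x$1 + c/2 * (x$2)\<^sup>2) *\<^sub>R d1 x) \<in> KK (M4_4 c T)"
      by (rule killing_fieldI[where f = "\<lambda>x. (x$1 + c/2 * (x$2)\<^sup>2)" and g = "\<lambda>x. 0"])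
         (use T in \<open>simp_all add: M4_4_def killing_simps\<close>)
    show "(\<lambda>x. x$2 *\<^sub>R d1 x) \<in> KK (M4_4 c T)"
      by (rule killing_fieldI[where f = "\<lambda>x. x$2" and g = "\<lambda>x. 0"])
         (use T in \<open>simp_all add: M4_4_def killing_simps\<close>)
  qed
next
  fix v assume v: "v \<in> KK (M4_4 c T)"
  let ?X = "partial 1 (\<lambda>y. v y $ 1) 0" and ?Y = "partial 2 (\<lambda>y. v y $ 1) 0" and ?Z = "partial 1 (\<lambda>y. v y $ 2) 0" and ?W = "partial 2 (\<lambda>y. v y $ 2) 0"
   have jet: "?Z = 0 \<and> ?W = 0"
    using T by (intro killing_ricci[OF v]) (simp_all add: M4_4_def power2_eq_square algebra_simps)
  let ?w = "(v 0 $ 1) *\<^sub>R (d1) + (v 0 $ 2) *\<^sub>R (d2) + (?X) *\<^sub>R (\<lambda>x. (x$1 + c/2 * (x$2)\<^sup>2) *\<^sub>R d1 x) + (?Y) *\<^sub>R (\<lambda>x. x$2 *\<^sub>R d1 x)"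
  have "?w \<in> span ?B"
    by (intro span_add span_scale span_base) simp_all
  moreover have "jet v = jet ?w"
    by (simp add: jet_def jet partial_elem_simps field_simps)
  ultimately show "\<exists>w\<in>span ?B. jet v = jet w"
    by blast
qed

lemma M4_5_span:
  assumes T: "T$2 = 0"
  shows "KK (M4_5 c T) = span {d1,
    d2,
    \<lambda>x. (exp (- x$1 + c * x$2) * cos (x$2)) *\<^sub>R d1 x,
    \<lambda>x. (exp (- x$1 + c * x$2) * sin (x$2)) *\<^sub>R d1 x}" (is "_ = span ?B")
proof (rule KK_eq_span_jetI)
  show "?B \<subseteq> KK (M4_5 c T)"
  proof (intro insert_subsetI empty_subsetI d_in_KK)
    show "(\<lambda>x. (exp (- x$1 + c * x$2) * cos (x$2)) *\<^sub>R d1 x) \<in> KK (M4_5 c T)"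
      by (rule killing_fieldI[where f = "\<lambda>x. (exp (- x$1 + c * x$2) * cos (x$2))" and g = "\<lambda>x. 0"])
         (use T in \<open>simp_all add: M4_5_def killing_simps\<close>)
    show "(\<lambda>x. (exp (- x$1 + c * x$2) * sin (x$2)) *\<^sub>R d1 x) \<in> KK (M4_5 c T)"
      by (rule killing_fieldI[where f = "\<lambda>x. (exp (- x$1 + c * x$2) * sin (x$2))" and g = "\<lambda>x. 0"])
         (use T in \<open>simp_all add: M4_5_def killing_simps\<close>)
  qed
next
  fix v assume v: "v \<in> KK (M4_5 c T)"
  let ?X = "partial 1 (\<lambda>y. v y $ 1) 0" and ?Y = "partial 2 (\<lambda>y. v y $ 1) 0" and ?Z = "partial 1 (\<lambda>y. v y $ 2) 0" and ?W = "partial 2 (\<lambda>y. v y $ 2) 0"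
  have "1 + c * c \<noteq> 0"
    using zero_le_square[of c] by linarith
  then have jet: "?Z = 0 \<and> ?W = 0"
    using T by (intro killing_ricci[OF v]) (simp_all add: M4_5_def power2_eq_square algebra_simps)
  let ?w = "(v 0 $ 1 + ?X) *\<^sub>R (d1) + (v 0 $ 2) *\<^sub>R (d2) + (- ?X) *\<^sub>R (\<lambda>x. (exp (- x$1 + c * x$2) * cos (x$2)) *\<^sub>R d1 x) + (?Y + c * ?X) *\<^sub>R (\<lambda>x. (exp (- x$1 + c * x$2) * sin (x$2)) *\<^sub>R d1 x)"
  have "?w \<in> span ?B"
    by (intro span_add span_scale span_base) simp_all
  moreover have "jet v = jet ?w"
    by (simp add: jet_def jet partial_elem_simps field_simps)
  ultimately show "\<exists>w\<in>span ?B. jet v = jet w"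
    by blast
qed

section \<open>The listed_if_nonconstant theorem\<close>

lemma listed_cases_torsion:
  assumes "listed \<eta>"
  shows "\<exists>T. torsion \<eta> = T \<and>
        (\<eta> = M6_0 T
         \<or> \<eta> = M6_1 T \<and> T$1 = 0
         \<or> \<eta> = M6_2 T \<and> T$1 * T$2 = 0
         \<or> \<eta> = M6_3 T \<and> T$1 * T$2 = 0
         \<or> \<eta> = M6_4 T \<and> T$2 = 0
         \<or> \<eta> = M6_5 T \<and> T = 0
         \<or> \<eta> = M4_1 T \<and> T$2 = 0
         \<or> (\<exists>c. c \<noteq> 0 \<and> c \<noteq> -1 \<and> \<eta> = M4_2 c T \<and> T$2 = 0)
         \<or> (\<exists>c. c \<noteq> 0 \<and> c \<noteq> -1 \<and> \<eta> = M4_3 c T \<and> T$2 = 0)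
         \<or> (\<exists>c. \<eta> = M4_4 c T \<and> T$2 = 0)
         \<or> (\<exists>c. \<eta> = M4_5 c T \<and> T$2 = 0))"
  using assms
proof cases
  case (1 T)
  then have "torsion \<eta> = T" by (simp only: torsion_models)
  with 1 show ?thesis by (intro exI[of _ T] conjI) blast+
next
  case (2 T)
  then have "torsion \<eta> = T" by (simp only: torsion_models)
  with 2 show ?thesis by (intro exI[of _ T] conjI) blast+
next
  case (3 T)
  then have "torsion \<eta> = T" by (simp only: torsion_models)
  with 3 show ?thesis by (intro exI[of _ T] conjI) blast+
next
  case (4 T)
  then have "torsion \<eta> = T" by (simp only: torsion_models)
  with 4 show ?thesis by (intro exI[of _ T] conjI) blast+
next
  case (5 T)
  then have "torsion \<eta> = T" by (simp only: torsion_models)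
  with 5 show ?thesis by (intro exI[of _ T] conjI) blast+
next
  case (6 T)
  then have "torsion \<eta> = T" by (simp only: torsion_models)
  with 6 show ?thesis by (intro exI[of _ T] conjI) blast+
next
  case (7 T)
  then have "torsion \<eta> = T" by (simp only: torsion_models)
  with 7 show ?thesis by (intro exI[of _ T] conjI) blast+
next
  case (8 c T)
  then have "torsion \<eta> = T" by (simp only: torsion_models)
  with 8 show ?thesis by (intro exI[of _ T] conjI) blast+
next
  case (9 c T)
  then have "torsion \<eta> = T" by (simp only: torsion_models)
  with 9 show ?thesis by (intro exI[of _ T] conjI) blast+
next
  case (10 T c)
  then have "torsion \<eta> = T" by (simp only: torsion_models)
  with 10 show ?thesis by (intro exI[of _ T] conjI) blast+
next
  case (11 T c)
  then have "torsion \<eta> = T" by (simp only: torsion_models)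
  with 11 show ?thesis by (intro exI[of _ T] conjI) blast+
qed

lemma classification_with_torsion:
  assumes "dim (KK \<xi>) > 2"
  shows "\<exists>\<eta> T. linearly_equivalent \<xi> \<eta> \<and> torsion \<eta> = T \<and>
        (\<eta> = M6_0 T
         \<or> \<eta> = M6_1 T \<and> T$1 = 0
         \<or> \<eta> = M6_2 T \<and> T$1 * T$2 = 0
         \<or> \<eta> = M6_3 T \<and> T$1 * T$2 = 0
         \<or> \<eta> = M6_4 T \<and> T$2 = 0
         \<or> \<eta> = M6_5 T \<and> T = 0
         \<or> \<eta> = M4_1 T \<and> T$2 = 0
         \<or> (\<exists>c. c \<noteq> 0 \<and> c \<noteq> -1 \<and> \<eta> = M4_2 c T \<and> T$2 = 0)
         \<or> (\<exists>c. c \<noteq> 0 \<and> c \<noteq> -1 \<and> \<eta> = M4_3 c T \<and> T$2 = 0)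
         \<or> (\<exists>c. \<eta> = M4_4 c T \<and> T$2 = 0)
         \<or> (\<exists>c. \<eta> = M4_5 c T \<and> T$2 = 0))"
proof -
  obtain \<eta> where \<eta>: "linearly_equivalent \<xi> \<eta>" "listed \<eta>"
    using listed_if_nonconstant[OF dim_gt_2[OF assms]] by blast
  then show ?thesis
    using listed_cases_torsion by blast
qed

theorem mainTheorem3:
  shows
  "(\<forall>\<xi>. dim (KK \<xi>) > 2 \<longrightarrow>
      (\<exists>\<eta> T. linearly_equivalent \<xi> \<eta> \<and> torsion \<eta> = T \<and>
        (\<eta> = M6_0 T
         \<or> \<eta> = M6_1 T \<and> T$1 = 0
         \<or> \<eta> = M6_2 T \<and> T$1 * T$2 = 0
         \<or> \<eta> = M6_3 T \<and> T$1 * T$2 = 0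
         \<or> \<eta> = M6_4 T \<and> T$2 = 0
         \<or> \<eta> = M6_5 T \<and> T = 0
         \<or> \<eta> = M4_1 T \<and> T$2 = 0
         \<or> (\<exists>c. c \<noteq> 0 \<and> c \<noteq> -1 \<and> \<eta> = M4_2 c T \<and> T$2 = 0)
         \<or> (\<exists>c. c \<noteq> 0 \<and> c \<noteq> -1 \<and> \<eta> = M4_3 c T \<and> T$2 = 0)
         \<or> (\<exists>c. \<eta> = M4_4 c T \<and> T$2 = 0)
         \<or> (\<exists>c. \<eta> = M4_5 c T \<and> T$2 = 0))))
   \<and>
   (\<forall>T.
      (T = 0 \<longrightarrow> KK (M6_0 T) = span {d1, d2,
         \<lambda>x. x$1 *\<^sub>R d1 x, \<lambda>x. x$1 *\<^sub>R d2 x, \<lambda>x. x$2 *\<^sub>R d1 x, \<lambda>x. x$2 *\<^sub>R d2 x}) \<and>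
      (T \<noteq> 0 \<longrightarrow> KK (M6_0 T) = span {d1, d2,
         \<lambda>x. x$1 *\<^sub>R (T$1 *\<^sub>R d1 x + T$2 *\<^sub>R d2 x),
         \<lambda>x. x$2 *\<^sub>R (T$1 *\<^sub>R d1 x + T$2 *\<^sub>R d2 x)}))
   \<and>
   (\<forall>T.
      (dim (KK (M6_1 T)) > 2 \<longrightarrow> T$1 = 0) \<and>
      (T = 0 \<longrightarrow> KK (M6_1 T) = span {d1,
         \<lambda>x. exp (- x$1) *\<^sub>R (d1 x - x$2 *\<^sub>R d2 x),
         \<lambda>x. x$2 *\<^sub>R d2 x,
         \<lambda>x. x$2 *\<^sub>R (d1 x - x$2 *\<^sub>R d2 x),
         d2,
         \<lambda>x. exp (- x$1) *\<^sub>R d2 x}) \<and>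
      (T$1 = 0 \<and> T$2 \<noteq> 0 \<longrightarrow> KK (M6_1 T) = span {d1, d2,
         \<lambda>x. x$2 *\<^sub>R d2 x,
         \<lambda>x. exp (- x$1) *\<^sub>R d2 x}) \<and>
      (T$1 \<noteq> 0 \<longrightarrow> KK (M6_1 T) = span {d1, d2}))
   \<and>
   (\<forall>T.
      (dim (KK (M6_2 T)) > 2 \<longrightarrow> T$1 * T$2 = 0) \<and>
      (T = 0 \<longrightarrow> KK (M6_2 T) = span {d1,
         \<lambda>x. exp (x$1) *\<^sub>R d1 x,
         \<lambda>x. exp (x$1 + x$2) *\<^sub>R d1 x,
         d2,
         \<lambda>x. exp (- x$1 - x$2) *\<^sub>R d2 x,
         \<lambda>x. exp (- x$2) *\<^sub>R d2 x}) \<and>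
      (T$1 = 0 \<and> T$2 \<noteq> 0 \<longrightarrow> KK (M6_2 T) = span {d1, d2,
         \<lambda>x. exp (- x$1 - x$2) *\<^sub>R d2 x,
         \<lambda>x. exp (- x$2) *\<^sub>R d2 x}) \<and>
      (T$1 \<noteq> 0 \<and> T$2 = 0 \<longrightarrow> KK (M6_2 T) = span {d1,
         \<lambda>x. exp (x$1) *\<^sub>R d1 x,
         \<lambda>x. exp (x$1 + x$2) *\<^sub>R d1 x,
         d2}) \<and>
      (T$1 * T$2 \<noteq> 0 \<longrightarrow> KK (M6_2 T) = span {d1, d2}))
   \<and>
   (\<forall>T.
      (dim (KK (M6_3 T)) > 2 \<longrightarrow> T$1 * T$2 = 0) \<and>
      (T = 0 \<longrightarrow> KK (M6_3 T) = span {d1,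
         \<lambda>x. x$1 *\<^sub>R d1 x,
         \<lambda>x. exp (x$2) *\<^sub>R d1 x,
         d2,
         \<lambda>x. exp (- x$2) *\<^sub>R d2 x,
         \<lambda>x. (x$1 * exp (- x$2)) *\<^sub>R d2 x}) \<and>
      (T$1 = 0 \<and> T$2 \<noteq> 0 \<longrightarrow> KK (M6_3 T) = span {d1, d2,
         \<lambda>x. exp (- x$2) *\<^sub>R d2 x,
         \<lambda>x. (x$1 * exp (- x$2)) *\<^sub>R d2 x}) \<and>
      (T$1 \<noteq> 0 \<and> T$2 = 0 \<longrightarrow> KK (M6_3 T) = span {d1, d2,
         \<lambda>x. x$1 *\<^sub>R d1 x,
         \<lambda>x. exp (x$2) *\<^sub>R d1 x}) \<and>
      (T$1 * T$2 \<noteq> 0 \<longrightarrow> KK (M6_3 T) = span {d1, d2}))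
   \<and>
   (\<forall>T.
      (dim (KK (M6_4 T)) > 2 \<longrightarrow> T$2 = 0) \<and>
      (T = 0 \<longrightarrow> KK (M6_4 T) = span {d1, d2,
         \<lambda>x. (x$1 + 1/2 * (x$2)\<^sup>2) *\<^sub>R d1 x,
         \<lambda>x. x$2 *\<^sub>R d1 x,
         \<lambda>x. (- (x$1 * x$2) - 1/2 * (x$2)^3) *\<^sub>R d1 x + (x$1 + 1/2 * (x$2)\<^sup>2) *\<^sub>R d2 x,
         \<lambda>x. - ((x$2)\<^sup>2 *\<^sub>R d1 x) + x$2 *\<^sub>R d2 x}) \<and>
      (T$1 \<noteq> 0 \<and> T$2 = 0 \<longrightarrow> KK (M6_4 T) = span {d1, d2,
         \<lambda>x. (x$1 + 1/2 * (x$2)\<^sup>2) *\<^sub>R d1 x,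
         \<lambda>x. x$2 *\<^sub>R d1 x}) \<and>
      (T$2 \<noteq> 0 \<longrightarrow> KK (M6_4 T) = span {d1, d2}))
   \<and>
   (\<forall>T.
      (dim (KK (M6_5 T)) > 2 \<longrightarrow> T = 0) \<and>
      (T = 0 \<longrightarrow> KK (M6_5 T) = span {d1, d2,
         \<lambda>x. cos (2 * x$2) *\<^sub>R d1 x - sin (2 * x$2) *\<^sub>R d2 x,
         \<lambda>x. sin (2 * x$2) *\<^sub>R d1 x + cos (2 * x$2) *\<^sub>R d2 x,
         \<lambda>x. exp (- x$1) *\<^sub>R (cos (x$2) *\<^sub>R d1 x - sin (x$2) *\<^sub>R d2 x),
         \<lambda>x. exp (- x$1) *\<^sub>R (sin (x$2) *\<^sub>R d1 x + cos (x$2) *\<^sub>R d2 x)}) \<and>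
      (T \<noteq> 0 \<longrightarrow> KK (M6_5 T) = span {d1, d2}))
   \<and>
   (\<forall>T.
      (dim (KK (M4_1 T)) > 2 \<longrightarrow> T$2 = 0) \<and>
      (T$2 = 0 \<longrightarrow> KK (M4_1 T) = span {d1, d2,
         \<lambda>x. exp (x$1) *\<^sub>R d1 x,
         \<lambda>x. (x$2 * exp (x$1)) *\<^sub>R d1 x}) \<and>
      (T$2 \<noteq> 0 \<longrightarrow> KK (M4_1 T) = span {d1, d2}))
   \<and>
   (\<forall>c T. c \<noteq> 0 \<and> c \<noteq> -1 \<longrightarrow>
      (dim (KK (M4_2 c T)) > 2 \<longrightarrow> T$2 = 0) \<and>
      (T$2 = 0 \<longrightarrow> KK (M4_2 c T) = span {d1, d2,
         \<lambda>x. exp (x$1) *\<^sub>R d1 x,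
         \<lambda>x. exp (x$1 + x$2) *\<^sub>R d1 x}) \<and>
      (T$2 \<noteq> 0 \<longrightarrow> KK (M4_2 c T) = span {d1, d2}))
   \<and>
   (\<forall>c T. c \<noteq> 0 \<and> c \<noteq> -1 \<longrightarrow>
      (dim (KK (M4_3 c T)) > 2 \<longrightarrow> T$2 = 0) \<and>
      (T$2 = 0 \<longrightarrow> KK (M4_3 c T) = span {d1, d2,
         \<lambda>x. exp (x$2) *\<^sub>R d1 x,
         \<lambda>x. x$1 *\<^sub>R d1 x}) \<and>
      (T$2 \<noteq> 0 \<longrightarrow> KK (M4_3 c T) = span {d1, d2}))
   \<and>
   (\<forall>c T.
      (dim (KK (M4_4 c T)) > 2 \<longrightarrow> T$2 = 0) \<and>
      (T$2 = 0 \<longrightarrow> KK (M4_4 c T) = span {d1, d2,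
         \<lambda>x. (x$1 + c/2 * (x$2)\<^sup>2) *\<^sub>R d1 x,
         \<lambda>x. x$2 *\<^sub>R d1 x}) \<and>
      (T$2 \<noteq> 0 \<longrightarrow> KK (M4_4 c T) = span {d1, d2}))
   \<and>
   (\<forall>c T.
      (dim (KK (M4_5 c T)) > 2 \<longrightarrow> T$2 = 0) \<and>
      (T$2 = 0 \<longrightarrow> KK (M4_5 c T) = span {d1, d2,
         \<lambda>x. (exp (- x$1 + c * x$2) * cos (x$2)) *\<^sub>R d1 x,
         \<lambda>x. (exp (- x$1 + c * x$2) * sin (x$2)) *\<^sub>R d1 x}) \<and>
      (T$2 \<noteq> 0 \<longrightarrow> KK (M4_5 c T) = span {d1, d2}))"
  by (intro conjI allI impI)
    (rule classification_with_torsion M6_0_flat M6_0_torsion M6_1_flat M6_1_torsion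
      M6_2_flat M6_2_torsion2 M6_2_torsion1 M6_3_flat M6_3_torsion2 M6_3_torsion1 M6_4_flat M6_4_torsion
      M6_5_flat M4_1_span M4_2_span M4_3_span M4_4_span M4_5_span only_translations
      torsion_restriction(1-6,9,10)[OF dim_gt_2] torsion_restriction(7,8)[OF _ dim_gt_2]; assumption)+

end
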